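(* Let $\Psi$ be a branching mechanism satisfying Grey's condition and $\Phi$ an immigration mechanism, and consider the $\mathrm{CBI}(\Psi,\Phi)$ process. Let $\theta>0$ be such that $\Psi(u)>0$ for all $u\ge\theta$. (i) The state $0$ is polar if and only if $$\int_\theta^\infty\exp\left[\int_\theta^z\frac{\Phi(u)}{\Psi(u)}\,\mathrm du\right]\frac{1}{\Psi(z)}\,\mathrm dz=\infty.$$ Assume further that $\Psi$ is critical or subcritical, i.e. $\Psi'(0+)\ge0$. Then the state $0$ is (ii) transient if and only if $$\int_\theta^\infty\exp\left[\int_\theta^z\frac{\Phi(u)}{\Psi(u)}\,\mathrm du\right]\frac{1}{\Psi(z)}\,\mathrm dz<\infty\quad\text{and}\quad\int_0^\theta\exp\left[-\int_x^\theta\frac{\Phi(s)}{\Psi(s)}\,\mathrm ds\right]\frac{\mathrm dx}{\Psi(x)}<\infty;$$ (iii) recurrent if and only if $$\int_\theta^\infty\exp\left[\int_\theta^z\frac{\Phi(u)}{\Psi(u)}\,\mathrm du\right]\frac{1}{\Psi(z)}\,\mathrm dz<\infty\quad\text{and}\quad\int_0^\theta\exp\left[-\int_x^\theta\frac{\Phi(s)}{\Psi(s)}\,\mathrm ds\right]\frac{\mathrm dx}{\Psi(x)}=\infty.$$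
   Context: Mechanisms. A branching mechanism is a function $\Psi(q)=dq+\frac12\sigma^2q^2+\int_0^\infty(e^{-qu}-1+qu\mathbf 1_{u\in(0,1)})\,\nu_1(\mathrm du)$, $q\ge0$, with $d\in\mathbb R$, $\sigma^2\ge0$ and $\nu_1$ a measure on $(0,\infty)$ with $\int_0^\infty(1\wedge u^2)\nu_1(\mathrm du)<\infty$. An immigration mechanism is a function $\Phi(q)=\beta q+\int_0^\infty(1-e^{-qu})\,\nu_0(\mathrm du)$, $q\ge 0$, with $\beta\ge0$ and $\int_0^\infty(1\wedge u)\nu_0(\mathrm du)<\infty$. CBI. For $q>0$ let $v_t(q)$ solve $v_t(q)=q-\int_0^t\Psi(v_s(q))\,\mathrm ds$. A $\mathrm{CBI}(\Psi,\Phi)$ (continuous-state branching process with immigration) started at $x\ge0$ is the càdlàg Markov process $Y$ with $Y_0=x$ (law $\mathbb P_x$) and $\mathbb E_x[e^{-qY_t}]=\exp\left(-xv_t(q)-\int_0^t\Phi(v_s(q))\,\mathrm ds\right)$ for all $q>0,t\ge0$. Grey's condition: there exists $\theta>0$ such that $\Psi(z)>0$ for all $z\ge\theta$ and $\int_\theta^\infty\frac{\mathrm dq}{\Psi(q)}<\infty$. Let $\mathcal Z=\overline{\{t\ge0:Y_t=0\}}$ for the process started at $0$. The state $0$ is polar if $\mathbb P_x[\exists t\ge0,\ Y_t=0]=0$ for every $x\ne0$. The state $0$ is transient (resp. recurrent) if $\mathcal Z$ is not reduced to $\{0\}$ and is bounded (resp. unbounded) almost surely. *)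

theory Defs
  imports "HOL-Probability.Probability"
begin

text \<open>A measure on \<open>(0,\<infinity>)\<close> is a measure on the trace Borel sigma-algebra, so integrals
  against \<open>\<nu>\<close> below only range over positive jump sizes.\<close>

definition branching_mechanism :: "(real \<Rightarrow> real) \<Rightarrow> bool" where
  "branching_mechanism \<Psi> \<longleftrightarrow>
    (\<exists>(d::real) (\<sigma>::real) (\<nu>::real measure).
        sets \<nu> = sets (restrict_space borel {0<..}) \<and>
        (\<integral>\<^sup>+u. ennreal (min 1 (u^2)) \<partial>\<nu>) < \<infinity> \<and>
        (\<forall>q\<ge>0. \<Psi> q = d * q + 1/2 * \<sigma>^2 * q^2
            + (\<integral>u. (exp (- q * u) - 1 + q * u * indicator {0<..<1} u) \<partial>\<nu>)))"

definition immigration_mechanism :: "(real \<Rightarrow> real) \<Rightarrow> bool" where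
  "immigration_mechanism \<Phi> \<longleftrightarrow>
    (\<exists>(\<beta>::real) (\<nu>::real measure). \<beta> \<ge> 0 \<and>
        sets \<nu> = sets (restrict_space borel {0<..}) \<and>
        (\<integral>\<^sup>+u. ennreal (min 1 u) \<partial>\<nu>) < \<infinity> \<and>
        (\<forall>q\<ge>0. \<Phi> q = \<beta> * q + (\<integral>u. (1 - exp (- q * u)) \<partial>\<nu>)))"

definition grey_condition :: "(real \<Rightarrow> real) \<Rightarrow> bool" where
  "grey_condition \<Psi> \<longleftrightarrow>
    (\<exists>\<theta>>0. (\<forall>z\<ge>\<theta>. \<Psi> z > 0) \<and> (\<integral>\<^sup>+q\<in>{\<theta>..}. ennreal (1 / \<Psi> q) \<partial>lborel) < \<infinity>)"

text \<open>\<open>\<Psi>'(0+)\<close> is the limit of \<open>\<Psi>'\<close> at \<open>0\<close> from the right. For a branching mechanism it lies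
  in \<open>[-\<infinity>,\<infinity>)\<close>, so \<open>\<Psi>'(0+) \<ge> 0\<close> means that the limit is a nonnegative real number.\<close>

definition critical_or_subcritical :: "(real \<Rightarrow> real) \<Rightarrow> bool" where
  "critical_or_subcritical \<Psi> \<longleftrightarrow> (\<exists>l\<ge>0. (deriv \<Psi> \<longlongrightarrow> l) (at_right 0))"

text \<open>The solution takes values in \<open>[0,\<infinity>)\<close>, the domain of \<open>\<Psi>\<close>.\<close>

definition cumulant_flow :: "(real \<Rightarrow> real) \<Rightarrow> (real \<Rightarrow> real \<Rightarrow> real) \<Rightarrow> bool" where
  "cumulant_flow \<Psi> v \<longleftrightarrow>
    (\<forall>q>0. \<forall>t\<ge>0. v t q \<ge> 0 \<and>
        set_integrable lborel {0..t} (\<lambda>s. \<Psi> (v s q)) \<and>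
        v t q = q - (LBINT s:{0..t}. \<Psi> (v s q)))"

text \<open>A CBI process may explode, so its state space is \<open>[0,\<infinity>]\<close>, with \<open>exp (-\<infinity>) = 0\<close>.\<close>

definition exp_neg :: "ennreal \<Rightarrow> real" where
  "exp_neg y = (if y = \<infinity> then 0 else exp (- enn2real y))"

definition cadlag :: "(real \<Rightarrow> ennreal) \<Rightarrow> bool" where
  "cadlag f \<longleftrightarrow>
    (\<forall>t\<ge>0. (f \<longlongrightarrow> f t) (at_right t)) \<and> (\<forall>t>0. \<exists>l. (f \<longlongrightarrow> l) (at_left t))"

definition natural_filtration ::
    "'w measure \<Rightarrow> (real \<Rightarrow> 'w \<Rightarrow> ennreal) \<Rightarrow> real \<Rightarrow> 'w measure" where
  "natural_filtration M Y s =
    sigma (space M) {Y u -` A \<inter> space M | u A. 0 \<le> u \<and> u \<le> s \<and> A \<in> sets borel}"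

definition cadlag_markov_process ::
    "(ennreal \<Rightarrow> 'w measure) \<Rightarrow> (real \<Rightarrow> 'w \<Rightarrow> ennreal) \<Rightarrow> bool" where
  "cadlag_markov_process P Y \<longleftrightarrow>
    (\<forall>x. prob_space (P x) \<and> sets (P x) = sets (P 0)) \<and>
    (\<forall>t\<ge>0. Y t \<in> borel_measurable (P 0)) \<and>
    (\<forall>\<omega>\<in>space (P 0). cadlag (\<lambda>t. Y t \<omega>)) \<and>
    (\<forall>x. AE \<omega> in P x. Y 0 \<omega> = x) \<and>
    (\<forall>x. \<forall>s\<ge>0. \<forall>t\<ge>0. \<forall>A\<in>sets borel. AE \<omega> in P x.
        real_cond_exp (P x) (natural_filtration (P x) Y s)
            (\<lambda>\<omega>'. indicator A (Y (s + t) \<omega>')) \<omega>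
          = measure (P (Y s \<omega>)) {\<omega>'\<in>space (P 0). Y t \<omega>' \<in> A})"

text \<open>\<open>P x\<close> is the law of the process started at \<open>x \<in> [0,\<infinity>]\<close>. For \<open>x = \<infinity>\<close> the Laplace transform
  vanishes (\<open>v t q > 0\<close> for \<open>q > 0\<close>), which says that \<open>\<infinity>\<close> is absorbing.\<close>

definition CBI ::
    "(real \<Rightarrow> real) \<Rightarrow> (real \<Rightarrow> real) \<Rightarrow> (ennreal \<Rightarrow> 'w measure) \<Rightarrow>
      (real \<Rightarrow> 'w \<Rightarrow> ennreal) \<Rightarrow> bool" where
  "CBI \<Psi> \<Phi> P Y \<longleftrightarrow>
    cadlag_markov_process P Y \<and>
    (\<exists>v. cumulant_flow \<Psi> v \<and>
      (\<forall>x. \<forall>q>0. \<forall>t\<ge>0.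
        (\<integral>\<omega>. exp_neg (ennreal q * Y t \<omega>) \<partial>P x)
          = exp_neg (x * ennreal (v t q)) * exp (- (LBINT s:{0..t}. \<Phi> (v s q)))))"

definition zero_set :: "(real \<Rightarrow> 'w \<Rightarrow> ennreal) \<Rightarrow> 'w \<Rightarrow> real set" where
  "zero_set Y \<omega> = closure {t. 0 \<le> t \<and> Y t \<omega> = 0}"

text \<open>\<open>AE\<close> only asks that the exceptional event be contained in a null set, so the (non-obvious)
  measurability of the events below is not an issue.\<close>

definition zero_polar ::
    "(ennreal \<Rightarrow> 'w measure) \<Rightarrow> (real \<Rightarrow> 'w \<Rightarrow> ennreal) \<Rightarrow> bool" where
  "zero_polar P Y \<longleftrightarrow> (\<forall>x. x \<noteq> 0 \<longrightarrow> (AE \<omega> in P x. \<not> (\<exists>t\<ge>0. Y t \<omega> = 0)))"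

definition zero_transient ::
    "(ennreal \<Rightarrow> 'w measure) \<Rightarrow> (real \<Rightarrow> 'w \<Rightarrow> ennreal) \<Rightarrow> bool" where
  "zero_transient P Y \<longleftrightarrow> (AE \<omega> in P 0. zero_set Y \<omega> \<noteq> {0} \<and> bounded (zero_set Y \<omega>))"

definition zero_recurrent ::
    "(ennreal \<Rightarrow> 'w measure) \<Rightarrow> (real \<Rightarrow> 'w \<Rightarrow> ennreal) \<Rightarrow> bool" where
  "zero_recurrent P Y \<longleftrightarrow> (AE \<omega> in P 0. zero_set Y \<omega> \<noteq> {0} \<and> \<not> bounded (zero_set Y \<omega>))"

end

theory Submission
  imports Defs
begin

text \<open>
  Under Grey's condition the flow \<open>v\<close> can be started at infinity: with \<open>H z = \<integral>\<^sub>z\<^sup>\<infinity> dq / \<Psi> q\<close> and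
  \<open>V = H\<^sup>-\<^sup>1\<close> one has \<open>v\<^sub>t (V s) = V (s + t)\<close>. Put \<open>G s = exp (\<integral>\<^sub>\<theta>\<^bsup>V s\<^esup> \<Phi> / \<Psi>)\<close>. The Laplace transform of the
  CBI then reads \<open>G s \<cdot> E\<^sub>x (exp (- V s Y\<^sub>t)) = G (s + t) exp (- V (s + t) x)\<close>: the semigroup acts on
  these exponentials by translation of \<open>s\<close>. Hence the potential
  \<open>U q t y = \<integral>\<^sub>t\<^sup>\<infinity> exp (- V s y) G s exp (- q s) ds\<close> satisfies \<open>exp (- q t) E\<^sub>x (U q 0 (Y\<^sub>t)) = U q t x\<close>,
  so \<open>exp (- q t) U q 0 (Y\<^sub>t)\<close> is a supermartingale which is almost a martingale as long as \<open>Y\<close> stays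
  away from \<open>0\<close>, and \<open>U q 0\<close> is maximal at \<open>0\<close>. The maximal inequality bounds the probability of a
  zero after time \<open>t\<close> from above, stopping near \<open>0\<close> bounds it from below, by
  \<open>E (U q 0 (Y\<^sub>t)) / U q 0 0\<close> up to errors that vanish in the limit. In terms of \<open>z = V s\<close>
  the two integrals of the theorem are \<open>\<integral> G\<close> near \<open>0\<close> and near \<open>\<infinity>\<close>.
\<close>

section \<open>The Markov property\<close>

text \<open>If the first zero \<open>\<sigma>\<close> after \<open>t\<close> could serve as a
  stopping time, optional stopping would give
  \<open>E (exp (- q (\<sigma> - t))) * U q 0 0 = E (U q 0 (Y t))\<close>. But the Markov property
  is given at fixed times only, and the event of having a zero is not visibly measurable, so the
  identity is replaced by two inequalities over dyadic times. Two obstacles shape the lower one.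
  First, away from \<open>0\<close> the martingale defect over a step \<open>h\<close> must be
  \<open>o(h)\<close>, so that its sum over \<open>T / h\<close> steps vanishes; Grey's condition
  provides this, because it makes \<open>\<Psi>\<close> superlinear while \<open>\<Phi>\<close> is
  at most linear. Second, a path can have infimum \<open>0\<close> over dyadic times without having
  a zero, if it jumps up from a vanishing left limit; this is excluded almost surely by observing
  the process shortly after it first falls below a small level. The discount \<open>q > 0\<close>
  keeps the potential finite when \<open>G\<close> has infinite mass at infinity;
  \<open>q = 0\<close> serves transience and \<open>q \<rightarrow> 0\<close> recurrence.\<close>

lemma exp_neg_bounds: "0 \<le> exp_neg y" "exp_neg y \<le> 1"
  by (auto simp: exp_neg_def)

lemma exp_neg_measurable [measurable]: "exp_neg \<in> borel_measurable borel"
  unfolding exp_neg_def[abs_def] by measurable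

lemma space_natural_filtration [simp]: "space (natural_filtration M Y s) = space M"
  unfolding natural_filtration_def by (rule space_measure_of) auto

lemma sets_natural_filtration:
  "sets (natural_filtration M Y s) =
    sigma_sets (space M) {Y u -` A \<inter> space M | u A. 0 \<le> u \<and> u \<le> s \<and> A \<in> sets borel}"
  unfolding natural_filtration_def by (rule sets_measure_of) auto

lemma natural_filtration_subalgebra:
  assumes "\<And>t. 0 \<le> t \<Longrightarrow> Y t \<in> borel_measurable M"
  shows "subalgebra M (natural_filtration M Y s)"
proof -
  have "{Y u -` A \<inter> space M | u A. 0 \<le> u \<and> u \<le> s \<and> A \<in> sets borel} \<subseteq> sets M"
    using assms by (auto intro: measurable_sets)
  then show ?thesis
    unfolding subalgebra_def sets_natural_filtration
    by (auto intro!: sets.sigma_sets_subset)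
qed

lemma natural_filtration_measurable:
  assumes "0 \<le> u" "u \<le> s"
  shows "Y u \<in> borel_measurable (natural_filtration M Y s)"
proof (rule measurableI)
  fix A :: "ennreal set" assume "A \<in> sets borel"
  then show "Y u -` A \<inter> space (natural_filtration M Y s) \<in> sets (natural_filtration M Y s)"
    using assms unfolding space_natural_filtration sets_natural_filtration
    by (intro sigma_sets.Basic) auto
qed simp

text \<open>The Markov property is given for indicators only. A function with values in
  \<open>[0, 1]\<close> is uniformly within \<open>1 / n\<close> of the average of the indicators of
  \<open>n\<close> of its superlevel sets, which replaces a monotone class argument.\<close>

lemma staircase_approx:
  fixes z :: real
  assumes "0 \<le> z" "z \<le> 1" "0 < n"
  shows "\<bar>z - (\<Sum>k<n. indicator {r. real (k+1) \<le> real n * r} z) / real n\<bar> \<le> 1 / real n"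
proof -
  define m where "m = nat \<lfloor>real n * z\<rfloor>"
  have nz: "real n * z \<le> real n" "0 \<le> real n * z" using assms by (simp_all add: mult_left_le)
  then have m: "real m \<le> real n * z" "real n * z < real m + 1"
    by (simp_all add: m_def)
  then have "m \<le> n" using nz by linarith
  have "(\<Sum>k<n. indicator {r. real (k+1) \<le> real n * r} z) = (\<Sum>k<n. if k < m then 1 else (0::real))"
    using m by (intro sum.cong) (auto simp: indicator_def)
  also have "\<dots> = (\<Sum>k<m. 1)"
    using \<open>m \<le> n\<close> by (intro sum.mono_neutral_cong_right) auto
  also have "\<dots> = real m" by simp
  finally have "z - (\<Sum>k<n. indicator {r. real (k+1) \<le> real n * r} z) / real n = (real n * z - real m) / real n"
    using assms by (simp add: field_simps)
  then show ?thesis using m assms by (simp add: divide_right_mono)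
qed

text \<open>The kernel \<open>y \<mapsto> P y\<close> is not assumed to be measurable; the function \<open>h\<close> stands in for
  \<open>y \<mapsto> E_y (g (Y t))\<close>, which for exponentials is explicit.\<close>

lemma markov_expectation:
  fixes g h :: "ennreal \<Rightarrow> real"
  assumes mp: "cadlag_markov_process P Y"
    and [measurable]: "g \<in> borel_measurable borel" "h \<in> borel_measurable borel"
    and g: "\<And>y. 0 \<le> g y" "\<And>y. g y \<le> 1"
    and h: "\<And>y. h y = (\<integral>\<omega>. g (Y t \<omega>) \<partial>P y)"
    and st: "0 \<le> s" "0 \<le> t"
    and B: "B \<in> sets (natural_filtration (P x) Y s)"
  shows "(LINT \<omega>:B|P x. g (Y (s + t) \<omega>)) = (LINT \<omega>:B|P x. h (Y s \<omega>))"
proof -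
  have prob: "prob_space (P y)" and sets_eq: "sets (P y) = sets (P 0)" for y
    using mp by (auto simp: cadlag_markov_process_def)
  have space_eq: "space (P y) = space (P 0)" for y
    using sets_eq by (rule sets_eq_imp_space_eq)
  interpret prob_space "P x" by (rule prob)
  have Ym: "Y u \<in> borel_measurable (P y)" if "0 \<le> u" for u y
    using mp that measurable_cong_sets[OF sets_eq[of y] refl[of "sets (borel :: ennreal measure)"]]
    by (simp add: cadlag_markov_process_def)
  have [measurable]: "Y s \<in> borel_measurable (P y)" "Y t \<in> borel_measurable (P y)"
    "Y (s + t) \<in> borel_measurable (P y)" for y
    using st by (auto intro!: Ym)
  define F where "F = natural_filtration (P x) Y s"
  have sub: "subalgebra (P x) F"
    unfolding F_def by (rule natural_filtration_subalgebra[OF Ym])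
  then have [measurable]: "B \<in> sets (P x)"
    using B by (auto simp: F_def subalgebra_def)
  interpret F: finite_measure_subalgebra "P x" F
    by standard (rule sub)
  have bnd: "integrable (P y) f"
    if "f \<in> borel_measurable (P y)" "\<And>\<omega>. \<bar>f \<omega>\<bar> \<le> 1" for f :: "_ \<Rightarrow> real" and y
  proof -
    interpret y: prob_space "P y" by (rule prob)
    show ?thesis by (rule y.integrable_const_bound[where B=1]) (use that in auto)
  qed
  have hb: "0 \<le> h y" "h y \<le> 1" for y
  proof -
    interpret y: prob_space "P y" by (rule prob)
    have "integrable (P y) (\<lambda>\<omega>. g (Y t \<omega>))" by (rule bnd) (auto simp: g)
    then show "0 \<le> h y" "h y \<le> 1" unfolding h
      using g by (auto intro!: y.integral_le_const)
  qed
  \<comment> \<open>One \<open>1 / n\<close> comes from replacing \<open>g\<close> by its staircase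
    at time \<open>s + t\<close>, the other from the same replacement under the law
    \<open>P (Y s \<omega>)\<close>.\<close>
  have key: "\<bar>(LINT \<omega>:B|P x. g (Y (s + t) \<omega>)) - (LINT \<omega>:B|P x. h (Y s \<omega>))\<bar> \<le> 2 / real n"
    if n: "0 < n" for n :: nat
  proof -
    define A where "A k = {y. real (k+1) \<le> real n * g y}" for k :: nat
    have [measurable]: "A k \<in> sets borel" for k unfolding A_def by measurable
    define gn where "gn y = (\<Sum>k<n. indicator (A k) y) / real n" for y
    have [measurable]: "gn \<in> borel_measurable borel" unfolding gn_def by measurable
    have approx: "\<bar>g y - gn y\<bar> \<le> 1 / real n" for y
      using staircase_approx[of "g y" n] g n by (simp add: gn_def A_def indicator_def)
    have gnb: "0 \<le> gn y" "gn y \<le> 1" for y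
    proof -
      show "0 \<le> gn y" by (simp add: gn_def sum_nonneg)
      have "(\<Sum>k<n. indicator (A k) y) \<le> (\<Sum>k<n. 1::real)"
        by (intro sum_mono) (auto simp: indicator_def)
      then show "gn y \<le> 1" using n by (simp add: gn_def field_simps)
    qed
    define E where "E k = {\<omega>'\<in>space (P 0). Y t \<omega>' \<in> A k}" for k
    define c where "c k = real_cond_exp (P x) F (\<lambda>\<omega>'. indicator (A k) (Y (s + t) \<omega>'))" for k
    have [measurable]: "c k \<in> borel_measurable (P x)" for k
      unfolding c_def by simp
    have int_ind: "integrable (P x) (\<lambda>\<omega>. indicator (A k) (Y (s + t) \<omega>) :: real)" for k
      by (rule bnd) (auto simp: indicator_def)
    have int_c: "integrable (P x) (c k)" for k
      unfolding c_def by (rule F.real_cond_exp_int(1)[OF int_ind])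
    have Bset: "integrable (P x) f \<Longrightarrow> set_integrable (P x) B f" for f :: "_ \<Rightarrow> real"
      unfolding set_integrable_def by (rule integrable_mult_indicator) auto
    have c_AE: "AE \<omega> in P x. c k \<omega> = measure (P (Y s \<omega>)) (E k)" for k
      using mp st unfolding c_def F_def E_def cadlag_markov_process_def by auto
    define C where "C \<omega> = (\<Sum>k<n. c k \<omega>) / real n" for \<omega>
    have gn_c: "(LINT \<omega>:B|P x. gn (Y (s + t) \<omega>)) = (LINT \<omega>:B|P x. C \<omega>)"
    proof -
      have int_eq: "(LINT \<omega>:B|P x. indicator (A k) (Y (s + t) \<omega>)) = (LINT \<omega>:B|P x. c k \<omega>)" for k
        unfolding c_def using F.real_cond_exp_intA[OF int_ind] B
        by (auto simp: F_def set_lebesgue_integral_def)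
      have lin: "(LINT \<omega>:B|P x. (\<Sum>k<n. f k \<omega>) / real n) = (\<Sum>k<n. LINT \<omega>:B|P x. f k \<omega>) / real n"
        if "\<And>k. integrable (P x) (f k)" for f :: "nat \<Rightarrow> _ \<Rightarrow> real"
      proof -
        have "(LINT \<omega>:B|P x. (\<Sum>k<n. f k \<omega>) / real n)
            = (LINT \<omega>|P x. (\<Sum>k<n. indicator B \<omega> *\<^sub>R f k \<omega>)) / real n"
          unfolding set_lebesgue_integral_def
          by (subst integral_divide_zero[symmetric], rule Bochner_Integration.integral_cong)
             (auto simp: indicator_def)
        also have "\<dots> = (\<Sum>k<n. LINT \<omega>:B|P x. f k \<omega>) / real n"
          using Bset[OF that] unfolding set_lebesgue_integral_def set_integrable_def
          by (subst Bochner_Integration.integral_sum) auto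
        finally show ?thesis .
      qed
      show ?thesis unfolding gn_def C_def lin[OF int_ind] lin[OF int_c] int_eq ..
    qed
    \<comment> \<open>Fix \<open>\<omega>\<close> and compare expectations under the single law
      \<open>P y\<close> with \<open>y = Y s \<omega>\<close>. Only the finite sum \<open>C\<close>
      of conditional probabilities and \<open>h\<close> are ever integrated over
      \<open>\<omega>\<close>, so measurability of \<open>y \<mapsto> P y\<close> does not
      arise.\<close>
    have c_h: "AE \<omega> in P x. \<bar>C \<omega> - h (Y s \<omega>)\<bar> \<le> 1 / real n"
    proof -
      have "AE \<omega> in P x. \<forall>k\<in>{..<n}. c k \<omega> = measure (P (Y s \<omega>)) (E k)"
        using c_AE by (intro AE_finite_allI) auto
      then show ?thesis
      proof (eventually_elim)
        case (elim \<omega>)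
        define y where "y = Y s \<omega>"
        interpret y: prob_space "P y" by (rule prob)
        have "(\<integral>\<omega>. indicator (A k) (Y t \<omega>) \<partial>P y) = measure (P y) (E k)" for k
        proof -
          have "(\<integral>\<omega>. indicator (A k) (Y t \<omega>) \<partial>P y)
              = (\<integral>\<omega>. indicator (E k) \<omega> \<partial>P y)"
            by (intro Bochner_Integration.integral_cong) (auto simp: E_def indicator_def space_eq[of y])
          also have "\<dots> = measure (P y) (E k)"
            by (simp add: E_def space_eq[of y, symmetric] Int_absorb2)
          finally show ?thesis .
        qed
        moreover have "(\<integral>\<omega>. gn (Y t \<omega>) \<partial>P y) = (\<Sum>k<n. \<integral>\<omega>. indicator (A k) (Y t \<omega>) \<partial>P y) / real n"
          unfolding gn_def integral_divide_zero
          by (subst Bochner_Integration.integral_sum) (auto intro!: bnd simp: indicator_def)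
        ultimately have "C \<omega> = (\<integral>\<omega>. gn (Y t \<omega>) \<partial>P y)"
          using elim by (simp add: y_def C_def)
        moreover have "h y - (\<integral>\<omega>. gn (Y t \<omega>) \<partial>P y) = (\<integral>\<omega>. g (Y t \<omega>) - gn (Y t \<omega>) \<partial>P y)"
          unfolding h using g gnb by (subst Bochner_Integration.integral_diff) (auto intro!: bnd)
        moreover have "\<bar>\<integral>\<omega>. g (Y t \<omega>) - gn (Y t \<omega>) \<partial>P y\<bar> \<le> 1 / real n"
        proof -
          have I: "integrable (P y) (\<lambda>\<omega>. g (Y t \<omega>) - gn (Y t \<omega>))"
            using g gnb by (intro Bochner_Integration.integrable_diff bnd) auto
          have "\<bar>\<integral>\<omega>. g (Y t \<omega>) - gn (Y t \<omega>) \<partial>P y\<bar> \<le> (\<integral>\<omega>. \<bar>g (Y t \<omega>) - gn (Y t \<omega>)\<bar> \<partial>P y)"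
            by (rule integral_abs_bound)
          also have "\<dots> \<le> 1 / real n"
            using I approx by (intro y.integral_le_const) auto
          finally show ?thesis .
        qed
        ultimately show ?case unfolding y_def by linarith
      qed
    qed
    have small: "\<bar>(LINT \<omega>:B|P x. f \<omega>) - (LINT \<omega>:B|P x. f' \<omega>)\<bar> \<le> 1 / real n"
      if f: "integrable (P x) f" "integrable (P x) f'" "AE \<omega> in P x. \<bar>f \<omega> - f' \<omega>\<bar> \<le> 1 / real n"
      for f f' :: "_ \<Rightarrow> real"
    proof -
      have "(LINT \<omega>:B|P x. f \<omega>) - (LINT \<omega>:B|P x. f' \<omega>) = (LINT \<omega>:B|P x. f \<omega> - f' \<omega>)"
        using Bset f by (simp add: set_integral_diff)
      also have "\<bar>\<dots>\<bar> \<le> (LINT \<omega>|P x. \<bar>indicator B \<omega> *\<^sub>R (f \<omega> - f' \<omega>)\<bar>)"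
        unfolding set_lebesgue_integral_def by (rule integral_abs_bound)
      also have "\<dots> \<le> 1 / real n"
      proof (rule integral_le_const)
        show "integrable (P x) (\<lambda>\<omega>. \<bar>indicator B \<omega> *\<^sub>R (f \<omega> - f' \<omega>)\<bar>)"
          using Bset[of "\<lambda>\<omega>. f \<omega> - f' \<omega>"] f by (auto simp: set_integrable_def)
        show "AE \<omega> in P x. \<bar>indicator B \<omega> *\<^sub>R (f \<omega> - f' \<omega>)\<bar> \<le> 1 / real n"
          using f(3) by eventually_elim (auto simp: indicator_def)
      qed
      finally show ?thesis .
    qed
    have "\<bar>(LINT \<omega>:B|P x. g (Y (s + t) \<omega>)) - (LINT \<omega>:B|P x. gn (Y (s + t) \<omega>))\<bar> \<le> 1 / real n"
      using approx g gnb by (intro small bnd) auto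
    moreover have "\<bar>(LINT \<omega>:B|P x. C \<omega>) - (LINT \<omega>:B|P x. h (Y s \<omega>))\<bar> \<le> 1 / real n"
    proof (rule small[OF _ _ c_h])
      show "integrable (P x) C" unfolding C_def
        using int_c by (intro integrable_divide_zero Bochner_Integration.integrable_sum)
      show "integrable (P x) (\<lambda>\<omega>. h (Y s \<omega>))"
        using hb by (intro bnd) auto
    qed
    ultimately show ?thesis unfolding gn_c by (simp add: field_simps)
  qed
  have "((\<lambda>n. 2 / real n) \<longlongrightarrow> 0) sequentially" by real_asymp
  then have "\<bar>(LINT \<omega>:B|P x. g (Y (s + t) \<omega>)) - (LINT \<omega>:B|P x. h (Y s \<omega>))\<bar> \<le> 0"
    by (rule tendsto_lowerbound) (auto intro!: eventually_sequentiallyI[of 1] key)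
  then show ?thesis by simp
qed

section \<open>Hitting zero\<close>

lemma exp_neg_antimono: "y \<le> y' \<Longrightarrow> exp_neg y' \<le> exp_neg y"
  by (auto simp: exp_neg_def top_unique intro: enn2real_mono simp: less_top)

lemma exp_neg_0 [simp]: "exp_neg 0 = 1"
  by (simp add: exp_neg_def)

lemma exp_neg_ennreal: "0 \<le> a \<Longrightarrow> exp_neg (ennreal a) = exp (- a)"
  by (simp add: exp_neg_def)

lemma exp_neg_eq_1_iff: "exp_neg y = 1 \<longleftrightarrow> y = 0"
  by (cases y) (auto simp: exp_neg_def)

section \<open>Right-continuous paths seen on dyadic times\<close>

lemma dyadic_dense:
  fixes a b :: real
  assumes "0 \<le> a" "a < b"
  shows "\<exists>m k::nat. a < real k / 2 ^ m \<and> real k / 2 ^ m < b"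
proof -
  obtain m where m: "1 / (b - a) < 2 ^ m"
    using real_arch_pow[of 2 "1 / (b - a)"] by auto
  define k where "k = nat \<lfloor>a * 2 ^ m\<rfloor> + 1"
  have "0 \<le> a * 2 ^ m" using assms by simp
  then have k: "a * 2 ^ m < real k" "real k \<le> a * 2 ^ m + 1"
    unfolding k_def by linarith+
  have "1 < (b - a) * 2 ^ m" using m assms by (simp add: field_simps)
  then have "real k < b * 2 ^ m" using k by (simp add: algebra_simps)
  then show ?thesis using k by (intro exI[of _ m] exI[of _ k]) (simp add: field_simps)
qed

lemma dyadic_refine:
  assumes "m \<le> m'"
  shows "real k / 2 ^ m = real (k * 2 ^ (m' - m)) / 2 ^ m'"
proof -
  obtain d where "m' = m + d" using assms le_iff_add by blast
  then show ?thesis by (simp add: power_add)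
qed

lemma cadlag_right_neighbourhood:
  assumes "cadlag y" "0 \<le> s" "open S" "y s \<in> S"
  shows "\<exists>b>0. \<forall>r. s \<le> r \<longrightarrow> r < s + b \<longrightarrow> y r \<in> S"
proof -
  have "(y \<longlongrightarrow> y s) (at_right s)" using assms by (auto simp: cadlag_def)
  then have "eventually (\<lambda>r. y r \<in> S) (at_right s)"
    using assms by (auto dest: topological_tendstoD)
  then obtain c where c: "c > s" "\<And>r. s < r \<Longrightarrow> r < c \<Longrightarrow> y r \<in> S"
    by (auto simp: eventually_at_right_field)
  show ?thesis
    using c assms(4) by (intro exI[of _ "c - s"]) (auto simp: le_less)
qed

text \<open>Right continuity carries the bound to times just after \<open>s\<close>, where a dyadic
  shift of \<open>t\<close> can be found. This is how a single zero becomes visible on a countable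
  set of times.\<close>

lemma cadlag_dyadic:
  assumes "cadlag y" "0 \<le> t" "t \<le> s" "y s < \<delta>" "0 < \<eta>"
  shows "\<exists>m k::nat. s < t + real k / 2 ^ m \<and> t + real k / 2 ^ m < s + \<eta> \<and> y (t + real k / 2 ^ m) < \<delta>"
proof -
  obtain b where b: "b > 0" "\<And>r. s \<le> r \<Longrightarrow> r < s + b \<Longrightarrow> y r < \<delta>"
    using cadlag_right_neighbourhood[of y s "{..<\<delta>}"] assms by auto
  obtain m k :: nat where "s - t < real k / 2 ^ m" "real k / 2 ^ m < s - t + min b \<eta>"
    using dyadic_dense[of "s - t" "s - t + min b \<eta>"] assms b by auto
  then show ?thesis
    using b by (intro exI[of _ m] exI[of _ k]) auto
qed

section \<open>Monotone limits, the maximal inequality and first passage times\<close>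

abbreviation (input) mass :: "(real \<Rightarrow> real) \<Rightarrow> real set \<Rightarrow> ennreal" where
  "mass G S \<equiv> \<integral>\<^sup>+s\<in>S. ennreal (G s) \<partial>lborel"

abbreviation (input) level :: "nat \<Rightarrow> ennreal" where
  "level n \<equiv> ennreal (1 / real (Suc n))"

text \<open>Measurability is asked of the truncated integrands only: in the time change for
  \<open>\<Psi>\<close> the integrand is controlled on compact intervals above the largest root and
  may be wild elsewhere.\<close>

lemma nn_integral_incseq_UN:
  fixes f :: "'a \<Rightarrow> ennreal"
  assumes "\<And>n. A n \<subseteq> A (Suc n)"
    and "\<And>n. (\<lambda>x. f x * indicator (A n) x) \<in> borel_measurable M"
  shows "(\<integral>\<^sup>+x\<in>(\<Union>n. A n). f x \<partial>M) = (SUP n. \<integral>\<^sup>+x\<in>A n. f x \<partial>M)"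
proof -
  have "f x * indicator (\<Union>n. A n) x = (SUP n. f x * indicator (A n) x)" for x
  proof -
    have "indicator (\<Union>n. A n) x = (SUP n. indicator (A n) x :: ennreal)"
    proof (rule antisym)
      show "indicator (\<Union>n. A n) x \<le> (SUP n. indicator (A n) x :: ennreal)"
        by (auto simp: indicator_def intro: SUP_upper2)
      show "(SUP n. indicator (A n) x :: ennreal) \<le> indicator (\<Union>n. A n) x"
        by (intro SUP_least) (auto simp: indicator_def)
    qed
    then show ?thesis by (simp only: SUP_mult_left_ennreal)
  qed
  moreover have "(\<integral>\<^sup>+x. (SUP n. f x * indicator (A n) x) \<partial>M) = (SUP n. \<integral>\<^sup>+x\<in>A n. f x \<partial>M)"
    using assms by (intro nn_integral_monotone_convergence_SUP incseq_SucI le_funI mult_left_mono)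
      (auto simp: indicator_def)
  ultimately show ?thesis by simp
qed

lemma emeasure_incseq_UN_bound:
  fixes K c :: ennreal
  assumes "range A \<subseteq> sets M" "incseq A" "\<And>n. K * emeasure M (A n) \<le> c"
  shows "K * emeasure M (\<Union>n. A n) \<le> c"
proof -
  have "K * emeasure M (\<Union>n. A n) = (SUP n. K * emeasure M (A n))"
    using SUP_emeasure_incseq[OF assms(1,2)] by (simp add: SUP_mult_left_ennreal[symmetric])
  also have "\<dots> \<le> c" using assms(3) by (auto intro: SUP_least)
  finally show ?thesis .
qed

text \<open>Invariant of the induction: \<open>K\<close> times the mass of the paths that have
  already reached \<open>K\<close>, plus the integral of \<open>X n\<close> over the others, is at
  most the initial expectation. Stating the supermartingale property through integrals over events
  of the past avoids conditional expectations of possibly infinite variables.\<close>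

lemma nonneg_supermartingale_maximal:
  fixes X :: "nat \<Rightarrow> 'w \<Rightarrow> ennreal"
  assumes sub: "\<And>k. subalgebra M (F k)" "\<And>k. sets (F k) \<subseteq> sets (F (Suc k))"
    and X: "\<And>k. X k \<in> borel_measurable (F k)"
    and dec: "\<And>k B. B \<in> sets (F k) \<Longrightarrow> (\<integral>\<^sup>+\<omega>\<in>B. X (Suc k) \<omega> \<partial>M) \<le> (\<integral>\<^sup>+\<omega>\<in>B. X k \<omega> \<partial>M)"
  shows "K * emeasure M {\<omega>\<in>space M. \<exists>k\<le>n. K \<le> X k \<omega>} \<le> (\<integral>\<^sup>+\<omega>. X 0 \<omega> \<partial>M)"
proof -
  define C where "C n = {\<omega>\<in>space M. \<exists>k\<le>n. K \<le> X k \<omega>}" for n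
  have spF [simp]: "space (F k) = space M" for k using sub by (auto simp: subalgebra_def)
  have XM [measurable]: "X k \<in> borel_measurable M" for k
    using measurable_from_subalg[OF sub(1) X] .
  have CF: "C n \<in> sets (F n)" for n
  proof (induction n)
    case 0
    have "C 0 = {\<omega>\<in>space (F 0). K \<le> X 0 \<omega>}" by (auto simp: C_def)
    also have "\<dots> \<in> sets (F 0)" using X[of 0] by measurable
    finally show ?case .
  next
    case (Suc n)
    have "C (Suc n) = C n \<union> {\<omega>\<in>space (F (Suc n)). K \<le> X (Suc n) \<omega>}"
      by (auto simp: C_def le_Suc_eq)
    moreover have "{\<omega>\<in>space (F (Suc n)). K \<le> X (Suc n) \<omega>} \<in> sets (F (Suc n))"
      using X[of "Suc n"] by measurable
    ultimately show ?case using Suc sub(2)[of n] by auto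
  qed
  then have CM [measurable]: "C n \<in> sets M" for n using sub(1)[of n] by (auto simp: subalgebra_def)
  have "K * emeasure M (C n) + (\<integral>\<^sup>+\<omega>\<in>space M - C n. X n \<omega> \<partial>M) \<le> (\<integral>\<^sup>+\<omega>. X 0 \<omega> \<partial>M)"
  proof (induction n)
    case 0
    have "K * emeasure M (C 0) + (\<integral>\<^sup>+\<omega>\<in>space M - C 0. X 0 \<omega> \<partial>M)
        = (\<integral>\<^sup>+\<omega>. K * indicator (C 0) \<omega> + X 0 \<omega> * indicator (space M - C 0) \<omega> \<partial>M)"
      by (subst nn_integral_add) (auto simp: nn_integral_cmult_indicator)
    also have "\<dots> \<le> (\<integral>\<^sup>+\<omega>. X 0 \<omega> \<partial>M)"
      by (intro nn_integral_mono) (auto simp: C_def indicator_def)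
    finally show ?case .
  next
    case (Suc n)
    have "K * emeasure M (C (Suc n)) + (\<integral>\<^sup>+\<omega>\<in>space M - C (Suc n). X (Suc n) \<omega> \<partial>M)
        = (\<integral>\<^sup>+\<omega>. K * indicator (C (Suc n)) \<omega> + X (Suc n) \<omega> * indicator (space M - C (Suc n)) \<omega> \<partial>M)"
      by (subst nn_integral_add) (auto simp: nn_integral_cmult_indicator)
    also have "\<dots> \<le> (\<integral>\<^sup>+\<omega>. K * indicator (C n) \<omega> + X (Suc n) \<omega> * indicator (space M - C n) \<omega> \<partial>M)"
      by (intro nn_integral_mono) (auto simp: C_def indicator_def le_Suc_eq)
    also have "\<dots> = K * emeasure M (C n) + (\<integral>\<^sup>+\<omega>\<in>space M - C n. X (Suc n) \<omega> \<partial>M)"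
      by (subst nn_integral_add) (auto simp: nn_integral_cmult_indicator)
    also have "\<dots> \<le> K * emeasure M (C n) + (\<integral>\<^sup>+\<omega>\<in>space M - C n. X n \<omega> \<partial>M)"
      using CF[of n] sets.compl_sets[OF CF[of n]] by (intro add_left_mono dec) simp
    also have "\<dots> \<le> (\<integral>\<^sup>+\<omega>. X 0 \<omega> \<partial>M)" by (rule Suc)
    finally show ?case .
  qed
  then show ?thesis unfolding C_def
    by (meson le_iff_add order_trans)
qed

abbreviation (input) passage :: "(real \<Rightarrow> ennreal) \<Rightarrow> ennreal \<Rightarrow> nat \<Rightarrow> real \<Rightarrow> nat \<Rightarrow> real \<Rightarrow> real \<Rightarrow> real \<Rightarrow> bool" where
  "passage y \<delta> T t m \<tau> w b \<equiv> \<exists>k\<le>T * 2 ^ m. y (t + real k / 2 ^ m) < \<delta> \<and> (\<forall>j<k. \<delta> \<le> y (t + real j / 2 ^ m)) \<and>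
    \<tau> < real k / 2 ^ m + w \<and> real k / 2 ^ m + w < \<tau> + b"

text \<open>\<open>\<tau>\<close> is the supremum over \<open>n\<close> of the infima of the dyadic
  times with value below \<open>\<delta> n\<close>; the infima increase because the thresholds
  decrease. A first passage on a grid may fall on either side of \<open>\<tau>\<close>, and the path
  is controlled only to the right of it. The delay \<open>w\<close> moves all passages with low
  threshold and fine grid into \<open>(\<tau>, \<tau> + b)\<close>. The threshold must be fixed
  before the grid.\<close>

lemma first_dyadic_times:
  fixes y :: "real \<Rightarrow> ennreal" and \<delta> :: "nat \<Rightarrow> ennreal"
  assumes dec: "\<And>n n'. n \<le> n' \<Longrightarrow> \<delta> n' \<le> \<delta> n"
    and ex: "\<And>n. \<exists>m k::nat. k \<le> T * 2 ^ m \<and> y (t + real k / 2 ^ m) < \<delta> n"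
  shows "\<exists>\<tau>\<ge>0. \<forall>b w. 0 < w \<longrightarrow> w < b \<longrightarrow> (\<exists>n0. \<forall>n\<ge>n0. \<exists>m0. \<forall>m\<ge>m0.
    passage y (\<delta> n) T t m \<tau> w b)"
proof -
  define S where "S n = {u. \<exists>m k::nat. u = real k / 2 ^ m \<and> k \<le> T * 2 ^ m \<and> y (t + u) < \<delta> n}" for n
  define \<tau>' where "\<tau>' n = Inf (S n)" for n
  have S_ne: "S n \<noteq> {}" for n using ex[of n] by (auto simp: S_def)
  have S_bd: "0 \<le> u" "u \<le> real T" if u: "u \<in> S n" for u n
  proof -
    obtain m k :: nat where k: "u = real k / 2 ^ m" "k \<le> T * 2 ^ m" using u unfolding S_def by blast
    have "real k \<le> real (T * 2 ^ m)" using k(2) by (rule of_nat_mono)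
    then show "0 \<le> u" "u \<le> real T" unfolding k(1) by (simp_all add: pos_divide_le_eq)
  qed
  have S_bdd: "bdd_below (S n)" for n using S_bd by (auto simp: bdd_below_def)
  have \<tau>'_le: "\<tau>' n \<le> u" if "u \<in> S n" for u n
    unfolding \<tau>'_def using that S_bdd by (rule cInf_lower)
  have \<tau>'_bd: "0 \<le> \<tau>' n" "\<tau>' n \<le> real T" for n
  proof -
    show "0 \<le> \<tau>' n" unfolding \<tau>'_def using S_ne S_bd by (intro cInf_greatest) auto
    obtain u where "u \<in> S n" using S_ne[of n] by auto
    then show "\<tau>' n \<le> real T" using \<tau>'_le S_bd(2) order_trans by blast
  qed
  have \<tau>'_mono: "\<tau>' n \<le> \<tau>' n'" if "n \<le> n'" for n n'
  proof -
    have "S n' \<subseteq> S n" unfolding S_def using dec[OF that] by (blast intro: less_le_trans)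
    then show ?thesis unfolding \<tau>'_def using S_ne S_bdd by (intro cInf_superset_mono) auto
  qed
  have bdd: "bdd_above (range \<tau>')" using \<tau>'_bd by (auto simp: bdd_above_def)
  define \<tau> where "\<tau> = (SUP n. \<tau>' n)"
  have le\<tau>: "\<tau>' n \<le> \<tau>" for n unfolding \<tau>_def by (rule cSUP_upper[OF _ bdd]) simp
  show ?thesis
  proof (intro exI[of _ \<tau>] conjI allI impI)
    show "0 \<le> \<tau>" using \<tau>'_bd(1)[of 0] le\<tau>[of 0] by simp
  next
    fix b w :: real assume w: "0 < w" "w < b"
    have "\<tau> - w < (SUP n. \<tau>' n)" using w by (simp add: \<tau>_def)
    then obtain n0 where n0: "\<tau> - w < \<tau>' n0" using less_cSUP_iff[OF _ bdd] by auto
    show "\<exists>n0. \<forall>n\<ge>n0. \<exists>m0. \<forall>m\<ge>m0. passage y (\<delta> n) T t m \<tau> w b"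
    proof (rule exI[of _ n0], intro allI impI)
      fix n assume "n0 \<le> n"
      then have n: "\<tau> - w < \<tau>' n" using n0 \<tau>'_mono[of n0 n] by simp
      have "Inf (S n) < \<tau> + b - w" using le\<tau>[of n] w by (simp add: \<tau>'_def)
      then obtain u where u: "u \<in> S n" "u < \<tau> + b - w"
        using cInf_less_iff[OF S_ne S_bdd] by auto
      then obtain m1 k1 :: nat where k1: "u = real k1 / 2 ^ m1" "k1 \<le> T * 2 ^ m1" "y (t + u) < \<delta> n"
        unfolding S_def by blast
      show "\<exists>m0. \<forall>m\<ge>m0. passage y (\<delta> n) T t m \<tau> w b"
      proof (rule exI[of _ m1], intro allI impI)
        fix m assume m: "m1 \<le> m"
        define k2 where "k2 = k1 * 2 ^ (m - m1)"
        have u2: "u = real k2 / 2 ^ m" unfolding k1 k2_def by (rule dyadic_refine[OF m])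
        have "k2 \<le> T * 2 ^ m1 * 2 ^ (m - m1)" unfolding k2_def by (intro mult_right_mono k1) simp
        also have "\<dots> = T * 2 ^ m" using m by (simp add: power_add[symmetric])
        finally have k2: "k2 \<le> T * 2 ^ m" .
        have "y (t + real k2 / 2 ^ m) < \<delta> n" using k1(3) unfolding u2 .
        from ex_least_nat_le[where P = "\<lambda>k. y (t + real k / 2 ^ m) < \<delta> n", OF this]
        obtain k where k: "y (t + real k / 2 ^ m) < \<delta> n" "k \<le> k2"
          and least: "\<And>j. j < k \<Longrightarrow> \<delta> n \<le> y (t + real j / 2 ^ m)"
          unfolding not_less by blast
        have kT: "k \<le> T * 2 ^ m" using k k2 by simp
        then have "real k / 2 ^ m \<in> S n" using k unfolding S_def by blast
        then have "\<tau>' n \<le> real k / 2 ^ m" by (rule \<tau>'_le)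
        moreover have "real k / 2 ^ m \<le> u" unfolding u2 using k(2) by (intro divide_right_mono) auto
        ultimately have "\<tau> < real k / 2 ^ m + w" "real k / 2 ^ m + w < \<tau> + b" using n u(2) by linarith+
        then show "passage y (\<delta> n) T t m \<tau> w b"
          using k least kT by blast
      qed
    qed
  qed
qed

lemma nn_integral_exp_Ioi:
  assumes "0 < (q::real)"
  shows "(\<integral>\<^sup>+s\<in>{0<..}. ennreal (exp (- q * s)) \<partial>lborel) \<le> ennreal (1 / q)"
proof -
  interpret prob_space "density lborel (exponential_density q)"
    by (rule prob_space_exponential_density[OF assms])
  have "1 = (\<integral>\<^sup>+s. ennreal (exponential_density q s) \<partial>lborel)"
    using emeasure_space_1 by (simp add: emeasure_density)
  then have "ennreal (1 / q) = ennreal (1 / q) * (\<integral>\<^sup>+s. ennreal (exponential_density q s) \<partial>lborel)"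
    by simp
  also have "\<dots> = (\<integral>\<^sup>+s. ennreal (1 / q) * ennreal (exponential_density q s) \<partial>lborel)"
    by (simp add: nn_integral_cmult)
  finally show ?thesis
    using assms
    by (auto intro!: nn_integral_mono simp: exponential_density_def ennreal_mult[symmetric] indicator_def mult.commute)
qed

text \<open>One starting law of the process, with the mechanisms entering only through
  \<open>V\<close> and \<open>G\<close>. The axiom \<open>duality\<close> is the translation
  identity restricted to events of the past, so it contains the Markov property for exponentials.
  \<open>G_small\<close> will bound the martingale defect away from \<open>0\<close>.\<close>

locale cbi_duality = prob_space M for M :: "'w measure" +
  fixes Y :: "real \<Rightarrow> 'w \<Rightarrow> ennreal" and V G :: "real \<Rightarrow> real" and x :: ennreal
  assumes Y_measurable: "\<And>t. 0 \<le> t \<Longrightarrow> Y t \<in> borel_measurable M"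
    and Y_cadlag: "\<And>\<omega>. \<omega> \<in> space M \<Longrightarrow> cadlag (\<lambda>t. Y t \<omega>)"
    and Y_start: "AE \<omega> in M. Y 0 \<omega> = x"
    and V_measurable [measurable]: "V \<in> borel_measurable borel"
    and G_measurable [measurable]: "G \<in> borel_measurable borel"
    and V_pos: "\<And>s. 0 < s \<Longrightarrow> 0 < V s"
    and G_pos: "\<And>s. 0 < s \<Longrightarrow> 0 < G s"
    and G_antimono: "\<And>s s'. 0 < s \<Longrightarrow> s \<le> s' \<Longrightarrow> G s' \<le> G s"
    and G_continuous: "continuous_on {0<..} G"
    and G_small: "\<And>\<delta>. 0 < \<delta> \<Longrightarrow> ((\<lambda>s. exp (- \<delta> * V s) * G s) \<longlongrightarrow> 0) (at_right 0)"
    and duality: "\<And>u w r B. 0 \<le> u \<Longrightarrow> 0 \<le> w \<Longrightarrow> 0 < r \<Longrightarrow> B \<in> sets (natural_filtration M Y u) \<Longrightarrow>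
      ennreal (G r) * (\<integral>\<^sup>+\<omega>\<in>B. ennreal (exp_neg (ennreal (V r) * Y (u + w) \<omega>)) \<partial>M)
        = ennreal (G (r + w)) * (\<integral>\<^sup>+\<omega>\<in>B. ennreal (exp_neg (ennreal (V (r + w)) * Y u \<omega>)) \<partial>M)"
begin

definition ker :: "real \<Rightarrow> ennreal \<Rightarrow> ennreal" where
  "ker s y = ennreal (exp_neg (ennreal (V s) * y))"

abbreviation weight :: "real \<Rightarrow> real \<Rightarrow> ennreal" where
  "weight q s \<equiv> ennreal (G s * exp (- q * s))"

definition U :: "real \<Rightarrow> real \<Rightarrow> ennreal \<Rightarrow> ennreal" where
  "U q t y = (\<integral>\<^sup>+s\<in>{t<..}. weight q s * ker s y \<partial>lborel)"

abbreviation early :: "real \<Rightarrow> real \<Rightarrow> ennreal \<Rightarrow> ennreal" where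
  "early q h y \<equiv> \<integral>\<^sup>+s\<in>{0<..h}. weight q s * ker s y \<partial>lborel"

abbreviation mean_U :: "real \<Rightarrow> 'w set \<Rightarrow> real \<Rightarrow> ennreal" where
  "mean_U q B t \<equiv> \<integral>\<^sup>+\<omega>\<in>B. U q 0 (Y t \<omega>) \<partial>M"

abbreviation filt :: "real \<Rightarrow> 'w measure" where
  "filt \<equiv> natural_filtration M Y"

abbreviation total_U :: "real \<Rightarrow> real \<Rightarrow> ennreal" where
  "total_U q t \<equiv> \<integral>\<^sup>+\<omega>. U q 0 (Y t \<omega>) \<partial>M"

abbreviation mean_ker :: "'w set \<Rightarrow> real \<Rightarrow> real \<Rightarrow> ennreal" where
  "mean_ker B s t \<equiv> \<integral>\<^sup>+\<omega>\<in>B. ker s (Y t \<omega>) \<partial>M"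

abbreviation hit_bound :: "real \<Rightarrow> nat \<Rightarrow> ennreal \<Rightarrow> ennreal" where
  "hit_bound w n p \<equiv> ennreal (G (1 + w) / G 1) * (ker (1 + w) (level n) * p)"

abbreviation discount :: "real \<Rightarrow> real \<Rightarrow> ennreal" where
  "discount q t \<equiv> ennreal (exp (- q * t))"

abbreviation Yd :: "real \<Rightarrow> nat \<Rightarrow> nat \<Rightarrow> 'w \<Rightarrow> ennreal" where
  "Yd t m k \<equiv> Y (t + real k / 2 ^ m)"

section \<open>The potential and its translation property\<close>

lemma ker_measurable [measurable]:
  "f \<in> borel_measurable N \<Longrightarrow> g \<in> borel_measurable N \<Longrightarrow> (\<lambda>z. ker (f z) (g z)) \<in> borel_measurable N"
  unfolding ker_def by measurable

lemma U_measurable [measurable]: "U q t \<in> borel_measurable borel"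
  unfolding U_def[abs_def] by measurable

lemma ker_le_1: "ker s y \<le> 1"
  unfolding ker_def using exp_neg_bounds(2) by (simp add: ennreal_le_1)

lemma ker_0 [simp]: "ker s 0 = 1"
  by (simp add: ker_def)

lemma ker_antimono: "y \<le> y' \<Longrightarrow> ker s y' \<le> ker s y"
  unfolding ker_def by (intro ennreal_leI exp_neg_antimono mult_left_mono) auto

lemma U_antimono: "y \<le> y' \<Longrightarrow> U q t y' \<le> U q t y"
  unfolding U_def by (intro nn_integral_mono mult_right_mono mult_left_mono ker_antimono) auto

lemma U_mono_time: "t \<le> t' \<Longrightarrow> U q t' y \<le> U q t y"
  unfolding U_def by (intro nn_integral_mono mult_left_mono) (auto simp: indicator_def)

lemma U_split:
  assumes "0 \<le> w"
  shows "U q 0 y = (\<integral>\<^sup>+s\<in>{0<..w}. weight q s * ker s y \<partial>lborel) + U q w y"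
  unfolding U_def using assms
  by (subst nn_integral_add[symmetric]) (auto intro!: nn_integral_cong simp: indicator_def)

lemma ker_tendsto_1:
  "0 < s \<Longrightarrow> (\<lambda>n. ker s (level n)) \<longlonglongrightarrow> 1"
proof -
  assume s: "0 < s"
  have "(\<lambda>n. exp (- (V s * (1 / real (Suc n))))) \<longlonglongrightarrow> exp (- (V s * 0))"
    by (intro tendsto_intros LIMSEQ_inverse_real_of_nat[unfolded inverse_eq_divide])
  moreover have "ker s (level n) = ennreal (exp (- (V s * (1 / real (Suc n)))))" for n
    using V_pos[OF s] unfolding ker_def
    by (subst ennreal_mult'[symmetric]) (auto simp: exp_neg_ennreal)
  ultimately show ?thesis using tendsto_ennrealI by fastforce
qed

text \<open>Along the levels \<open>1 / (n + 1)\<close> the kernel increases to \<open>1\<close>, so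
  monotone convergence gives \<open>U q t 0\<close> as the supremum of the
  \<open>U q t (level n)\<close>, also when it is infinite. Infinite \<open>U q t 0\<close> is the
  case behind polarity.\<close>

lemma U_lsc:
  assumes "K < U q t 0" "0 \<le> t"
  shows "\<exists>\<delta>>0. K < U q t \<delta>"
proof -
  have "U q t 0 = (\<integral>\<^sup>+s. (SUP n. (weight q s * ker s (level n)) * indicator {t<..} s) \<partial>lborel)"
    unfolding U_def
  proof (intro nn_integral_cong)
    fix s
    have inc: "incseq (\<lambda>n. ker s (level n))"
      by (intro incseq_SucI ker_antimono ennreal_leI) (simp add: field_simps)
    have "(SUP n. ker s (level n)) = 1" if "s > t"
      using LIMSEQ_unique[OF LIMSEQ_SUP[OF inc] ker_tendsto_1] that assms by auto
    then show "weight q s * ker s 0 * indicator {t<..} s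
       = (SUP n. (weight q s * ker s (level n)) * indicator {t<..} s)"
      by (cases "s > t") (auto simp: SUP_mult_left_ennreal[symmetric])
  qed
  also have "\<dots> = (SUP n. U q t (level n))"
    unfolding U_def
    by (intro nn_integral_monotone_convergence_SUP)
       (auto simp: incseq_def le_fun_def intro!: mult_right_mono mult_left_mono ker_antimono ennreal_leI divide_left_mono)
  finally obtain n where "K < U q t (level n)"
    using assms by (auto simp: less_SUP_iff)
  then show ?thesis by (intro exI[of _ "level n"]) (auto simp del: of_nat_Suc)
qed

lemma U_integral:
  assumes "0 \<le> u" "B \<in> sets M"
  shows "(\<integral>\<^sup>+\<omega>\<in>B. U q t (Y u \<omega>) \<partial>M)
    = (\<integral>\<^sup>+s\<in>{t<..}. weight q s * mean_ker B s u \<partial>lborel)"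
proof -
  interpret pair_sigma_finite M "lborel :: real measure" ..
  have [measurable]: "Y u \<in> borel_measurable M" "B \<in> sets M" using assms Y_measurable by auto
  have "(\<integral>\<^sup>+\<omega>\<in>B. U q t (Y u \<omega>) \<partial>M)
     = (\<integral>\<^sup>+\<omega>. \<integral>\<^sup>+s. weight q s * ker s (Y u \<omega>) * indicator {t<..} s * indicator B \<omega> \<partial>lborel \<partial>M)"
    unfolding U_def by (intro nn_integral_cong nn_integral_multc[symmetric]) measurable
  also have "\<dots> = (\<integral>\<^sup>+s. \<integral>\<^sup>+\<omega>. weight q s * ker s (Y u \<omega>) * indicator {t<..} s * indicator B \<omega> \<partial>M \<partial>lborel)"
    by (rule Fubini'[symmetric]) measurable
  also have "\<dots> = (\<integral>\<^sup>+s. \<integral>\<^sup>+\<omega>. (weight q s * indicator {t<..} s) * (ker s (Y u \<omega>) * indicator B \<omega>) \<partial>M \<partial>lborel)"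
    by (simp add: ac_simps)
  also have "\<dots> = (\<integral>\<^sup>+s. (weight q s * indicator {t<..} s) * mean_ker B s u \<partial>lborel)"
    by (intro nn_integral_cong nn_integral_cmult) measurable
  finally show ?thesis by (simp add: ac_simps)
qed

text \<open>Translation by \<open>w\<close> removes from \<open>U q 0\<close> exactly its mass on \<open>(0, w]\<close>.\<close>

lemma U_duality:
  assumes "0 \<le> u" "0 \<le> w" "B \<in> sets (filt u)"
  shows "discount q w * mean_U q B (u + w) = (\<integral>\<^sup>+\<omega>\<in>B. U q w (Y u \<omega>) \<partial>M)"
proof -
  have [measurable]: "B \<in> sets M" "Y u \<in> borel_measurable M" "Y (u + w) \<in> borel_measurable M"
    using assms natural_filtration_subalgebra[of Y M u] Y_measurable by (auto simp: subalgebra_def)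
  define h where "h s = weight q s * mean_ker B s u" for s
  have [measurable]: "h \<in> borel_measurable borel" unfolding h_def by measurable
  have "discount q w * mean_U q B (u + w)
     = (\<integral>\<^sup>+s. discount q w * (weight q s * mean_ker B s (u + w) * indicator {0<..} s) \<partial>lborel)"
    using assms by (subst U_integral) (auto intro!: nn_integral_cmult[symmetric])
  also have "\<dots> = (\<integral>\<^sup>+s. h (s + w) * indicator {0<..} s \<partial>lborel)"
  proof (intro nn_integral_cong)
    fix s
    show "discount q w * (weight q s * mean_ker B s (u + w) * indicator {0<..} s)
       = h (s + w) * indicator {0<..} s"
    proof (cases "s > 0")
      case True
      then have G: "0 < G s" "0 < G (s + w)" using G_pos assms by auto
      have "discount q w * (weight q s * mean_ker B s (u + w))
        = discount q w * discount q s * (ennreal (G s) * mean_ker B s (u + w))"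
        using G by (simp add: ennreal_mult ac_simps)
      also have "\<dots> = discount q w * discount q s * (ennreal (G (s + w)) * mean_ker B (s + w) u)"
        using duality[OF assms(1,2) True assms(3)] by (simp add: ker_def)
      also have "\<dots> = ennreal (exp (- q * w) * exp (- q * s) * G (s + w)) * mean_ker B (s + w) u"
        using G by (simp add: ennreal_mult ac_simps)
      also have "exp (- q * w) * exp (- q * s) * G (s + w) = G (s + w) * exp (- q * (s + w))"
        by (simp add: exp_add[symmetric] algebra_simps)
      finally show ?thesis using True by (simp add: h_def)
    qed simp
  qed
  also have "\<dots> = (\<integral>\<^sup>+s. h s * indicator {w<..} s \<partial>lborel)"
    by (subst nn_integral_real_affine[where c = 1 and t = w])
       (auto intro!: nn_integral_cong simp: indicator_def add.commute)
  also have "\<dots> = (\<integral>\<^sup>+\<omega>\<in>B. U q w (Y u \<omega>) \<partial>M)"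
    using assms by (subst U_integral) (auto simp: h_def)
  finally show ?thesis .
qed

lemma U_expectation:
  assumes "0 \<le> t"
  shows "discount q t * total_U q t = U q t x"
proof -
  have sp: "space M \<in> sets (filt 0)"
    using sets.top[of "filt 0"] by simp
  have ind: "(\<integral>\<^sup>+\<omega>\<in>space M. f \<omega> \<partial>M) = (\<integral>\<^sup>+\<omega>. f \<omega> \<partial>M)" for f
    by (rule nn_integral_cong) auto
  have "discount q t * total_U q t = (\<integral>\<^sup>+\<omega>. U q t (Y 0 \<omega>) \<partial>M)"
    using U_duality[OF order_refl assms sp] by (simp add: ind)
  also have "\<dots> = (\<integral>\<^sup>+\<omega>. U q t x \<partial>M)"
    using Y_start by (intro nn_integral_cong_AE) auto
  finally show ?thesis by (simp add: emeasure_space_1)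
qed

lemma filtration_subalgebra: "subalgebra M (filt u)"
  by (rule natural_filtration_subalgebra[OF Y_measurable])

lemma filtration_mono: "u \<le> u' \<Longrightarrow> sets (filt u) \<subseteq> sets (filt u')"
  unfolding sets_natural_filtration by (rule sigma_sets_mono') (auto intro: order_trans)

lemma filtration_sets: "B \<in> sets (filt u) \<Longrightarrow> B \<in> sets M"
  using filtration_subalgebra by (auto simp: subalgebra_def)

lemma U_supermartingale:
  assumes "0 \<le> u" "0 \<le> w" "B \<in> sets (filt u)"
  shows "discount q w * mean_U q B (u + w) \<le> mean_U q B u"
  unfolding U_duality[OF assms]
  using assms by (intro nn_integral_mono mult_right_mono U_mono_time) auto

section \<open>Upper bounds on zeros: the maximal inequality over dyadic times\<close>

definition exceed :: "real \<Rightarrow> real \<Rightarrow> ennreal \<Rightarrow> 'w set" where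
  "exceed q t K = {\<omega>\<in>space M. \<exists>m k::nat. K \<le> discount q (real k / 2 ^ m) * U q 0 (Yd t m k \<omega>)}"

text \<open>On one grid the discounted potential is a supermartingale in discrete time whose initial
  expectation is \<open>total_U q t\<close>, whatever the mesh. Each grid is contained in the next,
  so the bound survives the increasing union over all grids.\<close>

lemma
  assumes t: "0 \<le> t"
  shows exceed_sets: "exceed q t K \<in> sets M"
    and exceed_bound: "K * emeasure M (exceed q t K) \<le> total_U q t"
proof -
  define X where "X m k \<omega> = discount q (real k / 2 ^ m) * U q 0 (Yd t m k \<omega>)" for m k :: nat and \<omega>
  define C where "C m n = {\<omega>\<in>space M. \<exists>k\<le>n. K \<le> X m k \<omega>}" for m n :: nat
  have [measurable]: "Y (t + real k / 2 ^ m) \<in> borel_measurable M" for k m :: nat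
    using t by (intro Y_measurable) auto
  have C_sets [measurable]: "C m n \<in> sets M" for m n
    unfolding C_def X_def by measurable
  have C_bound: "K * emeasure M (C m n) \<le> total_U q t" for m n
  proof -
    define F where "F k = filt (t + real k / 2 ^ m)" for k :: nat
    have "K * emeasure M (C m n) \<le> (\<integral>\<^sup>+\<omega>. X m 0 \<omega> \<partial>M)"
      unfolding C_def
    proof (rule nonneg_supermartingale_maximal[where F = F])
      show "subalgebra M (F k)" for k unfolding F_def by (rule filtration_subalgebra)
      show "sets (F k) \<subseteq> sets (F (Suc k))" for k
        unfolding F_def by (intro filtration_mono add_left_mono divide_right_mono) auto
      have "Y (t + real k / 2 ^ m) \<in> borel_measurable (F k)" for k
        unfolding F_def using t by (intro natural_filtration_measurable) auto
      then show "X m k \<in> borel_measurable (F k)" for k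
        unfolding X_def[abs_def] by measurable
    next
      fix k B assume B: "B \<in> sets (F k)"
      then have [measurable]: "B \<in> sets M" unfolding F_def by (rule filtration_sets)
      let ?u = "t + real k / 2 ^ m" and ?w = "1 / 2 ^ m :: real"
      have eq: "t + real (Suc k) / 2 ^ m = ?u + ?w" "real (Suc k) / 2 ^ m = real k / 2 ^ m + ?w"
        by (auto simp: add_divide_distrib)
      have split: "discount q (real k / 2 ^ m + ?w)
          = discount q (real k / 2 ^ m) * discount q ?w"
        unfolding distrib_left exp_add by (rule ennreal_mult) auto
      have [measurable]: "Y (?u + ?w) \<in> borel_measurable M" unfolding eq[symmetric] by measurable
      have "(\<integral>\<^sup>+\<omega>\<in>B. X m (Suc k) \<omega> \<partial>M)
          = (\<integral>\<^sup>+\<omega>. discount q (real k / 2 ^ m) * (discount q ?w * (U q 0 (Y (?u + ?w) \<omega>) * indicator B \<omega>)) \<partial>M)"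
        unfolding X_def eq split by (simp only: mult.assoc add.assoc)
      also have "\<dots> = discount q (real k / 2 ^ m) * (discount q ?w * mean_U q B (?u + ?w))"
        by (subst nn_integral_cmult, measurable)+
      also have "\<dots> \<le> discount q (real k / 2 ^ m) * mean_U q B ?u"
        using t B by (intro mult_left_mono U_supermartingale) (auto simp: F_def)
      also have "\<dots> = (\<integral>\<^sup>+\<omega>\<in>B. X m k \<omega> \<partial>M)"
        unfolding X_def mult.assoc by (subst nn_integral_cmult, measurable)
      finally show "(\<integral>\<^sup>+\<omega>\<in>B. X m (Suc k) \<omega> \<partial>M) \<le> (\<integral>\<^sup>+\<omega>\<in>B. X m k \<omega> \<partial>M)" .
    qed
    then show ?thesis by (simp add: X_def)
  qed
  have inc: "incseq (\<lambda>n. C m n)" for m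
    by (auto simp: C_def incseq_def intro: order_trans)
  have Cm: "K * emeasure M (\<Union>n. C m n) \<le> total_U q t" for m
    using C_bound inc by (intro emeasure_incseq_UN_bound) auto
  have inc': "incseq (\<lambda>m. \<Union>n. C m n)"
  proof (intro incseq_SucI subsetI)
    fix m \<omega> assume "\<omega> \<in> (\<Union>n. C m n)"
    then obtain k where "\<omega> \<in> space M" "K \<le> X m k \<omega>" by (auto simp: C_def)
    moreover have "X m k \<omega> = X (Suc m) (k * 2) \<omega>"
      using dyadic_refine[of m "Suc m" k] by (simp add: X_def)
    ultimately show "\<omega> \<in> (\<Union>n. C (Suc m) n)" by (auto simp: C_def)
  qed
  have E: "exceed q t K = (\<Union>m. \<Union>n. C m n)"
    by (auto simp: exceed_def C_def X_def)
  show "exceed q t K \<in> sets M" unfolding E by measurable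
  show "K * emeasure M (exceed q t K) \<le> total_U q t"
    unfolding E using Cm inc' by (intro emeasure_incseq_UN_bound[where A = "\<lambda>m. \<Union>n. C m n"]) auto
qed

text \<open>Just after a zero, \<open>U q 0 (Y s)\<close> is close to its maximal value \<open>U q 0 0\<close>.\<close>

lemma zero_exceeds:
  assumes "\<omega> \<in> space M" "0 \<le> t" "t \<le> s" "Y s \<omega> = 0" "0 \<le> q"
    and K: "K * ennreal (exp (q * (s - t + 1))) < U q 0 0"
  shows "\<omega> \<in> exceed q t K"
proof -
  obtain \<delta> where \<delta>: "\<delta> > 0" "K * ennreal (exp (q * (s - t + 1))) < U q 0 \<delta>"
    using U_lsc[OF K] by auto
  \<comment> \<open>The window \<open>1\<close> is arbitrary; it is the \<open>+ 1\<close> in the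
    exponent of the hypothesis, which pays for the discount up to the chosen dyadic time.\<close>
  obtain m k :: nat where mk: "t + real k / 2 ^ m < s + 1" "Yd t m k \<omega> < \<delta>"
    using cadlag_dyadic[OF Y_cadlag[OF assms(1)] assms(2,3), of \<delta> 1] \<delta> assms by auto
  let ?d = "real k / 2 ^ m"
  have "K * ennreal (exp (q * ?d)) \<le> K * ennreal (exp (q * (s - t + 1)))"
    using mk assms by (intro mult_left_mono ennreal_leI exp_le_cancel_iff[THEN iffD2]) auto
  also have "\<dots> \<le> U q 0 \<delta>" using \<delta> by simp
  also have "\<dots> \<le> U q 0 (Y (t + ?d) \<omega>)" using mk by (intro U_antimono) auto
  finally have "discount q ?d * (K * ennreal (exp (q * ?d))) \<le> discount q ?d * U q 0 (Y (t + ?d) \<omega>)"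
    by (rule mult_left_mono) simp
  moreover have "discount q ?d * (K * ennreal (exp (q * ?d))) = K * (discount q ?d * ennreal (exp (q * ?d)))"
    by (simp only: ac_simps)
  moreover have "discount q ?d * ennreal (exp (q * ?d)) = 1"
    by (simp add: ennreal_mult[symmetric] exp_add[symmetric])
  ultimately show ?thesis using assms(1) unfolding exceed_def by auto
qed

text \<open>A zero would drive the discounted potential above every level, because
  \<open>U q 0 0\<close> is infinite. Its expectation at time \<open>t\<close> is finite, so the
  maximal inequality gives probability \<open>O(1 / n)\<close> to exceeding level
  \<open>n\<close>.\<close>

lemma no_zeros:
  assumes "0 \<le> t" "0 \<le> q" "U q 0 0 = \<infinity>" "U q t x < \<infinity>"
  shows "AE \<omega> in M. \<forall>s\<ge>t. Y s \<omega> \<noteq> 0"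
proof -
  define N where "N = (\<Inter>n::nat. exceed q t (of_nat n))"
  have [measurable]: "N \<in> sets M" unfolding N_def using exceed_sets[OF assms(1)] by auto
  define c where "c = total_U q t"
  have "discount q t * c < \<infinity>"
    using U_expectation[OF assms(1), of q] assms(4) unfolding c_def by simp
  then have "c < \<infinity>"
    by (cases "c = \<infinity>") (auto simp: less_top ennreal_mult_eq_top_iff)
  have "of_nat n * emeasure M N \<le> c" for n :: nat
  proof -
    have "of_nat n * emeasure M N \<le> of_nat n * emeasure M (exceed q t (of_nat n))"
      unfolding N_def using exceed_sets[OF assms(1)] by (intro mult_left_mono emeasure_mono) auto
    also have "\<dots> \<le> c" unfolding c_def by (rule exceed_bound[OF assms(1)])
    finally show ?thesis .
  qed
  then have "ennreal (real n * measure M N) \<le> c" for n :: nat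
    by (simp add: emeasure_eq_measure ennreal_mult ennreal_of_nat_eq_real_of_nat)
  then have "real n * measure M N \<le> enn2real c" for n :: nat
    using \<open>c < \<infinity>\<close> by (metis ennreal_enn2real ennreal_le_iff enn2real_nonneg infinity_ennreal_def)
  then have "measure M N = 0"
    by (metis measure_nonneg real_archimedian_rdiv_eq_0 enn2real_nonneg)
  then have "N \<in> null_sets M" by (simp add: null_sets_def emeasure_eq_measure)
  then show ?thesis
  proof (rule AE_I')
    show "{\<omega> \<in> space M. \<not> (\<forall>s\<ge>t. Y s \<omega> \<noteq> 0)} \<subseteq> N"
      unfolding N_def using assms
      by (auto intro!: zero_exceeds ennreal_mult_less_top[THEN iffD2] simp: of_nat_less_top less_top[symmetric] ennreal_mult_eq_top_iff)
  qed
qed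

lemma U_vanishes:
  assumes "U q 0 y < \<infinity>"
  shows "(\<lambda>n. U q (real n) y) \<longlonglongrightarrow> 0"
proof -
  have "(\<lambda>n. U q (real n) y) \<longlonglongrightarrow> (\<integral>\<^sup>+s. 0 \<partial>(lborel :: real measure))"
    unfolding U_def
  proof (rule nn_integral_dominated_convergence[where w = "\<lambda>s. weight q s * ker s y * indicator {0<..} s"])
    show "AE s in lborel. (\<lambda>n. weight q s * ker s y * indicator {real n<..} s) \<longlonglongrightarrow> 0"
    proof (intro AE_I2 tendsto_eventually)
      fix s :: real
      obtain n0 :: nat where "s \<le> real n0" using real_arch_simple by auto
      then show "eventually (\<lambda>n. weight q s * ker s y * indicator {real n<..} s = 0) sequentially"
        by (intro eventually_sequentiallyI[of n0]) auto
    qed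
  qed (use assms in \<open>auto simp: U_def indicator_def\<close>)
  then show ?thesis by simp
qed

text \<open>With \<open>q = 0\<close> there is no discount, so a zero at any time after
  \<open>n\<close> lifts the potential above the fixed level \<open>K\<close>, half of its maximum.
  The probability of this is at most \<open>U 0 n x / K\<close>, the tail of a convergent
  integral.\<close>

lemma zeros_bounded_of_potential:
  assumes "0 < U 0 0 0" "U 0 0 0 < \<infinity>"
  shows "AE \<omega> in M. \<exists>n::nat. \<forall>s\<ge>real n. Y s \<omega> \<noteq> 0"
proof -
  define K where "K = U 0 0 0 / 2"
  have K: "K < U 0 0 0" "0 < K" "K < \<infinity>"
  proof -
    obtain a where a: "U 0 0 0 = ennreal a" "0 \<le> a" using assms(2) by (cases "U 0 0 0") auto
    then have "K = ennreal (a / 2)" by (simp add: K_def divide_ennreal[symmetric])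
    then show "K < U 0 0 0" "0 < K" "K < \<infinity>"
      using a assms(1) by (auto simp: ennreal_less_iff)
  qed
  define N where "N = (\<Inter>n::nat. exceed 0 (real n) K)"
  have [measurable]: "N \<in> sets M" unfolding N_def using exceed_sets by auto
  have "K * emeasure M N \<le> U 0 (real n) x" for n :: nat
  proof -
    have "K * emeasure M N \<le> K * emeasure M (exceed 0 (real n) K)"
      unfolding N_def using exceed_sets by (intro mult_left_mono emeasure_mono) auto
    also have "\<dots> \<le> (\<integral>\<^sup>+\<omega>. U 0 0 (Y (real n) \<omega>) \<partial>M)" by (rule exceed_bound) simp
    also have "\<dots> = U 0 (real n) x" using U_expectation[of "real n" 0] by simp
    finally show ?thesis .
  qed
  moreover have "U 0 0 x < \<infinity>"
    using U_antimono[of 0 x 0 0] assms by (auto intro: order.strict_trans1)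
  ultimately have "K * emeasure M N \<le> 0"
    by (intro tendsto_lowerbound[OF U_vanishes]) auto
  then have "N \<in> null_sets M" using K by (auto simp: null_sets_def)
  then show ?thesis
  proof (rule AE_I')
    show "{\<omega> \<in> space M. \<not> (\<exists>n. \<forall>s\<ge>real n. Y s \<omega> \<noteq> 0)} \<subseteq> N"
    proof
      fix \<omega> assume \<omega>: "\<omega> \<in> {\<omega> \<in> space M. \<not> (\<exists>n. \<forall>s\<ge>real n. Y s \<omega> \<noteq> 0)}"
      have "\<omega> \<in> exceed 0 (real n) K" for n :: nat
      proof -
        obtain s where "s \<ge> real n" "Y s \<omega> = 0" using \<omega> by blast
        then show ?thesis using \<omega> K by (intro zero_exceeds) auto
      qed
      then show "\<omega> \<in> N" by (simp add: N_def)
    qed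
  qed
qed

section \<open>Lower bounds on zeros: optional stopping on dyadic grids\<close>

text \<open>\<open>near t T\<close>: the infimum of \<open>Y\<close> over the dyadic shifts of \<open>t\<close> in \<open>[t, t + T]\<close> is \<open>0\<close>. Unlike the
  existence of a zero, this is visibly measurable.\<close>

definition near_grid :: "real \<Rightarrow> nat \<Rightarrow> nat \<Rightarrow> nat \<Rightarrow> 'w set" where
  "near_grid t T n m = {\<omega>\<in>space M. \<exists>k\<le>T * 2 ^ m. Yd t m k \<omega> < level n}"

definition near :: "real \<Rightarrow> nat \<Rightarrow> 'w set" where
  "near t T = (\<Inter>n. \<Union>m. near_grid t T n m)"

lemma Y_dyadic_measurable: "0 \<le> t \<Longrightarrow> Y (t + real k / 2 ^ m) \<in> borel_measurable M"
  by (rule Y_measurable) simp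

lemma near_grid_sets [measurable]: "0 \<le> t \<Longrightarrow> near_grid t T n m \<in> sets M"
proof -
  assume t: "0 \<le> t"
  note [measurable] = Y_dyadic_measurable[OF t]
  show ?thesis unfolding near_grid_def by measurable
qed

lemma near_sets [measurable]: "0 \<le> t \<Longrightarrow> near t T \<in> sets M"
  unfolding near_def by auto

lemma near_grid_incseq: "incseq (near_grid t T n)"
proof (intro incseq_SucI subsetI)
  fix m \<omega> assume "\<omega> \<in> near_grid t T n m"
  then obtain k where "\<omega> \<in> space M" "k \<le> T * 2 ^ m" "Yd t m k \<omega> < level n"
    by (auto simp: near_grid_def)
  moreover have "real (k * 2) / 2 ^ Suc m = real k / 2 ^ m" by simp
  ultimately have "k * 2 \<le> T * 2 ^ Suc m" "Y (t + real (k * 2) / 2 ^ Suc m) \<omega> < level n"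
    by (simp, metis)
  then show "\<omega> \<in> near_grid t T n (Suc m)"
    using \<open>\<omega> \<in> space M\<close> unfolding near_grid_def by blast
qed

lemma near_grid_decreasing: "n \<le> n' \<Longrightarrow> near_grid t T n' m \<subseteq> near_grid t T n m"
proof -
  assume "n \<le> n'"
  then have "level n' \<le> level n"
    by (intro ennreal_leI divide_left_mono) auto
  then show ?thesis unfolding near_grid_def by (blast intro: less_le_trans)
qed

text \<open>\<open>early q h\<close> is what the potential loses from the martingale property over a
  step of length \<open>h\<close>. Above a fixed positive level the integrand tends to
  \<open>0\<close> with \<open>s\<close>, so the loss is \<open>o(h)\<close> and the sum over
  \<open>T / h\<close> steps vanishes.\<close>

lemma small_mass:
  assumes "0 \<le> q" "0 < \<delta>" "0 < \<eta>"
  shows "\<exists>h0>0. \<forall>h. 0 < h \<longrightarrow> h \<le> h0 \<longrightarrow>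
    early q h (ennreal \<delta>) \<le> ennreal (\<eta> * h)"
proof -
  have "eventually (\<lambda>s. exp (- \<delta> * V s) * G s < \<eta>) (at_right 0)"
    using order_tendstoD(2)[OF G_small[OF assms(2)] assms(3)] .
  then obtain b where b: "b > 0" "\<And>s. 0 < s \<Longrightarrow> s < b \<Longrightarrow> exp (- \<delta> * V s) * G s < \<eta>"
    by (auto simp: eventually_at_right_field)
  have "early q h (ennreal \<delta>) \<le> ennreal (\<eta> * h)"
    if h: "0 < h" "h \<le> b / 2" for h
  proof -
    have "early q h (ennreal \<delta>)
        \<le> (\<integral>\<^sup>+s. ennreal \<eta> * indicator {0<..h} s \<partial>lborel)"
    proof (intro nn_integral_mono)
      fix s
      show "weight q s * ker s (ennreal \<delta>) * indicator {0<..h} s \<le> ennreal \<eta> * indicator {0<..h} s"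
      proof (cases "s \<in> {0<..h}")
        case True
        then have s: "0 < s" "s < b" using h by auto
        have "ker s (ennreal \<delta>) = ennreal (exp (- \<delta> * V s))"
          unfolding ker_def using V_pos[OF s(1)] assms
          by (subst ennreal_mult'[symmetric]) (auto simp: exp_neg_ennreal mult.commute)
        then have "weight q s * ker s (ennreal \<delta>) = ennreal ((exp (- \<delta> * V s) * G s) * exp (- q * s))"
          using G_pos[OF s(1)] by (simp add: ennreal_mult[symmetric] ac_simps)
        also have "\<dots> \<le> ennreal (\<eta> * 1)"
          using b(2)[OF s] G_pos[OF s(1)] assms s by (intro ennreal_leI mult_mono) auto
        finally show ?thesis using True by simp
      qed simp
    qed
    also have "\<dots> = ennreal (\<eta> * h)"
      using h assms by (simp add: nn_integral_cmult_indicator ennreal_mult)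
    finally show ?thesis .
  qed
  then show ?thesis using b(1) by (intro exI[of _ "b / 2"]) auto
qed

text \<open>Optional stopping at the first grid time below \<open>\<delta>\<close>, written as an
  induction on the number of steps. Paths that have dropped are credited with the maximal value
  \<open>U q 0 0\<close>, paths in \<open>B m k\<close> continue, and each step costs at most
  \<open>\<epsilon>\<close> of the mesh because the path is still above
  \<open>\<delta>\<close>.\<close>

lemma grid_lower_bound:
  assumes "0 \<le> t" "0 \<le> q" "0 < \<delta>"
  defines "B \<equiv> \<lambda>m k::nat. {\<omega>\<in>space M. \<forall>j\<le>k. \<delta> \<le> Yd t m j \<omega>}"
  defines "\<epsilon> \<equiv> \<lambda>h. \<integral>\<^sup>+s\<in>{0<..h}. weight q s * ker s \<delta> \<partial>lborel"
  shows "total_U q t \<le> U q 0 0 * emeasure M (space M - B m k)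
    + discount q (real k / 2 ^ m) * mean_U q (B m k) (t + real k / 2 ^ m)
    + of_nat k * \<epsilon> (1 / 2 ^ m)"
proof (induction k)
  note [measurable] = Y_dyadic_measurable[OF assms(1)]
  have [measurable]: "B m k \<in> sets M" for k unfolding B_def by measurable
  have le0: "U q 0 y \<le> U q 0 0" for y by (rule U_antimono) simp
  {
    case 0
    have "total_U q t
        \<le> (\<integral>\<^sup>+\<omega>. U q 0 0 * indicator (space M - B m 0) \<omega> + U q 0 (Yd t m 0 \<omega>) * indicator (B m 0) \<omega> \<partial>M)"
      using le0 by (intro nn_integral_mono) (auto simp: indicator_def)
    also have "\<dots> = U q 0 0 * emeasure M (space M - B m 0) + mean_U q (B m 0) (t + real 0 / 2 ^ m)"
      by (subst nn_integral_add) (measurable, simp add: nn_integral_cmult_indicator)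
    finally show ?case by simp
  next
    case (Suc k)
    let ?u = "t + real k / 2 ^ m" and ?w = "1 / 2 ^ m :: real"
    have eq: "t + real (Suc k) / 2 ^ m = ?u + ?w" by (simp add: add_divide_distrib)
    have eq': "exp (- q * (real (Suc k) / 2 ^ m)) = exp (- q * (real k / 2 ^ m)) * exp (- q * ?w)"
      by (simp add: exp_add[symmetric] add_divide_distrib distrib_left)
    have [measurable]: "Y (?u + ?w) \<in> borel_measurable M" unfolding eq[symmetric] by measurable
    have BF: "B m k \<in> sets (filt ?u)"
    proof -
      have meas: "Y (t + real j / 2 ^ m) \<in> borel_measurable (filt ?u)" if "j \<le> k" for j
        using assms(1) that by (intro natural_filtration_measurable) (auto intro!: divide_right_mono)
      have "(\<Inter>j\<in>{..k}. {\<omega>\<in>space (filt ?u). \<delta> \<le> Yd t m j \<omega>}) \<in> sets (filt ?u)"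
      proof (intro sets.finite_INT)
        fix j assume "j \<in> {..k}"
        then have [measurable]: "Y (t + real j / 2 ^ m) \<in> borel_measurable (filt ?u)"
          by (intro meas) simp
        show "{\<omega>\<in>space (filt ?u). \<delta> \<le> Yd t m j \<omega>} \<in> sets (filt ?u)"
          by measurable
      qed auto
      also have "(\<Inter>j\<in>{..k}. {\<omega>\<in>space (filt ?u). \<delta> \<le> Yd t m j \<omega>}) = B m k"
        by (auto simp: B_def)
      finally show ?thesis .
    qed
    have "mean_U q (B m k) ?u
        \<le> (\<integral>\<^sup>+\<omega>. \<epsilon> ?w * indicator (B m k) \<omega> + U q ?w (Y ?u \<omega>) * indicator (B m k) \<omega> \<partial>M)"
    proof (intro nn_integral_mono)
      fix \<omega>
      show "U q 0 (Y ?u \<omega>) * indicator (B m k) \<omega> \<le> \<epsilon> ?w * indicator (B m k) \<omega> + U q ?w (Y ?u \<omega>) * indicator (B m k) \<omega>"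
      proof (cases "\<omega> \<in> B m k")
        case True
        then have "\<delta> \<le> Y ?u \<omega>" by (auto simp: B_def)
        then have "U q 0 (Y ?u \<omega>) \<le> \<epsilon> ?w + U q ?w (Y ?u \<omega>)"
          unfolding \<epsilon>_def
          by (subst U_split[of ?w]) (auto intro!: nn_integral_mono mult_right_mono mult_left_mono ker_antimono)
        then show ?thesis using True by simp
      qed simp
    qed
    also have "\<dots> = \<epsilon> ?w * emeasure M (B m k) + (\<integral>\<^sup>+\<omega>\<in>B m k. U q ?w (Y ?u \<omega>) \<partial>M)"
      by (subst nn_integral_add) (measurable, simp add: nn_integral_cmult_indicator)
    also have "\<dots> \<le> \<epsilon> ?w + (\<integral>\<^sup>+\<omega>\<in>B m k. U q ?w (Y ?u \<omega>) \<partial>M)"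
      using mult_left_mono[OF emeasure_le_1, of "\<epsilon> ?w" "B m k"] by (intro add_right_mono) simp
    also have "(\<integral>\<^sup>+\<omega>\<in>B m k. U q ?w (Y ?u \<omega>) \<partial>M) = discount q ?w * mean_U q (B m k) (?u + ?w)"
      using U_duality[OF _ _ BF, of ?w q] assms(1) by simp
    finally have 1: "mean_U q (B m k) ?u
      \<le> \<epsilon> ?w + discount q ?w * mean_U q (B m k) (?u + ?w)" .
    have "mean_U q (B m k) (?u + ?w)
        \<le> (\<integral>\<^sup>+\<omega>. U q 0 0 * indicator (B m k - B m (Suc k)) \<omega> + U q 0 (Y (?u + ?w) \<omega>) * indicator (B m (Suc k)) \<omega> \<partial>M)"
      using le0 by (intro nn_integral_mono) (auto simp: indicator_def)
    also have "\<dots> = U q 0 0 * emeasure M (B m k - B m (Suc k)) + (\<integral>\<^sup>+\<omega>\<in>B m (Suc k). U q 0 (Y (?u + ?w) \<omega>) \<partial>M)"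
      by (subst nn_integral_add) (measurable, simp add: nn_integral_cmult_indicator)
    finally have 2: "mean_U q (B m k) (?u + ?w)
      \<le> U q 0 0 * emeasure M (B m k - B m (Suc k)) + (\<integral>\<^sup>+\<omega>\<in>B m (Suc k). U q 0 (Y (?u + ?w) \<omega>) \<partial>M)" .
    define e1 e2 where "e1 = discount q (real k / 2 ^ m)" and "e2 = discount q ?w"
    define a b where "a = U q 0 0 * emeasure M (B m k - B m (Suc k))"
      and "b = (\<integral>\<^sup>+\<omega>\<in>B m (Suc k). U q 0 (Y (?u + ?w) \<omega>) \<partial>M)"
    \<comment> \<open>Discounts are bounded by \<open>1\<close> in front of the step error and of
      the newly stopped mass. They are kept on the surviving term, which has to vanish as the
      horizon grows.\<close>
    have e: "e1 \<le> 1" "e2 \<le> 1" using assms(2) by (auto simp: e1_def e2_def ennreal_le_1)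
    have "e1 * mean_U q (B m k) ?u \<le> e1 * (\<epsilon> ?w + e2 * (a + b))"
    proof (rule mult_left_mono[OF order_trans[OF 1]])
      show "\<epsilon> ?w + discount q ?w * mean_U q (B m k) (?u + ?w) \<le> \<epsilon> ?w + e2 * (a + b)"
        unfolding e2_def a_def b_def by (intro add_left_mono mult_left_mono 2) simp
    qed simp
    also have "\<dots> = e1 * \<epsilon> ?w + (e1 * e2) * a + e1 * e2 * b"
      by (simp add: distrib_left ac_simps)
    also have "\<dots> \<le> 1 * \<epsilon> ?w + 1 * a + e1 * e2 * b"
      using e by (intro add_mono mult_right_mono order_refl) (auto intro: mult_le_one)
    finally have 3: "e1 * mean_U q (B m k) ?u \<le> \<epsilon> ?w + a + e1 * e2 * b" by simp
    have "U q 0 0 * emeasure M (space M - B m k) + a = U q 0 0 * emeasure M (space M - B m (Suc k))"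
    proof -
      have "emeasure M (space M - B m k) + emeasure M (B m k - B m (Suc k)) = emeasure M ((space M - B m k) \<union> (B m k - B m (Suc k)))"
        by (intro plus_emeasure) auto
      also have "(space M - B m k) \<union> (B m k - B m (Suc k)) = space M - B m (Suc k)"
        by (auto simp: B_def)
      finally show ?thesis unfolding a_def by (simp only: distrib_left[symmetric])
    qed
    note 4 = this
    have "total_U q t \<le> U q 0 0 * emeasure M (space M - B m k)
      + e1 * mean_U q (B m k) ?u + of_nat k * \<epsilon> ?w"
      using Suc by (simp add: e1_def)
    also have "\<dots> \<le> U q 0 0 * emeasure M (space M - B m k) + (\<epsilon> ?w + a + e1 * e2 * b) + of_nat k * \<epsilon> ?w"
      by (intro add_right_mono add_left_mono 3)
    also have "\<dots> = (U q 0 0 * emeasure M (space M - B m k) + a) + e1 * e2 * b + of_nat (Suc k) * \<epsilon> ?w"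
      by (simp add: distrib_right ac_simps)
    finally show ?case
      unfolding 4 eq eq' by (simp only: e1_def e2_def b_def ennreal_mult exp_ge_zero)
  }
qed

lemma near_lower_bound:
  assumes t: "0 \<le> t" and "0 \<le> q" and fin: "U q 0 0 < \<infinity>"
  shows "total_U q t
    \<le> U q 0 0 * (emeasure M (near t T) + ennreal (exp (- q * real T)))"
proof -
  note [measurable] = Y_dyadic_measurable[OF t] near_grid_sets[OF t] near_sets[OF t]
  have step: "total_U q t
    \<le> U q 0 0 * (emeasure M (\<Union>m. near_grid t T n m) + ennreal (exp (- q * real T)))" for n
  proof (rule ennreal_le_epsilon)
    fix e :: real assume e: "0 < e"
    define \<delta> where "\<delta> = 1 / real (Suc n)"
    have \<delta>: "0 < \<delta>" by (simp add: \<delta>_def)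
    \<comment> \<open>There are \<open>T * 2 ^ m\<close> steps of length \<open>1 / 2 ^ m\<close>,
      so the errors add up to \<open>T * \<eta> \<le> e\<close>; the \<open>+ 1\<close> covers
      \<open>T = 0\<close>.\<close>
    define \<eta> where "\<eta> = e / (real T + 1)"
    have \<eta>: "0 < \<eta>" "real T * \<eta> \<le> e" using e by (auto simp: \<eta>_def field_simps)
    obtain h0 where h0: "h0 > 0" "\<And>h. 0 < h \<Longrightarrow> h \<le> h0 \<Longrightarrow>
      early q h (ennreal \<delta>) \<le> ennreal (\<eta> * h)"
      using small_mass[OF assms(2) \<delta> \<eta>(1)] by blast
    obtain m where m: "1 / 2 ^ m < h0"
      using real_arch_pow_inv[of h0 "1/2"] h0 by (auto simp: power_divide)
    define B where "B = {\<omega>\<in>space M. \<forall>j\<le>T * 2 ^ m. ennreal \<delta> \<le> Yd t m j \<omega>}"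
    have [measurable]: "B \<in> sets M" unfolding B_def by measurable
    have B: "space M - B = near_grid t T n m"
      by (auto simp: B_def near_grid_def \<delta>_def not_le)
    have T: "real (T * 2 ^ m) / 2 ^ m = real T" by simp
    have "total_U q t \<le> U q 0 0 * emeasure M (near_grid t T n m)
      + ennreal (exp (- q * real T)) * mean_U q B (t + real T)
      + of_nat (T * 2 ^ m) * early q (1 / 2 ^ m) (ennreal \<delta>)"
      using grid_lower_bound[OF t assms(2), where \<delta> = "ennreal \<delta>" and m = m and k = "T * 2 ^ m"] \<delta>
      unfolding B_def[symmetric] B T by simp
    also have "\<dots> \<le> U q 0 0 * emeasure M (\<Union>m. near_grid t T n m) + ennreal (exp (- q * real T)) * U q 0 0 + ennreal e"
    proof (intro add_mono mult_left_mono)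
      show "emeasure M (near_grid t T n m) \<le> emeasure M (\<Union>m. near_grid t T n m)"
        by (intro emeasure_mono) auto
      have "mean_U q B (t + real T) \<le> (\<integral>\<^sup>+\<omega>. U q 0 0 \<partial>M)"
        by (intro nn_integral_mono) (auto simp: indicator_def intro!: U_antimono)
      then show "mean_U q B (t + real T) \<le> U q 0 0"
        by (simp add: emeasure_space_1)
      have "of_nat (T * 2 ^ m) * early q (1 / 2 ^ m) (ennreal \<delta>)
          \<le> of_nat (T * 2 ^ m) * ennreal (\<eta> * (1 / 2 ^ m))"
        using m by (intro mult_left_mono h0(2)) auto
      also have "\<dots> = ennreal (real (T * 2 ^ m) * (\<eta> * (1 / 2 ^ m)))"
        using \<eta> unfolding ennreal_of_nat_eq_real_of_nat by (intro ennreal_mult[symmetric]) auto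
      also have "real (T * 2 ^ m) * (\<eta> * (1 / 2 ^ m)) = real T * \<eta>" by simp
      also have "\<dots> \<le> ennreal e" using \<eta> by (intro ennreal_leI)
      finally show "of_nat (T * 2 ^ m) * early q (1 / 2 ^ m) (ennreal \<delta>) \<le> ennreal e" .
    qed auto
    finally show "total_U q t
      \<le> U q 0 0 * (emeasure M (\<Union>m. near_grid t T n m) + ennreal (exp (- q * real T))) + ennreal e"
      unfolding distrib_left by (simp only: mult.commute)
  qed
  have dec: "decseq (\<lambda>n. \<Union>m. near_grid t T n m)"
    unfolding decseq_def using near_grid_decreasing by fast
  have "(\<lambda>n. emeasure M (\<Union>m. near_grid t T n m)) \<longlonglongrightarrow> emeasure M (near t T)"
    unfolding near_def using dec by (intro Lim_emeasure_decseq) auto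
  then have "(\<lambda>n. U q 0 0 * (emeasure M (\<Union>m. near_grid t T n m) + ennreal (exp (- q * real T))))
    \<longlonglongrightarrow> U q 0 0 * (emeasure M (near t T) + ennreal (exp (- q * real T)))"
    using fin by (intro ennreal_tendsto_cmult tendsto_add) auto
  then show ?thesis
    by (rule tendsto_lowerbound) (intro always_eventually allI step, simp)
qed

lemma limsup_integral_lower:
  fixes f :: "nat \<Rightarrow> 'w \<Rightarrow> ennreal"
  assumes "\<And>i. f i \<in> borel_measurable M" "\<And>i \<omega>. f i \<omega> \<le> 1"
    and "c \<longlonglongrightarrow> l" "\<And>i. c i \<le> (\<integral>\<^sup>+\<omega>. f i \<omega> \<partial>M)"
  shows "l \<le> (\<integral>\<^sup>+\<omega>. limsup (\<lambda>i. f i \<omega>) \<partial>M)"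
proof -
  have "l = limsup c" using assms(3) by (intro lim_imp_Limsup[symmetric]) auto
  also have "\<dots> \<le> limsup (\<lambda>i. \<integral>\<^sup>+\<omega>. f i \<omega> \<partial>M)" by (intro Limsup_mono always_eventually allI assms(4))
  also have "\<dots> \<le> (\<integral>\<^sup>+\<omega>. limsup (\<lambda>i. f i \<omega>) \<partial>M)"
    using assms(1,2) by (intro nn_integral_limsup[where w = "\<lambda>_. 1"]) (auto simp: emeasure_space_1)
  finally show ?thesis .
qed

section \<open>Quasi-left-continuity when zero is approached\<close>

definition first_hit :: "real \<Rightarrow> nat \<Rightarrow> nat \<Rightarrow> nat \<Rightarrow> 'w set" where
  "first_hit t n m k = {\<omega>\<in>space M. Yd t m k \<omega> < level n \<and>
    (\<forall>j<k. level n \<le> Yd t m j \<omega>)}"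

text \<open>The sum has at most one nonzero term: it is the kernel evaluated a delay
  \<open>w\<close> after the first grid passage below \<open>level n\<close>, and \<open>0\<close>
  without such a passage by time \<open>T\<close>. The parameter \<open>1\<close> is an arbitrary
  positive one; \<open>ker 1\<close> equals \<open>1\<close> only at \<open>0\<close>, so it detects
  whether the path has left \<open>0\<close>.\<close>

definition after_hit :: "real \<Rightarrow> nat \<Rightarrow> real \<Rightarrow> nat \<Rightarrow> nat \<Rightarrow> 'w \<Rightarrow> ennreal" where
  "after_hit t T w n m \<omega> = (\<Sum>k\<le>T * 2 ^ m. ker 1 (Y (t + real k / 2 ^ m + w) \<omega>) * indicator (first_hit t n m k) \<omega>)"

lemma first_hit_filtration:
  assumes "0 \<le> t"
  shows "first_hit t n m k \<in> sets (filt (t + real k / 2 ^ m))"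
proof -
  let ?F = "filt (t + real k / 2 ^ m)"
  have meas: "Y (t + real j / 2 ^ m) \<in> borel_measurable ?F" if "j \<le> k" for j
    using assms that by (intro natural_filtration_measurable) (auto intro!: divide_right_mono)
  have "first_hit t n m k = {\<omega>\<in>space ?F. Yd t m k \<omega> < level n} \<inter>
    {\<omega>\<in>space ?F. \<forall>j\<in>{..<k}. level n \<le> Yd t m j \<omega>}"
    by (auto simp: first_hit_def)
  also have "\<dots> \<in> sets ?F"
  proof (intro sets.Int sets.sets_Collect_finite_All)
    show "{\<omega>\<in>space ?F. Yd t m k \<omega> < level n} \<in> sets ?F"
      using meas[of k] by measurable
    fix j assume "j \<in> {..<k}"
    then have [measurable]: "Y (t + real j / 2 ^ m) \<in> borel_measurable ?F" by (intro meas) simp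
    show "{\<omega>\<in>space ?F. level n \<le> Yd t m j \<omega>} \<in> sets ?F" by measurable
  qed simp
  finally show ?thesis .
qed

lemma first_hit_disjoint: "j < k \<Longrightarrow> first_hit t n m j \<inter> first_hit t n m k = {}"
  by (auto simp: first_hit_def)

lemma first_hit_unique: "\<omega> \<in> first_hit t n m j \<Longrightarrow> \<omega> \<in> first_hit t n m k \<Longrightarrow> j = k"
  using first_hit_disjoint[of j k] first_hit_disjoint[of k j] by (cases j k rule: linorder_cases) auto

lemma near_grid_first_hit: "near_grid t T n m = (\<Union>k\<in>{..T * 2 ^ m}. first_hit t n m k)"
proof (intro equalityI subsetI)
  fix \<omega> assume "\<omega> \<in> near_grid t T n m"
  then obtain k0 where k0: "\<omega> \<in> space M" "k0 \<le> T * 2 ^ m" "Yd t m k0 \<omega> < level n"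
    by (auto simp: near_grid_def)
  from ex_least_nat_le[where P = "\<lambda>k. Yd t m k \<omega> < level n", OF k0(3)]
  obtain k where "Yd t m k \<omega> < level n" "k \<le> k0" "\<And>j. j < k \<Longrightarrow> level n \<le> Yd t m j \<omega>"
    unfolding not_less by blast
  then have "\<omega> \<in> first_hit t n m k" "k \<le> T * 2 ^ m"
    using k0 unfolding first_hit_def by auto
  then show "\<omega> \<in> (\<Union>k\<in>{..T * 2 ^ m}. first_hit t n m k)" by auto
qed (auto simp: near_grid_def first_hit_def)

lemma after_hit_eq:
  assumes "\<omega> \<in> first_hit t n m k" "k \<le> T * 2 ^ m"
  shows "after_hit t T w n m \<omega> = ker 1 (Y (t + real k / 2 ^ m + w) \<omega>)"
proof -
  have "after_hit t T w n m \<omega> = (\<Sum>j\<in>{k}. ker 1 (Y (t + real j / 2 ^ m + w) \<omega>) * indicator (first_hit t n m j) \<omega>)"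
    unfolding after_hit_def
  proof (rule sum.mono_neutral_right)
    show "\<forall>j\<in>{..T * 2 ^ m} - {k}. ker 1 (Y (t + real j / 2 ^ m + w) \<omega>) * indicator (first_hit t n m j) \<omega> = 0"
    proof
      fix j assume "j \<in> {..T * 2 ^ m} - {k}"
      then have "\<omega> \<notin> first_hit t n m j" using first_hit_unique[OF assms(1)] by blast
      then show "ker 1 (Y (t + real j / 2 ^ m + w) \<omega>) * indicator (first_hit t n m j) \<omega> = 0" by simp
    qed
  qed (use assms in auto)
  then show ?thesis using assms by simp
qed

lemma after_hit_eq_0: "\<omega> \<notin> near_grid t T n m \<Longrightarrow> after_hit t T w n m \<omega> = 0"
  unfolding near_grid_first_hit after_hit_def by (auto intro!: sum.neutral simp: indicator_def)

lemma after_hit_le_1: "after_hit t T w n m \<omega> \<le> 1"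
proof (cases "\<omega> \<in> near_grid t T n m")
  case True
  then show ?thesis unfolding near_grid_first_hit by (auto simp: after_hit_eq intro: ker_le_1)
qed (simp add: after_hit_eq_0)

lemma after_hit_measurable: "0 \<le> t \<Longrightarrow> 0 \<le> w \<Longrightarrow> after_hit t T w n m \<in> borel_measurable M"
proof -
  assume t: "0 \<le> t" "0 \<le> w"
  have [measurable]: "Y (t + real k / 2 ^ m + w) \<in> borel_measurable M" for k
    using t by (intro Y_measurable) auto
  have [measurable]: "first_hit t n m k \<in> sets M" for k
    using first_hit_filtration[OF t(1)] by (rule filtration_sets)
  show ?thesis unfolding after_hit_def[abs_def] by measurable
qed

text \<open>The strong Markov property at a passage with finitely many values: each event
  \<open>first_hit\<close> lies in the past of its grid time, so \<open>duality\<close> with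
  \<open>r = 1\<close> applies on it, and below \<open>level n\<close> the kernel is at least its
  value at that level.\<close>

lemma after_hit_integral:
  assumes "0 \<le> t" "0 \<le> w"
  shows "hit_bound w n (emeasure M (near_grid t T n m))
    \<le> (\<integral>\<^sup>+\<omega>. after_hit t T w n m \<omega> \<partial>M)"
proof -
  let ?\<delta> = "level n"
  have G: "0 < G 1" "0 < G (1 + w)" using assms G_pos by auto
  have Ym [measurable]: "Y (t + real k / 2 ^ m + w) \<in> borel_measurable M" for k
    using assms by (intro Y_measurable) auto
  have Fh [measurable]: "first_hit t n m k \<in> sets M" for k
    using first_hit_filtration[OF assms(1)] by (rule filtration_sets)
  have step: "ennreal (G (1 + w) / G 1) * (ker (1 + w) ?\<delta> * emeasure M (first_hit t n m k))
     \<le> mean_ker (first_hit t n m k) 1 (t + real k / 2 ^ m + w)" for k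
  proof -
    have "ker (1 + w) ?\<delta> * emeasure M (first_hit t n m k) = (\<integral>\<^sup>+\<omega>. ker (1 + w) ?\<delta> * indicator (first_hit t n m k) \<omega> \<partial>M)"
      by (simp add: nn_integral_cmult_indicator)
    also have "\<dots> \<le> mean_ker (first_hit t n m k) (1 + w) (t + real k / 2 ^ m)"
      by (intro nn_integral_mono) (auto simp: first_hit_def indicator_def intro!: ker_antimono)
    finally have "ennreal (G (1 + w) / G 1) * (ker (1 + w) ?\<delta> * emeasure M (first_hit t n m k))
      \<le> ennreal (1 / G 1) * (ennreal (G (1 + w)) * mean_ker (first_hit t n m k) (1 + w) (t + real k / 2 ^ m))"
    proof -
      assume le: "ker (1 + w) ?\<delta> * emeasure M (first_hit t n m k) \<le> mean_ker (first_hit t n m k) (1 + w) (t + real k / 2 ^ m)"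
      have "ennreal (G (1 + w) / G 1) = ennreal (1 / G 1) * ennreal (G (1 + w))"
        using G by (simp add: ennreal_mult[symmetric])
      then show ?thesis using le by (simp only: mult.assoc) (intro mult_left_mono, auto)
    qed
    also have "\<dots> = ennreal (1 / G 1) * (ennreal (G 1) * mean_ker (first_hit t n m k) 1 (t + real k / 2 ^ m + w))"
      using duality[OF _ assms(2) zero_less_one first_hit_filtration[OF assms(1)]] assms(1)
      by (simp add: ker_def)
    also have "\<dots> = mean_ker (first_hit t n m k) 1 (t + real k / 2 ^ m + w)"
      using G by (simp add: mult.assoc[symmetric] ennreal_mult[symmetric])
    finally show ?thesis .
  qed
  have "emeasure M (near_grid t T n m) = (\<Sum>k\<le>T * 2 ^ m. emeasure M (first_hit t n m k))"
    unfolding near_grid_first_hit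
    by (intro sum_emeasure[symmetric]) (auto simp: disjoint_family_on_def dest: first_hit_unique)
  then have "ennreal (G (1 + w) / G 1) * (ker (1 + w) ?\<delta> * emeasure M (near_grid t T n m))
    = (\<Sum>k\<le>T * 2 ^ m. ennreal (G (1 + w) / G 1) * (ker (1 + w) ?\<delta> * emeasure M (first_hit t n m k)))"
    by (simp add: sum_distrib_left)
  also have "\<dots> \<le> (\<Sum>k\<le>T * 2 ^ m. \<integral>\<^sup>+\<omega>\<in>first_hit t n m k. ker 1 (Y (t + real k / 2 ^ m + w) \<omega>) \<partial>M)"
    by (intro sum_mono step)
  also have "\<dots> = (\<integral>\<^sup>+\<omega>. after_hit t T w n m \<omega> \<partial>M)"
    unfolding after_hit_def by (intro nn_integral_sum[symmetric]) measurable
  finally show ?thesis .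
qed

text \<open>The grid is refined first, then the threshold is lowered, then the delay is shortened.
  This is the quantifier order of \<open>first_dyadic_times\<close>; the delay must stay positive
  until the other two limits are done.\<close>

definition final_hit :: "real \<Rightarrow> nat \<Rightarrow> 'w \<Rightarrow> ennreal" where
  "final_hit t T \<omega> = limsup (\<lambda>j. limsup (\<lambda>n. limsup (\<lambda>m. after_hit t T (1 / real (Suc j)) n m \<omega>)))"

lemma final_hit_measurable: "0 \<le> t \<Longrightarrow> final_hit t T \<in> borel_measurable M"
proof -
  assume "0 \<le> t"
  then have [measurable]: "after_hit t T (1 / real (Suc j)) n m \<in> borel_measurable M" for j n m
    by (intro after_hit_measurable) auto
  show ?thesis unfolding final_hit_def[abs_def] by measurable
qed

text \<open>Reverse Fatou for each of the three limits. Refining the grid replaces the grid event by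
  a union containing \<open>near t T\<close>; lowering the threshold sends
  \<open>ker (1 + w) (level n)\<close> to \<open>1\<close>; shortening the delay sends
  \<open>G (1 + w) / G 1\<close> to \<open>1\<close> by continuity of \<open>G\<close>.\<close>

lemma final_hit_integral:
  assumes "0 \<le> t"
  shows "emeasure M (near t T) \<le> (\<integral>\<^sup>+\<omega>. final_hit t T \<omega> \<partial>M)"
proof -
  note [measurable] = near_grid_sets[OF assms] near_sets[OF assms]
  have am [measurable]: "after_hit t T w n m \<in> borel_measurable M" if "0 \<le> w" for w n m
    using assms that by (rule after_hit_measurable)
  define p where "p = emeasure M (near t T)"
  have G: "0 < G s" if "1 \<le> s" for s using G_pos that by auto
  have 1: "hit_bound w n p
     \<le> (\<integral>\<^sup>+\<omega>. limsup (\<lambda>m. after_hit t T w n m \<omega>) \<partial>M)" if w: "0 \<le> w" for w n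
  proof -
    have "hit_bound w n p
        \<le> hit_bound w n (emeasure M (\<Union>m. near_grid t T n m))"
      unfolding p_def near_def by (intro mult_left_mono emeasure_mono) auto
    also have "\<dots> \<le> (\<integral>\<^sup>+\<omega>. limsup (\<lambda>m. after_hit t T w n m \<omega>) \<partial>M)"
    proof (rule limsup_integral_lower)
      show "(\<lambda>m. hit_bound w n (emeasure M (near_grid t T n m)))
        \<longlonglongrightarrow> hit_bound w n (emeasure M (\<Union>m. near_grid t T n m))"
        using near_grid_incseq by (intro ennreal_tendsto_cmult Lim_emeasure_incseq) (auto simp: ker_def)
      show "hit_bound w n (emeasure M (near_grid t T n m))
        \<le> (\<integral>\<^sup>+\<omega>. after_hit t T w n m \<omega> \<partial>M)" for m
        using assms w by (rule after_hit_integral)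
    qed (use w in \<open>auto intro: am after_hit_le_1\<close>)
    finally show ?thesis .
  qed
  have le1: "limsup f \<le> 1" if "\<And>i. f i \<le> (1::ennreal)" for f :: "nat \<Rightarrow> ennreal"
    using that by (intro Limsup_bounded) auto
  have 2: "ennreal (G (1 + w) / G 1) * p \<le> (\<integral>\<^sup>+\<omega>. limsup (\<lambda>n. limsup (\<lambda>m. after_hit t T w n m \<omega>)) \<partial>M)"
    if w: "0 \<le> w" for w
  proof (rule limsup_integral_lower)
    note [measurable] = am[OF w]
    show "(\<lambda>\<omega>. limsup (\<lambda>m. after_hit t T w n m \<omega>)) \<in> borel_measurable M" for n by measurable
    have "(\<lambda>n. ennreal (G (1 + w) / G 1) * (p * ker (1 + w) (level n))) \<longlonglongrightarrow> ennreal (G (1 + w) / G 1) * (p * 1)"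
      using w by (intro ennreal_tendsto_cmult ker_tendsto_1) (auto simp: p_def less_top[symmetric])
    then show "(\<lambda>n. hit_bound w n p) \<longlonglongrightarrow> ennreal (G (1 + w) / G 1) * p"
      by (simp add: mult.commute)
  qed (use w 1 in \<open>auto intro!: le1 after_hit_le_1\<close>)
  have "p \<le> (\<integral>\<^sup>+\<omega>. final_hit t T \<omega> \<partial>M)"
    unfolding final_hit_def
  proof (rule limsup_integral_lower)
    show "(\<lambda>\<omega>. limsup (\<lambda>n. limsup (\<lambda>m. after_hit t T (1 / real (Suc j)) n m \<omega>))) \<in> borel_measurable M" for j
    proof -
      have [measurable]: "after_hit t T (1 / real (Suc j)) n m \<in> borel_measurable M" for n m by (rule am) simp
      show ?thesis by measurable
    qed
    have "isCont G 1" using G_continuous by (simp add: continuous_on_eq_continuous_at)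
    moreover have "(\<lambda>j. 1 + 1 / real (Suc j)) \<longlonglongrightarrow> 1 + 0"
      by (intro tendsto_intros LIMSEQ_inverse_real_of_nat[unfolded inverse_eq_divide])
    ultimately have "(\<lambda>j. G (1 + 1 / real (Suc j))) \<longlonglongrightarrow> G 1"
      using isCont_tendsto_compose[of 1 G "\<lambda>j. 1 + 1 / real (Suc j)" sequentially] by simp
    then have "(\<lambda>j. G (1 + 1 / real (Suc j)) / G 1) \<longlonglongrightarrow> G 1 / G 1"
      using G[of 1] by (intro tendsto_divide tendsto_const) auto
    then have "(\<lambda>j. p * ennreal (G (1 + 1 / real (Suc j)) / G 1)) \<longlonglongrightarrow> p * ennreal (G 1 / G 1)"
      by (intro ennreal_tendsto_cmult tendsto_ennrealI) (auto simp: p_def less_top[symmetric])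
    then show "(\<lambda>j. ennreal (G (1 + 1 / real (Suc j)) / G 1) * p) \<longlonglongrightarrow> p"
      using G[of 1] by (simp add: mult.commute)
  qed (auto intro!: le1 after_hit_le_1 2)
  then show ?thesis by (simp add: p_def)
qed

lemma final_hit_outside:
  assumes "\<omega> \<notin> near t T"
  shows "final_hit t T \<omega> = 0"
proof -
  obtain n0 where n0: "\<omega> \<notin> near_grid t T n0 m" for m using assms by (auto simp: near_def)
  have "limsup (\<lambda>m. after_hit t T w n m \<omega>) = 0" if "n0 \<le> n" for w n
  proof -
    have "after_hit t T w n m \<omega> = 0" for m
      using n0 near_grid_decreasing[OF that] by (intro after_hit_eq_0) blast
    then show ?thesis by (simp add: Limsup_const)
  qed
  then have "eventually (\<lambda>n. limsup (\<lambda>m. after_hit t T w n m \<omega>) \<le> 0) sequentially" for w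
    by (intro eventually_sequentiallyI[of n0]) simp
  then have "limsup (\<lambda>n. limsup (\<lambda>m. after_hit t T w n m \<omega>)) \<le> 0" for w
    by (rule Limsup_bounded)
  then have "final_hit t T \<omega> \<le> 0"
    unfolding final_hit_def by (intro Limsup_bounded always_eventually) auto
  then show ?thesis by simp
qed

lemma final_hit_le_1: "final_hit t T \<omega> \<le> 1"
  unfolding final_hit_def by (intro Limsup_bounded always_eventually allI after_hit_le_1)

text \<open>At the limit \<open>\<tau>\<close> of the passage times the path is positive, hence
  above some \<open>c > 0\<close> just after \<open>t + \<tau>\<close>. The delayed passages land
  there, also when the left limit is \<open>0\<close> and the path jumps up. The kernel is then at
  most \<open>ker 1 c < 1\<close>.\<close>

lemma final_hit_less_1:
  assumes t: "0 \<le> t" and \<omega>: "\<omega> \<in> near t T" and nz: "\<And>s. t \<le> s \<Longrightarrow> Y s \<omega> \<noteq> 0"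
  shows "final_hit t T \<omega> < 1"
proof -
  have sp: "\<omega> \<in> space M" using \<omega> by (auto simp: near_def near_grid_def)
  have dec: "level n' \<le> level n" if "n \<le> n'" for n n' :: nat
    using that by (intro ennreal_leI divide_left_mono) auto
  have ex: "\<exists>m k::nat. k \<le> T * 2 ^ m \<and> Yd t m k \<omega> < level n" for n
    using \<omega> unfolding near_def near_grid_def by blast
  obtain \<tau> where "\<tau> \<ge> 0" and \<tau>: "\<And>b w. 0 < w \<Longrightarrow> w < b \<Longrightarrow> \<exists>n0. \<forall>n\<ge>n0. \<exists>m0. \<forall>m\<ge>m0.
    \<exists>k\<le>T * 2 ^ m. Yd t m k \<omega> < level n \<and>
     (\<forall>j<k. level n \<le> Yd t m j \<omega>) \<and>
      \<tau> < real k / 2 ^ m + w \<and> real k / 2 ^ m + w < \<tau> + b"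
    using first_dyadic_times[where y = "\<lambda>s. Y s \<omega>" and \<delta> = "\<lambda>n. level n" and T = T and t = t, OF dec ex]
    by blast
  have "0 < Y (t + \<tau>) \<omega>" using nz[of "t + \<tau>"] \<open>\<tau> \<ge> 0\<close> by (simp add: zero_less_iff_neq_zero)
  then obtain c where c: "0 < c" "c < Y (t + \<tau>) \<omega>" using dense by blast
  obtain b where b: "b > 0" "\<And>s. t + \<tau> \<le> s \<Longrightarrow> s < t + \<tau> + b \<Longrightarrow> c < Y s \<omega>"
    using cadlag_right_neighbourhood[OF Y_cadlag[OF sp], of "t + \<tau>" "{c<..}"] t \<open>\<tau> \<ge> 0\<close> c by auto
  have bound: "\<exists>n0. \<forall>n\<ge>n0. \<exists>m0. \<forall>m\<ge>m0. after_hit t T w n m \<omega> \<le> ker 1 c" if w: "0 < w" "w < b" for w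
  proof -
    have "after_hit t T w n m \<omega> \<le> ker 1 c"
      if "k \<le> T * 2 ^ m" "Yd t m k \<omega> < level n"
        "\<forall>j<k. level n \<le> Yd t m j \<omega>"
        "\<tau> < real k / 2 ^ m + w" "real k / 2 ^ m + w < \<tau> + b" for n m k
    proof -
      have "\<omega> \<in> first_hit t n m k" unfolding first_hit_def using that sp by blast
      then have "after_hit t T w n m \<omega> = ker 1 (Y (t + real k / 2 ^ m + w) \<omega>)" using that by (intro after_hit_eq)
      moreover have "c < Y (t + real k / 2 ^ m + w) \<omega>" using that by (intro b(2)) auto
      ultimately show ?thesis by (auto intro: ker_antimono)
    qed
    then show ?thesis using \<tau>[OF w] by meson
  qed
  have "limsup (\<lambda>n. limsup (\<lambda>m. after_hit t T w n m \<omega>)) \<le> ker 1 c" if w: "0 < w" "w < b" for w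
  proof -
    obtain n0 where "\<forall>n\<ge>n0. \<exists>m0. \<forall>m\<ge>m0. after_hit t T w n m \<omega> \<le> ker 1 c" using bound[OF w] by blast
    then have "limsup (\<lambda>m. after_hit t T w n m \<omega>) \<le> ker 1 c" if "n0 \<le> n" for n
      using that by (intro Limsup_bounded) (auto simp: eventually_sequentially)
    then show ?thesis by (rule Limsup_bounded[OF eventually_sequentiallyI])
  qed
  moreover have "eventually (\<lambda>j. 1 / real (Suc j) < b) sequentially"
    using order_tendstoD(2)[OF LIMSEQ_inverse_real_of_nat b(1)] by (simp add: inverse_eq_divide)
  ultimately have "final_hit t T \<omega> \<le> ker 1 c"
    unfolding final_hit_def by (intro Limsup_bounded) (auto elim!: eventually_mono)
  also have "ker 1 c < 1"
  proof -
    have "ennreal (V 1) * c \<noteq> 0" using V_pos[of 1] c by (auto simp: ennreal_eq_0_iff)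
    then have "exp_neg (ennreal (V 1) * c) \<noteq> 1" by (simp add: exp_neg_eq_1_iff)
    then show ?thesis unfolding ker_def
      using exp_neg_bounds[of "ennreal (V 1) * c"] by (simp add: ennreal_less_one_iff)
  qed
  finally show ?thesis .
qed

text \<open>Quasi-left-continuity: if the infimum of \<open>Y\<close> is \<open>0\<close>, then it is attained and the path does not jump
  away from \<open>0\<close> at the limit of the times when it falls below \<open>1 / n\<close>.\<close>

lemma zero_of_near:
  assumes "0 \<le> t"
  shows "AE \<omega> in M. \<omega> \<in> near t T \<longrightarrow> (\<exists>s\<ge>t. Y s \<omega> = 0)"
proof -
  note [measurable] = near_sets[OF assms] final_hit_measurable[OF assms]
  have le: "final_hit t T \<omega> \<le> indicator (near t T) \<omega>" for \<omega>
    using final_hit_outside[of \<omega> t T] final_hit_le_1[of t T \<omega>] by (auto simp: indicator_def)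
  have fin: "(\<integral>\<^sup>+\<omega>. final_hit t T \<omega> \<partial>M) < \<infinity>"
    using nn_integral_mono[of M "final_hit t T" "\<lambda>_. 1"] final_hit_le_1
    by (auto simp: emeasure_space_1 intro: order.strict_trans1)
  \<comment> \<open>\<open>final_hit\<close> is at most the indicator of \<open>near t T\<close> and
    has at least its integral, so the two agree almost everywhere. Hence \<open>final_hit\<close> is
    \<open>1\<close> on almost all of \<open>near t T\<close>, which is impossible for a path
    without zeros.\<close>
  have "(\<integral>\<^sup>+\<omega>. indicator (near t T) \<omega> - final_hit t T \<omega> \<partial>M)
      = (\<integral>\<^sup>+\<omega>. indicator (near t T) \<omega> \<partial>M) - (\<integral>\<^sup>+\<omega>. final_hit t T \<omega> \<partial>M)"
    using le fin by (intro nn_integral_diff) auto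
  also have "\<dots> = 0" using final_hit_integral[OF assms, of T] by (simp add: diff_eq_0_ennreal less_top[symmetric])
  finally have "AE \<omega> in M. indicator (near t T) \<omega> - final_hit t T \<omega> = 0"
    by (subst (asm) nn_integral_0_iff_AE) auto
  then show ?thesis
  proof eventually_elim
    case (elim \<omega>)
    show ?case
    proof (rule impI, rule ccontr)
      assume n: "\<omega> \<in> near t T" "\<not> (\<exists>s\<ge>t. Y s \<omega> = 0)"
      then have "final_hit t T \<omega> < 1" using assms by (intro final_hit_less_1) auto
      then show False using elim n by (simp add: diff_eq_0_iff_ennreal)
    qed
  qed
qed

section \<open>Zeros in terms of the mass of \<open>G\<close> near zero and near infinity\<close>

lemma U_0: "U q t 0 = (\<integral>\<^sup>+s\<in>{t<..}. weight q s \<partial>lborel)"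
  by (simp add: U_def)

lemma U_finite:
  assumes "0 < q" "0 < t"
  shows "U q t y < \<infinity>"
proof -
  have "U q t y \<le> U q t 0" by (rule U_antimono) simp
  also have "U q t 0 \<le> (\<integral>\<^sup>+s. ennreal (G t) * (discount q s * indicator {0<..} s) \<partial>lborel)"
    unfolding U_0 using assms G_pos G_antimono[OF assms(2)]
    by (intro nn_integral_mono) (auto simp: indicator_def ennreal_mult[symmetric] less_imp_le intro!: ennreal_leI mult_right_mono)
  also have "\<dots> = ennreal (G t) * (\<integral>\<^sup>+s\<in>{0<..}. discount q s \<partial>lborel)"
    by (simp add: nn_integral_cmult)
  also have "\<dots> < \<infinity>"
    using nn_integral_exp_Ioi[OF assms(1)] by (auto intro!: ennreal_mult_less_top[THEN iffD2] intro: order.strict_trans1)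
  finally show ?thesis .
qed

lemma U_pos:
  assumes "x' \<noteq> \<infinity>" "0 \<le> t"
  shows "0 < U q t x'"
proof (rule ccontr)
  assume "\<not> 0 < U q t x'"
  then have "(\<integral>\<^sup>+s\<in>{t<..}. weight q s * ker s x' \<partial>lborel) = 0"
    by (simp add: U_def)
  then have "AE s in lborel. weight q s * ker s x' * indicator {t<..} s = 0"
    by (subst (asm) nn_integral_0_iff_AE) auto
  then have "AE s in lborel. s \<notin> {t<..}"
  proof eventually_elim
    case (elim s)
    show ?case
    proof
      assume s: "s \<in> {t<..}"
      then have "0 < s" using assms by auto
      moreover have "ennreal (V s) * x' \<noteq> \<infinity>" using assms by (auto simp: ennreal_mult_eq_top_iff)
      ultimately show False using elim s G_pos[of s] by (auto simp: ker_def exp_neg_def)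
    qed
  qed
  then have "emeasure lborel {t<..} = 0"
    by (subst (asm) AE_iff_null_sets[symmetric]) (auto simp: null_sets_def)
  moreover have "emeasure lborel {t<..<t + 1} \<le> emeasure lborel {t<..}"
    by (intro emeasure_mono) auto
  ultimately show False by simp
qed

lemma U_finite_0:
  assumes "0 < a" "mass G {0<..a} < \<infinity>" "0 < q"
  shows "U q 0 y < \<infinity>"
proof -
  have "(\<integral>\<^sup>+s\<in>{0<..a}. weight q s * ker s y \<partial>lborel) \<le> mass G {0<..a}"
  proof (intro nn_integral_mono)
    fix s
    show "weight q s * ker s y * indicator {0<..a} s \<le> ennreal (G s) * indicator {0<..a} s"
    proof (cases "s \<in> {0<..a}")
      case True
      then have "weight q s \<le> ennreal (G s * 1)"
        using assms(3) G_pos[of s] by (intro ennreal_leI mult_left_mono) auto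
      then have "weight q s * ker s y \<le> ennreal (G s * 1) * 1"
        by (intro mult_mono ker_le_1) auto
      then show ?thesis using True by simp
    qed simp
  qed
  also have "\<dots> < \<infinity>" by (rule assms(2))
  finally show ?thesis
    using U_split[of a q y] U_finite[OF assms(3,1), of y] assms(1) by (simp add: less_top)
qed

text \<open>The exponential weight is bounded below on \<open>(0, a]\<close>, so
  \<open>U 1 0 0\<close> is infinite, while \<open>U 1 t x\<close> is finite for every
  \<open>t > 0\<close>. Times \<open>t = 1 / (n + 1)\<close> exhaust the positive half-line; time
  \<open>0\<close> is left out because the process may start at zero.\<close>

lemma never_zero:
  assumes "0 < a" "mass G {0<..a} = \<infinity>"
  shows "AE \<omega> in M. \<forall>s>0. Y s \<omega> \<noteq> 0"
proof -
  have "ennreal (exp (- a)) * mass G {0<..a}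
      = (\<integral>\<^sup>+s. ennreal (exp (- a)) * (ennreal (G s) * indicator {0<..a} s) \<partial>lborel)"
    by (simp add: nn_integral_cmult)
  also have "\<dots> \<le> U 1 0 0"
    unfolding U_0
  proof (intro nn_integral_mono)
    fix s
    show "ennreal (exp (- a)) * (ennreal (G s) * indicator {0<..a} s) \<le> ennreal (G s * exp (- 1 * s)) * indicator {0<..} s"
      using G_pos[of s] by (auto simp: indicator_def ennreal_mult[symmetric] mult.commute[of "exp _"] intro!: ennreal_leI mult_left_mono)
  qed
  finally have inf: "U 1 0 0 = \<infinity>" using assms by (simp add: ennreal_mult_top top_unique)
  have "AE \<omega> in M. \<forall>s\<ge>1 / real (Suc n). Y s \<omega> \<noteq> 0" for n
    using inf by (intro no_zeros[where q = 1] U_finite) auto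
  then have "AE \<omega> in M. \<forall>n. \<forall>s\<ge>1 / real (Suc n). Y s \<omega> \<noteq> 0" unfolding AE_all_countable by blast
  then show ?thesis
  proof eventually_elim
    case (elim \<omega>)
    show ?case
    proof (intro allI impI)
      fix s :: real assume "0 < s"
      then obtain n where "1 / real (Suc n) < s" using nat_approx_posE by blast
      then show "Y s \<omega> \<noteq> 0" using elim by (meson less_imp_le)
    qed
  qed
qed

text \<open>Let the horizon \<open>T\<close> tend to infinity in the grid estimate;
  \<open>q > 0\<close> removes the surviving paths.\<close>

lemma zero_lower_bound:
  assumes "0 \<le> t" "0 < q" "U q 0 0 < \<infinity>"
  shows "U q t x \<le> U q 0 0 * emeasure M (\<Union>T. near t T)"
proof -
  note [measurable] = near_sets[OF assms(1)]
  have "U q t x \<le> U q 0 0 * (emeasure M (\<Union>T. near t T) + ennreal (exp (- q * real T)))" for T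
  proof -
    have "U q t x \<le> 1 * total_U q t"
      unfolding U_expectation[OF assms(1), symmetric] using assms by (intro mult_right_mono) (auto simp: ennreal_le_1)
    also have "\<dots> \<le> U q 0 0 * (emeasure M (near t T) + ennreal (exp (- q * real T)))"
      using near_lower_bound[of t q T] assms by simp
    also have "\<dots> \<le> U q 0 0 * (emeasure M (\<Union>T. near t T) + ennreal (exp (- q * real T)))"
      by (intro mult_left_mono add_right_mono emeasure_mono) auto
    finally show ?thesis .
  qed
  moreover have "(\<lambda>T. U q 0 0 * (emeasure M (\<Union>T. near t T) + ennreal (exp (- q * real T))))
    \<longlonglongrightarrow> U q 0 0 * (emeasure M (\<Union>T. near t T) + ennreal 0)"
  proof (intro ennreal_tendsto_cmult tendsto_add tendsto_const tendsto_ennrealI)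
    show "(\<lambda>T. exp (- q * real T)) \<longlonglongrightarrow> 0" using assms(2) by real_asymp
  qed (use assms in auto)
  ultimately show ?thesis
    using tendsto_lowerbound[OF _ always_eventually] by fastforce
qed

lemma zero_of_near_UN:
  assumes "0 \<le> t"
  shows "AE \<omega> in M. \<omega> \<in> (\<Union>T. near t T) \<longrightarrow> (\<exists>s\<ge>t. Y s \<omega> = 0)"
proof -
  have "AE \<omega> in M. \<forall>T. \<omega> \<in> near t T \<longrightarrow> (\<exists>s\<ge>t. Y s \<omega> = 0)"
    unfolding AE_all_countable using zero_of_near[OF assms] by blast
  then show ?thesis by eventually_elim blast
qed

text \<open>Without zeros the lower bound would force \<open>U 1 0 x = 0\<close>, but the kernel is
  positive at every finite starting point.\<close>

lemma zero_reachable: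
  assumes "0 < a" "mass G {0<..a} < \<infinity>" "x \<noteq> \<infinity>"
  shows "\<not> (AE \<omega> in M. \<forall>s\<ge>0. Y s \<omega> \<noteq> 0)"
proof
  assume none: "AE \<omega> in M. \<forall>s\<ge>0. Y s \<omega> \<noteq> 0"
  have "AE \<omega> in M. \<omega> \<notin> (\<Union>T. near 0 T)"
    using none zero_of_near_UN[OF order_refl] by eventually_elim auto
  then have "emeasure M (\<Union>T. near 0 T) = 0"
    using near_sets[OF order_refl] by (subst (asm) AE_iff_null_sets[symmetric]) (auto simp: null_sets_def)
  then have "U 1 0 x \<le> 0"
    using zero_lower_bound[of 0 1] U_finite_0[OF assms(1,2), of 1 0] by simp
  then show False using U_pos[OF assms(3), of 0 1] by simp
qed

text \<open>The zero at time \<open>0\<close> is trivial, so zeros after \<open>t n\<close> with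
  \<open>t n \<rightarrow> 0\<close> are counted. Their probability is at least
  \<open>U 1 (t n) 0 / U 1 0 0\<close>, and monotone convergence sends this ratio to
  \<open>1\<close>.\<close>

lemma zero_revisited:
  assumes "0 < a" "mass G {0<..a} < \<infinity>" "x = 0"
  shows "AE \<omega> in M. \<exists>s>0. Y s \<omega> = 0"
proof -
  define t where "t n = 1 / real (Suc n)" for n
  have t: "0 < t n" for n by (simp add: t_def)
  define E where "E = (\<Union>n. \<Union>T. near (t n) T)"
  have [measurable]: "near (t n) T \<in> sets M" for n T using t[of n] by (intro near_sets) simp
  have [measurable]: "E \<in> sets M" unfolding E_def by measurable
  have fin: "U 1 0 0 < \<infinity>" using assms by (intro U_finite_0) auto
  have pos: "0 < U 1 0 0" by (intro U_pos) auto
  have "U 1 (t n) 0 \<le> U 1 0 0 * emeasure M E" for n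
  proof -
    have "U 1 (t n) 0 \<le> U 1 0 0 * emeasure M (\<Union>T. near (t n) T)"
      using zero_lower_bound[of "t n" 1] t[of n] fin assms(3) by simp
    also have "\<dots> \<le> U 1 0 0 * emeasure M E"
      unfolding E_def by (intro mult_left_mono emeasure_mono) (auto simp del: UN_simps)
    finally show ?thesis .
  qed
  then have le: "(SUP n. U 1 (t n) 0) \<le> U 1 0 0 * emeasure M E" by (rule SUP_least)
  have "(\<Union>n. {t n<..}) = {0<..}"
  proof (intro equalityI subsetI)
    fix s :: real assume "s \<in> {0<..}"
    then show "s \<in> (\<Union>n. {t n<..})" using nat_approx_posE[of s] unfolding t_def by auto
  qed (use t in \<open>auto intro: less_trans\<close>)
  then have "U 1 0 0 = (\<integral>\<^sup>+s\<in>(\<Union>n. {t n<..}). weight 1 s \<partial>lborel)" by (simp only: U_0)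
  also have "\<dots> = (SUP n. U 1 (t n) 0)"
    unfolding U_0
  proof (rule nn_integral_incseq_UN)
    have "t (Suc n) \<le> t n" for n unfolding t_def by (intro divide_left_mono) auto
    then show "{t n<..} \<subseteq> {t (Suc n)<..}" for n by (auto intro: le_less_trans)
  qed measurable
  finally have "U 1 0 0 \<le> U 1 0 0 * emeasure M E" using le by simp
  then have "emeasure M E = 1"
  proof -
    obtain u where u: "U 1 0 0 = ennreal u" "0 < u" using fin pos by (cases "U 1 0 0") auto
    assume "U 1 0 0 \<le> U 1 0 0 * emeasure M E"
    then have "u \<le> u * measure M E" using u by (simp add: emeasure_eq_measure ennreal_mult[symmetric])
    then show ?thesis using u prob_le_1[of E] by (simp add: emeasure_eq_measure)
  qed
  then have "AE \<omega> in M. \<omega> \<in> E" by (intro AE_prob_1) (simp add: measure_def)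
  moreover have "AE \<omega> in M. \<forall>n. \<omega> \<in> (\<Union>T. near (t n) T) \<longrightarrow> (\<exists>s\<ge>t n. Y s \<omega> = 0)"
    unfolding AE_all_countable using zero_of_near_UN t less_imp_le by blast
  ultimately show ?thesis
  proof eventually_elim
    case (elim \<omega>)
    then obtain n where "\<exists>s\<ge>t n. Y s \<omega> = 0" unfolding E_def by blast
    then show ?case using t[of n] by (auto intro: less_le_trans)
  qed
qed

text \<open>Let \<open>p\<close> be the probability of approaching zero after \<open>t\<close>.
  Splitting the potential at \<open>t\<close> gives \<open>U q 0 0 \<le> c + p * U q 0 0\<close>
  with \<open>c\<close> free of \<open>q\<close>. If \<open>p < 1\<close>, the potentials are
  bounded uniformly in \<open>q\<close>, whereas they increase to the infinite total mass of
  \<open>G\<close> as \<open>q \<rightarrow> 0\<close>.\<close>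

lemma zeros_unbounded:
  assumes "0 < a" "mass G {0<..a} < \<infinity>" "x = 0"
    and inf: "mass G {0<..} = \<infinity>"
  shows "AE \<omega> in M. \<forall>n::nat. \<exists>s\<ge>real n. Y s \<omega> = 0"
proof -
  have one: "emeasure M (\<Union>T. near t T) = 1" if t: "0 \<le> t" for t
  proof -
    have [measurable]: "near t T \<in> sets M" for T using t by (rule near_sets)
    define p where "p = measure M (\<Union>T. near t T)"
    have p: "0 \<le> p" "p \<le> 1" "emeasure M (\<Union>T. near t T) = ennreal p"
      by (auto simp: p_def emeasure_eq_measure)
    define c where "c = mass G {0<..t}"
    have "c \<le> (\<integral>\<^sup>+s. ennreal (G s) * indicator {0<..a} s + ennreal (G a) * indicator {0<..t} s \<partial>lborel)"
      unfolding c_def using G_antimono[OF assms(1)]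
      by (intro nn_integral_mono) (auto simp: indicator_def intro!: ennreal_leI)
    also have "\<dots> = mass G {0<..a} + ennreal (G a) * emeasure lborel {0<..t}"
      by (subst nn_integral_add) (auto simp: nn_integral_cmult_indicator)
    also have "\<dots> < \<infinity>" using assms(2) t by (simp add: ennreal_mult_less_top)
    finally have c: "c < \<infinity>" .
    then obtain c' where c': "c = ennreal c'" "0 \<le> c'" by (cases c) auto
    have bound: "U q 0 0 \<le> c + U q 0 0 * ennreal p" if q: "0 < q" for q
    proof -
      have "U q 0 0 = (\<integral>\<^sup>+s\<in>{0<..t}. weight q s * ker s 0 \<partial>lborel) + U q t 0"
        using t by (rule U_split)
      also have "\<dots> \<le> c + U q 0 0 * ennreal p"
      proof (rule add_mono)
        show "(\<integral>\<^sup>+s\<in>{0<..t}. weight q s * ker s 0 \<partial>lborel) \<le> c"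
          unfolding c_def using G_pos q
          by (intro nn_integral_mono) (auto simp: indicator_def mult_left_le less_imp_le intro!: ennreal_leI)
        show "U q t 0 \<le> U q 0 0 * ennreal p"
          using zero_lower_bound[of t q] t q assms U_finite_0[OF assms(1,2) q] p by simp
      qed
      finally show ?thesis .
    qed
    have "p = 1"
    proof (rule ccontr)
      assume "p \<noteq> 1"
      then have p1: "p < 1" using p by simp
      have "U q 0 0 \<le> ennreal (c' / (1 - p))" if q: "0 < q" for q
      proof -
        obtain u where u: "U q 0 0 = ennreal u" "0 \<le> u" using U_finite_0[OF assms(1,2) q, of 0] by (cases "U q 0 0") auto
        have "u \<le> c' + u * p"
          using bound[OF q] u c' p by (simp add: ennreal_mult[symmetric] ennreal_plus[symmetric] del: ennreal_plus)
        then have "u \<le> c' / (1 - p)" using p1 by (simp add: field_simps)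
        then show ?thesis using u by (simp add: ennreal_leI)
      qed
      then have "(SUP n. U (1 / real (Suc n)) 0 0) \<le> ennreal (c' / (1 - p))"
        by (intro SUP_least) simp
      moreover have "mass G {0<..} = (SUP n. U (1 / real (Suc n)) 0 0)"
      proof -
        have inc: "incseq (\<lambda>n. ennreal (G s * exp (- (1 / real (Suc n)) * s)) * indicator {0<..} s)" for s
        proof (cases "0 < s")
          case True
          then show ?thesis using G_pos[OF True]
            by (intro incseq_SucI) (auto intro!: mult_left_mono ennreal_leI divide_left_mono)
        qed (simp add: incseq_def)
        have "mass G {0<..}
            = (\<integral>\<^sup>+s. (SUP n. ennreal (G s * exp (- (1 / real (Suc n)) * s)) * indicator {0<..} s) \<partial>lborel)"
        proof (intro nn_integral_cong)
          fix s
          have "(\<lambda>n. G s * exp (- (1 / real (Suc n)) * s)) \<longlonglongrightarrow> G s * exp (- 0 * s)"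
            by (intro tendsto_intros LIMSEQ_inverse_real_of_nat[unfolded inverse_eq_divide])
          then have "(\<lambda>n. ennreal (G s * exp (- (1 / real (Suc n)) * s)) * indicator {0<..} s) \<longlonglongrightarrow> ennreal (G s * exp (- 0 * s)) * indicator {0<..} s"
            by (cases "0 < s") (auto intro: tendsto_ennrealI)
          then show "ennreal (G s) * indicator {0<..} s = (SUP n. ennreal (G s * exp (- (1 / real (Suc n)) * s)) * indicator {0<..} s)"
            using LIMSEQ_unique[OF LIMSEQ_SUP[OF inc[of s]]] by simp
        qed
        also have "\<dots> = (SUP n. U (1 / real (Suc n)) 0 0)"
          unfolding U_0 using inc
          by (intro nn_integral_monotone_convergence_SUP) (auto simp: incseq_def le_fun_def)
        finally show ?thesis .
      qed
      ultimately show False using inf by (simp add: top_unique)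
    qed
    then show ?thesis using p by simp
  qed
  have "AE \<omega> in M. \<exists>s\<ge>real n. Y s \<omega> = 0" for n
  proof -
    have [measurable]: "near (real n) T \<in> sets M" for T by (intro near_sets) simp
    have "AE \<omega> in M. \<omega> \<in> (\<Union>T. near (real n) T)"
      using one[of "real n"] by (intro AE_prob_1) (simp add: measure_def)
    moreover have "AE \<omega> in M. \<omega> \<in> (\<Union>T. near (real n) T) \<longrightarrow> (\<exists>s\<ge>real n. Y s \<omega> = 0)"
      by (rule zero_of_near_UN) simp
    ultimately show ?thesis by eventually_elim blast
  qed
  then show ?thesis unfolding AE_all_countable by blast
qed

lemma zeros_bounded:
  assumes "mass G {0<..} < \<infinity>"
  shows "AE \<omega> in M. \<exists>n::nat. \<forall>s\<ge>real n. Y s \<omega> \<noteq> 0"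
proof (rule zeros_bounded_of_potential)
  show "0 < U 0 0 0" by (rule U_pos) auto
  show "U 0 0 0 < \<infinity>" using assms by (simp add: U_0)
qed

end

section \<open>Branching and immigration mechanisms\<close>

lemma dominated_convergence_within:
  fixes f :: "real \<Rightarrow> 'a \<Rightarrow> real"
  assumes meas: "\<And>q. f q \<in> borel_measurable M" "g \<in> borel_measurable M"
    and w: "integrable M w"
    and bound: "eventually (\<lambda>q. \<forall>u\<in>space M. \<bar>f q u\<bar> \<le> w u) (at q0 within S)"
    and lim: "\<And>u. u \<in> space M \<Longrightarrow> ((\<lambda>q. f q u) \<longlongrightarrow> g u) (at q0 within S)"
  shows "((\<lambda>q. \<integral>u. f q u \<partial>M) \<longlongrightarrow> (\<integral>u. g u \<partial>M)) (at q0 within S)"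
  unfolding tendsto_at_iff_sequentially comp_def
proof (intro allI impI)
  fix X :: "nat \<Rightarrow> real" assume X: "\<forall>i. X i \<in> S - {q0}" "X \<longlonglongrightarrow> q0"
  then have F: "filterlim X (at q0 within S) sequentially"
    by (auto simp: filterlim_at)
  obtain N where N: "\<And>n. N \<le> n \<Longrightarrow> \<forall>u\<in>space M. \<bar>f (X n) u\<bar> \<le> w u"
    using filterlim_iff[THEN iffD1, OF F, rule_format, OF bound] by (auto simp: eventually_sequentially)
  show "(\<lambda>n. \<integral>u. f (X n) u \<partial>M) \<longlonglongrightarrow> (\<integral>u. g u \<partial>M)"
  proof (rule LIMSEQ_offset[of _ N], rule integral_dominated_convergence[OF meas(2) meas(1) w])
    show "AE u in M. (\<lambda>i. f (X (i + N)) u) \<longlonglongrightarrow> g u"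
    proof (rule AE_I2)
      fix u assume "u \<in> space M"
      then have "(\<lambda>i. f (X i) u) \<longlonglongrightarrow> g u" using filterlim_compose[OF lim F] by simp
      then show "(\<lambda>i. f (X (i + N)) u) \<longlonglongrightarrow> g u" by (rule LIMSEQ_ignore_initial_segment)
    qed
    show "AE u in M. norm (f (X (n + N)) u) \<le> w u" for n using N[of "n + N"] by auto
  qed
qed

lemma exp_minus_bounds:
  fixes x :: real assumes "0 \<le> x"
  shows "0 \<le> exp (- x) - 1 + x" "exp (- x) - 1 + x \<le> x\<^sup>2" "x * exp (- x) \<le> 1"
proof -
  show "0 \<le> exp (- x) - 1 + x" using exp_ge_add_one_self[of "- x"] by simp
  have x: "1 + x \<le> exp x" by (rule exp_ge_add_one_self)
  have e: "exp x * exp (- x) = 1" by (simp add: exp_add[symmetric])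
  have "(1 + x) * exp (- x) \<le> exp x * exp (- x)" by (rule mult_right_mono[OF x]) simp
  then have 1: "(1 + x) * exp (- x) \<le> 1" using e by simp
  \<comment> \<open>The product equals \<open>1 + x ^ 3\<close>.\<close>
  have "1 \<le> (1 - x + x\<^sup>2) * (1 + x)" using assms by (simp add: algebra_simps power2_eq_square)
  then have "(1 + x) * exp (- x) \<le> (1 + x) * (1 - x + x\<^sup>2)" using 1 by (simp add: mult.commute)
  then show "exp (- x) - 1 + x \<le> x\<^sup>2" using assms by (simp add: mult_le_cancel_left)
  show "x * exp (- x) \<le> 1" using 1 by (simp add: algebra_simps) (smt (verit) exp_gt_zero)
qed

section \<open>Regularity and positivity of the branching mechanism\<close>

definition comp_exp :: "real \<Rightarrow> real \<Rightarrow> real" where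
  "comp_exp q u = exp (- q * u) - 1 + q * u * indicator {0<..<1} u"

definition comp_exp' :: "real \<Rightarrow> real \<Rightarrow> real" where
  "comp_exp' q u = - u * exp (- q * u) + u * indicator {0<..<1} u"

lemma comp_exp_bound:
  assumes "0 \<le> q" "0 < u"
  shows "\<bar>comp_exp q u\<bar> \<le> (1 + q\<^sup>2) * min 1 (u\<^sup>2)"
proof (cases "u < 1")
  case True
  then have "u\<^sup>2 \<le> 1" using assms by (simp add: power_le_one)
  have "\<bar>comp_exp q u\<bar> \<le> (q * u)\<^sup>2"
    using True exp_minus_bounds[of "q * u"] assms by (simp add: comp_exp_def)
  also have "\<dots> = q\<^sup>2 * min 1 (u\<^sup>2)" using \<open>u\<^sup>2 \<le> 1\<close> by (simp add: power_mult_distrib)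
  also have "\<dots> \<le> (1 + q\<^sup>2) * min 1 (u\<^sup>2)" by (intro mult_right_mono) auto
  finally show ?thesis .
next
  case False
  then have "\<bar>comp_exp q u\<bar> = 1 - exp (- q * u)" using assms by (simp add: comp_exp_def)
  moreover have "min 1 (u\<^sup>2) = 1" using False by (simp add: min_def one_le_power)
  ultimately show ?thesis by simp (smt (verit) exp_gt_zero zero_le_power2)
qed

text \<open>Large jumps contribute \<open>u * exp (- q * u) \<le> 1 / q\<close>. The blow-up at
  \<open>q = 0\<close> is genuine: the derivative of \<open>\<Psi>\<close> may tend to
  \<open>-\<infinity>\<close> there.\<close>

lemma comp_exp'_bound:
  assumes "0 < q" "0 < u"
  shows "\<bar>comp_exp' q u\<bar> \<le> (q + 1 / q) * min 1 (u\<^sup>2)"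
proof (cases "u < 1")
  case True
  have "u\<^sup>2 \<le> 1" using True assms by (simp add: power_le_one)
  have e: "0 \<le> 1 - exp (- q * u)" "1 - exp (- q * u) \<le> q * u"
    using assms exp_minus_bounds[of "q * u"] by auto
  have "comp_exp' q u = u * (1 - exp (- q * u))" using True assms by (simp add: comp_exp'_def algebra_simps)
  then have "\<bar>comp_exp' q u\<bar> = u * (1 - exp (- q * u))" using assms e by simp
  also have "\<dots> \<le> u * (q * u)" using e assms by (intro mult_left_mono) auto
  also have "\<dots> = q * min 1 (u\<^sup>2)" using \<open>u\<^sup>2 \<le> 1\<close> by (simp add: power2_eq_square)
  also have "\<dots> \<le> (q + 1 / q) * min 1 (u\<^sup>2)" using assms by (intro mult_right_mono) auto
  finally show ?thesis .
next
  case False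
  then have "\<bar>comp_exp' q u\<bar> = u * exp (- (q * u))" using assms by (simp add: comp_exp'_def)
  also have "\<dots> \<le> 1 / q" using exp_minus_bounds(3)[of "q * u"] assms by (simp add: field_simps)
  also have "\<dots> \<le> (q + 1 / q)" using assms by simp
  moreover have "min 1 (u\<^sup>2) = 1" using False by (simp add: min_def one_le_power)
  ultimately show ?thesis by simp
qed

lemma comp_exp_deriv: "((\<lambda>q. comp_exp q u) has_real_derivative comp_exp' q u) (at q within S)"
  unfolding comp_exp_def comp_exp'_def
  by (auto intro!: derivative_eq_intros simp: algebra_simps)

lemma comp_exp_convex:
  assumes "0 < t" "t < 1"
  shows "comp_exp ((1 - t) * a + t * b) u \<le> (1 - t) * comp_exp a u + t * comp_exp b u"
proof -
  have "exp ((1 - t) *\<^sub>R (- a * u) + t *\<^sub>R (- b * u)) \<le> (1 - t) * exp (- a * u) + t * exp (- b * u)"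
    using assms by (intro convex_onD[OF exp_convex]) auto
  then show ?thesis unfolding comp_exp_def by (simp add: algebra_simps)
qed

locale jump_measure =
  fixes \<nu> :: "real measure"
  assumes sets_eq: "sets \<nu> = sets (restrict_space borel {0<..})"
begin

lemma space_eq: "space \<nu> = {0<..}"
  using sets_eq_imp_space_eq[OF sets_eq] by (simp add: space_restrict_space)

lemma measurable_jump: "f \<in> borel_measurable borel \<Longrightarrow> f \<in> borel_measurable \<nu>"
  using measurable_cong_sets[OF sets_eq refl] measurable_restrict_space1 by blast

lemma integrable_jump:
  fixes f w :: "real \<Rightarrow> real"
  assumes "(\<integral>\<^sup>+u. ennreal (w u) \<partial>\<nu>) < \<infinity>" "w \<in> borel_measurable borel" "\<And>u. 0 < u \<Longrightarrow> 0 \<le> w u"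
    and "f \<in> borel_measurable borel" "\<And>u. 0 < u \<Longrightarrow> \<bar>f u\<bar> \<le> C * w u"
  shows "integrable \<nu> f"
proof -
  have "integrable \<nu> w"
    using assms(1) by (intro integrableI_nonneg measurable_jump assms(2)) (auto simp: space_eq assms(3))
  then have "integrable \<nu> (\<lambda>u. C * w u)" by simp
  then show ?thesis
  proof (rule Bochner_Integration.integrable_bound)
    show "f \<in> borel_measurable \<nu>" by (rule measurable_jump[OF assms(4)])
    show "AE u in \<nu>. norm (f u) \<le> norm (C * w u)"
    proof (rule AE_I2)
      fix u assume "u \<in> space \<nu>"
      then have "\<bar>f u\<bar> \<le> C * w u" using assms(5)[of u] by (simp add: space_eq)
      then show "norm (f u) \<le> norm (C * w u)" by simp
    qed
  qed
qed

end

lemma comp_exp_measurable [measurable]: "comp_exp q \<in> borel_measurable borel"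
  unfolding comp_exp_def[abs_def] by measurable

lemma comp_exp'_measurable [measurable]: "comp_exp' q \<in> borel_measurable borel"
  unfolding comp_exp'_def[abs_def] by measurable

locale branching = jump_measure \<nu> for \<nu> +
  fixes \<Psi> :: "real \<Rightarrow> real" and d \<sigma> :: real
  assumes jumps: "(\<integral>\<^sup>+u. ennreal (min 1 (u\<^sup>2)) \<partial>\<nu>) < \<infinity>"
    and formula: "\<And>q. 0 \<le> q \<Longrightarrow> \<Psi> q = d * q + 1/2 * \<sigma>\<^sup>2 * q\<^sup>2 + (\<integral>u. comp_exp q u \<partial>\<nu>)"
begin

abbreviation jump_part :: "real \<Rightarrow> real" where
  "jump_part q \<equiv> \<integral>u. comp_exp q u \<partial>\<nu>"

lemma integrable_square_jump:
  assumes "f \<in> borel_measurable borel" "\<And>u. 0 < u \<Longrightarrow> \<bar>f u\<bar> \<le> C * min 1 (u\<^sup>2)"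
  shows "integrable \<nu> f"
  by (rule integrable_jump[OF jumps _ _ assms]) auto

lemma integrable_comp_exp: "0 \<le> q \<Longrightarrow> integrable \<nu> (comp_exp q)"
  by (rule integrable_square_jump[where C = "1 + q\<^sup>2"]) (auto intro: comp_exp_bound)

lemma mechanism_0: "\<Psi> 0 = 0"
  using formula[of 0] by (simp add: comp_exp_def)

lemma mechanism_convex: "convex_on {0..} \<Psi>"
proof (rule convex_onI)
  fix t x y :: real assume t: "0 < t" "t < 1" and xy: "x \<in> {0..}" "y \<in> {0..}"
  let ?z = "(1 - t) * x + t * y"
  have z: "0 \<le> ?z" using t xy by auto
  have "jump_part ?z \<le> (\<integral>u. (1 - t) * comp_exp x u + t * comp_exp y u \<partial>\<nu>)"
    using xy z t by (intro integral_mono integrable_comp_exp comp_exp_convex Bochner_Integration.integrable_add integrable_mult_right) auto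
  also have "\<dots> = (1 - t) * jump_part x + t * jump_part y"
    using xy by (simp add: integrable_comp_exp)
  finally have 1: "jump_part ?z \<le> (1 - t) * jump_part x + t * jump_part y" .
  have "((1 - t) * x\<^sup>2 + t * y\<^sup>2) - ?z\<^sup>2 = (t * (1 - t)) * (x - y)\<^sup>2"
    by (simp add: power2_eq_square algebra_simps)
  moreover have "0 \<le> (t * (1 - t)) * (x - y)\<^sup>2" using t by simp
  ultimately have "\<sigma>\<^sup>2 * ?z\<^sup>2 \<le> \<sigma>\<^sup>2 * ((1 - t) * x\<^sup>2 + t * y\<^sup>2)" by (intro mult_left_mono) auto
  moreover have "(1 - t) * (1/2 * \<sigma>\<^sup>2 * x\<^sup>2) + t * (1/2 * \<sigma>\<^sup>2 * y\<^sup>2) = 1/2 * (\<sigma>\<^sup>2 * ((1 - t) * x\<^sup>2 + t * y\<^sup>2))"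
    by (simp add: field_simps)
  ultimately have "1/2 * \<sigma>\<^sup>2 * ?z\<^sup>2 \<le> (1 - t) * (1/2 * \<sigma>\<^sup>2 * x\<^sup>2) + t * (1/2 * \<sigma>\<^sup>2 * y\<^sup>2)"
    by simp
  moreover have "d * ?z = (1 - t) * (d * x) + t * (d * y)" by (simp add: algebra_simps)
  ultimately show "\<Psi> ((1 - t) *\<^sub>R x + t *\<^sub>R y) \<le> (1 - t) * \<Psi> x + t * \<Psi> y"
    using 1 xy z by (simp add: formula distrib_left)
qed simp

text \<open>Convexity yields continuity in the open half-line only. The endpoint is needed for the
  mean value theorem on \<open>[0, z]\<close>, which turns the condition on the derivative at
  \<open>0+\<close> into a bound on \<open>\<Psi>\<close>.\<close>

lemma mechanism_continuous_0: "continuous (at 0 within {0..}) \<Psi>"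
proof -
  have "((\<lambda>q. jump_part q) \<longlongrightarrow> (\<integral>u. 0 \<partial>\<nu>)) (at 0 within {0..})"
  proof (rule dominated_convergence_within[where w = "\<lambda>u. 2 * min 1 (u\<^sup>2)"])
    show "integrable \<nu> (\<lambda>u. 2 * min 1 (u\<^sup>2))" by (rule integrable_square_jump[where C = 2]) auto
    have "eventually (\<lambda>q::real. q < 1) (at 0 within {0..})" by (intro order_tendstoD(2)[OF tendsto_ident_at]) simp
    moreover have "eventually (\<lambda>q::real. q \<ge> 0) (at 0 within {0..})" by (auto simp: eventually_at_filter)
    ultimately show "eventually (\<lambda>q. \<forall>u\<in>space \<nu>. \<bar>comp_exp q u\<bar> \<le> 2 * min 1 (u\<^sup>2)) (at 0 within {0..})"
    proof eventually_elim
      case (elim q)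
      then have q2: "1 + q\<^sup>2 \<le> 2" by (simp add: power_le_one)
      show ?case
      proof
        fix u assume "u \<in> space \<nu>"
        then have "\<bar>comp_exp q u\<bar> \<le> (1 + q\<^sup>2) * min 1 (u\<^sup>2)" using elim by (intro comp_exp_bound) (auto simp: space_eq)
        also have "\<dots> \<le> 2 * min 1 (u\<^sup>2)" using q2 by (intro mult_right_mono) auto
        finally show "\<bar>comp_exp q u\<bar> \<le> 2 * min 1 (u\<^sup>2)" .
      qed
    qed
    show "((\<lambda>q. comp_exp q u) \<longlongrightarrow> 0) (at 0 within {0..})" for u
    proof -
      have "((\<lambda>q. comp_exp q u) \<longlongrightarrow> comp_exp 0 u) (at 0 within {0..})"
        using DERIV_continuous[OF comp_exp_deriv] by (simp add: continuous_within)
      then show ?thesis by (simp add: comp_exp_def)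
    qed
  qed (auto intro: measurable_jump)
  then have "((\<lambda>q. d * q + 1/2 * \<sigma>\<^sup>2 * q\<^sup>2 + jump_part q) \<longlongrightarrow> d * 0 + 1/2 * \<sigma>\<^sup>2 * 0\<^sup>2 + (\<integral>u. 0 \<partial>\<nu>)) (at 0 within {0..})"
    by (intro tendsto_intros)
  moreover have "eventually (\<lambda>q. d * q + 1/2 * \<sigma>\<^sup>2 * q\<^sup>2 + jump_part q = \<Psi> q) (at 0 within {0..})"
    by (auto simp: eventually_at_filter formula)
  ultimately show ?thesis
    unfolding continuous_within mechanism_0 by (auto elim: Lim_transform_eventually)
qed

text \<open>Differentiation under the integral: on \<open>[q/2, 2q]\<close> the mean value theorem
  dominates the difference quotients by a multiple of \<open>min 1 (u\<^sup>2)\<close>. The constant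
  \<open>C\<close> there bounds \<open>z + 1 / z\<close> on that interval.\<close>

lemma mechanism_differentiable:
  assumes q: "0 < q"
  shows "\<exists>D. (\<Psi> has_real_derivative D) (at q)"
proof -
  define C where "C = 2 * q + 1 / (q / 2)"
  have est: "\<bar>comp_exp y u - comp_exp q u\<bar> \<le> C * min 1 (u\<^sup>2) * \<bar>y - q\<bar>"
    if y: "y \<in> {q/2..2*q}" and u: "0 < u" for y u
  proof -
    have "norm (comp_exp y u - comp_exp q u) \<le> C * min 1 (u\<^sup>2) * norm (y - q)"
    proof (rule field_differentiable_bound[where S = "{q/2..2*q}"])
      fix z assume z: "z \<in> {q/2..2*q}"
      show "((\<lambda>q. comp_exp q u) has_field_derivative comp_exp' z u) (at z within {q/2..2*q})" by (rule comp_exp_deriv)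
      have "\<bar>comp_exp' z u\<bar> \<le> (z + 1 / z) * min 1 (u\<^sup>2)" using z q u by (intro comp_exp'_bound) auto
      also have "\<dots> \<le> C * min 1 (u\<^sup>2)" unfolding C_def
        using z q by (intro mult_right_mono add_mono divide_left_mono) auto
      finally show "norm (comp_exp' z u) \<le> C * min 1 (u\<^sup>2)" by simp
    qed (use y q in auto)
    then show ?thesis by simp
  qed
  have "((\<lambda>y. \<integral>u. (comp_exp y u - comp_exp q u) / (y - q) \<partial>\<nu>) \<longlongrightarrow> (\<integral>u. comp_exp' q u \<partial>\<nu>)) (at q within UNIV)"
  proof (rule dominated_convergence_within[where w = "\<lambda>u. C * min 1 (u\<^sup>2)"])
    show "(\<lambda>u. (comp_exp y u - comp_exp q u) / (y - q)) \<in> borel_measurable \<nu>" for y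
      by (rule measurable_jump) measurable
    show "comp_exp' q \<in> borel_measurable \<nu>" by (rule measurable_jump) measurable
    show "integrable \<nu> (\<lambda>u. C * min 1 (u\<^sup>2))"
      using q by (intro integrable_square_jump[where C = C]) (auto simp: abs_mult C_def)
    have "eventually (\<lambda>y. y \<in> {q/2<..<2*q}) (at q)" using q by (intro eventually_at_in_open') auto
    moreover have "eventually (\<lambda>y. y \<noteq> q) (at q)" by (simp add: eventually_at_filter)
    ultimately show "eventually (\<lambda>y. \<forall>u\<in>space \<nu>. \<bar>(comp_exp y u - comp_exp q u) / (y - q)\<bar> \<le> C * min 1 (u\<^sup>2)) (at q)"
    proof eventually_elim
      case (elim y)
      then show ?case using est[of y] by (auto simp: space_eq divide_le_eq)
    qed
    show "((\<lambda>y. (comp_exp y u - comp_exp q u) / (y - q)) \<longlongrightarrow> comp_exp' q u) (at q)" for u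
      using comp_exp_deriv[of u q UNIV] by (simp add: has_field_derivative_iff)
  qed
  then have "((\<lambda>y. (jump_part y - jump_part q) / (y - q)) \<longlongrightarrow> (\<integral>u. comp_exp' q u \<partial>\<nu>)) (at q)"
  proof (rule Lim_transform_eventually)
    have "eventually (\<lambda>y. y \<in> {q/2<..<2*q}) (at q)" using q by (intro eventually_at_in_open') auto
    then show "eventually (\<lambda>y. (\<integral>u. (comp_exp y u - comp_exp q u) / (y - q) \<partial>\<nu>)
      = (jump_part y - jump_part q) / (y - q)) (at q)"
      by eventually_elim (use q in \<open>simp add: integrable_comp_exp\<close>)
  qed
  then have "((\<lambda>q. jump_part q) has_real_derivative (\<integral>u. comp_exp' q u \<partial>\<nu>)) (at q)"
    by (simp add: has_field_derivative_iff)
  then have "((\<lambda>q. d * q + 1/2 * \<sigma>\<^sup>2 * q\<^sup>2 + jump_part q) has_real_derivative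
      (d * 1 + 1/2 * \<sigma>\<^sup>2 * (2 * q) + (\<integral>u. comp_exp' q u \<partial>\<nu>))) (at q)"
    by (auto intro!: derivative_eq_intros)
  then have "(\<Psi> has_real_derivative (d * 1 + 1/2 * \<sigma>\<^sup>2 * (2 * q) + (\<integral>u. comp_exp' q u \<partial>\<nu>))) (at q)"
    by (rule has_field_derivative_transform_within_open[where S = "{0<..}"]) (auto simp: formula q)
  then show ?thesis by blast
qed

text \<open>The second difference of \<open>\<Psi>\<close> at \<open>0, z/2, z\<close> is
  \<open>\<sigma>\<^sup>2 z\<^sup>2 / 4 + \<integral>(1 - exp (- z u / 2))\<^sup>2 \<nu>(du)\<close>.\<close>

lemma mechanism_degenerate:
  assumes z: "0 < z" "\<Psi> z = 0" "\<Psi> (z / 2) = 0" and "0 \<le> q"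
  shows "\<Psi> q = 0"
proof -
  define g where "g u = (1 - exp (- z * u / 2))\<^sup>2" for u :: real
  have g: "g u = comp_exp z u - 2 * comp_exp (z / 2) u" for u
  proof -
    have "exp (- z * u) = (exp (- z * u / 2))\<^sup>2" by (simp add: power2_eq_square exp_add[symmetric])
    then show ?thesis by (simp add: g_def comp_exp_def power2_eq_square algebra_simps)
  qed
  have int_g: "integrable \<nu> g" unfolding g using z by (intro Bochner_Integration.integrable_diff integrable_mult_right integrable_comp_exp) auto
  have "(\<integral>u. g u \<partial>\<nu>) = jump_part z - 2 * jump_part (z / 2)"
    unfolding g using z by (simp add: integrable_comp_exp)
  moreover have "\<Psi> z - 2 * \<Psi> (z / 2) = \<sigma>\<^sup>2 * z\<^sup>2 / 4 + (jump_part z - 2 * jump_part (z / 2))"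
    using z by (simp add: formula power2_eq_square algebra_simps)
  ultimately have sum0: "\<sigma>\<^sup>2 * z\<^sup>2 / 4 + (\<integral>u. g u \<partial>\<nu>) = 0" using z by simp
  have nn: "0 \<le> \<sigma>\<^sup>2 * z\<^sup>2 / 4" "0 \<le> (\<integral>u. g u \<partial>\<nu>)" by (auto simp: g_def)
  then have g0: "(\<integral>u. g u \<partial>\<nu>) = 0" and "\<sigma>\<^sup>2 * z\<^sup>2 / 4 = 0" using sum0 by linarith+
  then have \<sigma>: "\<sigma> = 0" using z(1) by simp
  have "AE u in \<nu>. g u = 0"
    using g0 by (subst (asm) integral_nonneg_eq_0_iff_AE[OF int_g]) (auto simp: g_def)
  \<comment> \<open>\<open>g\<close> is strictly positive on \<open>(0, \<infinity>)\<close>, so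
    \<open>\<nu>\<close> is the null measure. With \<open>\<sigma> = 0\<close> the mechanism is
    linear, and its zero at \<open>z\<close> makes the slope vanish.\<close>
  then have "AE u in \<nu>. False"
    using AE_space
  proof eventually_elim
    case (elim u)
    then have "exp (- z * u / 2) < 1" using z(1) by (simp add: space_eq)
    then have "1 - exp (- z * u / 2) \<noteq> 0" by linarith
    then show False using elim(1) unfolding g_def power2_eq_square mult_eq_0_iff by blast
  qed
  then have zero: "(\<integral>u. f u \<partial>\<nu>) = 0" for f :: "real \<Rightarrow> real"
    by (intro integral_eq_zero_AE) (auto elim: AE_mp)
  have "\<Psi> p = d * p" if "0 \<le> p" for p using that \<sigma> zero by (simp add: formula)
  then show ?thesis using z assms(4) by auto
qed

end

lemma branching_mechanismD:
  assumes "branching_mechanism \<Psi>"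
  shows "\<exists>\<nu> d \<sigma>. branching \<nu> \<Psi> d \<sigma>"
proof -
  obtain d \<sigma> :: real and \<nu> :: "real measure" where *: "sets \<nu> = sets (restrict_space borel {0<..})"
    "(\<integral>\<^sup>+u. ennreal (min 1 (u\<^sup>2)) \<partial>\<nu>) < \<infinity>"
    "\<forall>q\<ge>0. \<Psi> q = d * q + 1/2 * \<sigma>\<^sup>2 * q\<^sup>2 + (\<integral>u. (exp (- q * u) - 1 + q * u * indicator {0<..<1} u) \<partial>\<nu>)"
    using assms unfolding branching_mechanism_def by blast
  have "branching \<nu> \<Psi> d \<sigma>"
    by standard (use * in \<open>auto simp: comp_exp_def\<close>)
  then show ?thesis by blast
qed

lemma convex_ratio_mono:
  assumes "convex_on {0..} f" "f 0 = 0" "0 < a" "a \<le> (b::real)"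
  shows "f a / a \<le> f b / b"
proof -
  have "f ((1 - a / b) *\<^sub>R 0 + (a / b) *\<^sub>R b) \<le> (1 - a / b) * f 0 + (a / b) * f b"
    using assms by (intro convex_onD[OF assms(1)]) auto
  then have "f a \<le> (a / b) * f b" using assms by simp
  then show ?thesis using assms by (simp add: field_simps)
qed

text \<open>By the mean value theorem \<open>\<Psi> z / z\<close> is a value of the derivative near
  \<open>0\<close>, hence at least \<open>- e\<close> for small \<open>z\<close>; this ratio is
  nondecreasing by convexity, so \<open>\<Psi> \<ge> 0\<close>. A zero at \<open>q\<close> would
  entail one at \<open>q / 2\<close>, and two such zeros make \<open>\<Psi>\<close> vanish
  identically, contrary to its sign at \<open>\<theta>\<close>.\<close>

lemma critical_or_subcritical_pos:
  assumes "branching_mechanism \<Psi>" "critical_or_subcritical \<Psi>" "0 < \<theta>" "0 < \<Psi> \<theta>" "0 < q"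
  shows "0 < \<Psi> q"
proof -
  obtain \<nu> d \<sigma> where "branching \<nu> \<Psi> d \<sigma>" using branching_mechanismD[OF assms(1)] by blast
  then interpret branching \<nu> \<Psi> d \<sigma> .
  obtain l where l: "0 \<le> l" "(deriv \<Psi> \<longlongrightarrow> l) (at_right 0)"
    using assms(2) by (auto simp: critical_or_subcritical_def)
  have der: "(\<Psi> has_real_derivative deriv \<Psi> z) (at z)" if "0 < z" for z
    using mechanism_differentiable[OF that] DERIV_imp_deriv by metis
  have nonneg: "0 \<le> \<Psi> y" if y: "0 < y" for y
  proof -
    have lower: "- e \<le> \<Psi> y / y" if e: "0 < e" for e
    proof -
      have "eventually (\<lambda>z. - e < deriv \<Psi> z) (at_right 0)" using l e by (intro order_tendstoD(1)) auto
      then obtain b where b: "0 < b" "\<And>z. 0 < z \<Longrightarrow> z < b \<Longrightarrow> - e < deriv \<Psi> z"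
        by (auto simp: eventually_at_right_field)
      define z where "z = min y b / 2"
      have z: "0 < z" "z \<le> y" "z < b" using y b by (auto simp: z_def)
      have "continuous_on {0..z} \<Psi>"
        unfolding continuous_on_eq_continuous_within
      proof
        fix w assume w: "w \<in> {0..z}"
        show "continuous (at w within {0..z}) \<Psi>"
        proof (cases "w = 0")
          case True
          then show ?thesis using mechanism_continuous_0 by (auto intro: continuous_within_subset)
        next
          case False
          then show ?thesis using w der[of w] DERIV_isCont continuous_at_imp_continuous_at_within by fastforce
        qed
      qed
      moreover have "(\<Psi> has_derivative (\<lambda>h. deriv \<Psi> w * h)) (at w)" if "0 < w" for w
        using der[OF that] by (simp add: has_field_derivative_def)
      ultimately obtain \<xi> where \<xi>: "0 < \<xi>" "\<xi> < z" "\<Psi> z - \<Psi> 0 = deriv \<Psi> \<xi> * (z - 0)"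
        using mvt[OF z(1), of \<Psi> "\<lambda>w h. deriv \<Psi> w * h"] by metis
      then have "\<Psi> z / z = deriv \<Psi> \<xi>" using z mechanism_0 by simp
      then have "- e \<le> \<Psi> z / z" using b(2)[of \<xi>] \<xi> z by simp
      also have "\<dots> \<le> \<Psi> y / y" by (rule convex_ratio_mono[OF mechanism_convex mechanism_0 z(1,2)])
      finally show ?thesis .
    qed
    have "0 \<le> \<Psi> y / y"
    proof (rule field_le_epsilon)
      fix e :: real assume "0 < e"
      then show "0 \<le> \<Psi> y / y + e" using lower[of e] by linarith
    qed
    then show ?thesis using y by (simp add: zero_le_divide_iff)
  qed
  have "\<Psi> q \<noteq> 0"
  proof
    assume 0: "\<Psi> q = 0"
    then have "\<Psi> (q / 2) / (q / 2) \<le> 0"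
      using convex_ratio_mono[OF mechanism_convex mechanism_0, of "q / 2" q] assms(5) by simp
    then have "\<Psi> (q / 2) = 0" using nonneg[of "q / 2"] assms(5) by (simp add: divide_le_0_iff)
    then have "\<Psi> \<theta> = 0" using mechanism_degenerate[OF assms(5) 0] assms(3) by simp
    then show False using assms(4) by simp
  qed
  then show ?thesis using nonneg[OF assms(5)] by simp
qed

text \<open>Concavity together with \<open>\<Phi> 0 = 0\<close> gives the last two claims:
  continuity inside the half-line, and \<open>\<Phi> q / q\<close> nonincreasing. The linear growth
  bound is what limits \<open>G\<close> near time \<open>0\<close>.\<close>

lemma immigration_mechanism_properties:
  assumes "immigration_mechanism \<Phi>"
  shows "\<And>q. 0 \<le> q \<Longrightarrow> 0 \<le> \<Phi> q"
    and "continuous_on {0<..} \<Phi>"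
    and "\<And>q. 1 \<le> q \<Longrightarrow> \<Phi> q \<le> \<Phi> 1 * q"
proof -
  obtain \<beta> :: real and \<nu> :: "real measure" where *: "0 \<le> \<beta>"
    "sets \<nu> = sets (restrict_space borel {0<..})" "(\<integral>\<^sup>+u. ennreal (min 1 u) \<partial>\<nu>) < \<infinity>"
    and formula: "\<And>q. 0 \<le> q \<Longrightarrow> \<Phi> q = \<beta> * q + (\<integral>u. (1 - exp (- q * u)) \<partial>\<nu>)"
    using assms unfolding immigration_mechanism_def by blast
  interpret jump_measure \<nu> by standard (rule *)
  have int: "integrable \<nu> (\<lambda>u. 1 - exp (- q * u))" if q: "0 \<le> q" for q
  proof (rule integrable_jump[OF *(3), where C = "1 + q"])
    fix u :: real assume u: "0 < u"
    have "0 \<le> 1 - exp (- q * u)" "1 - exp (- q * u) \<le> q * u" "1 - exp (- q * u) \<le> 1"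
      using u q exp_minus_bounds[of "q * u"] by auto
    moreover have "q * u \<le> (1 + q) * min 1 u" if "u \<le> 1" using that u by (simp add: min_def distrib_right)
    moreover have "1 \<le> (1 + q) * min 1 u" if "1 < u" using that q by (simp add: min_def)
    ultimately show "\<bar>1 - exp (- q * u)\<bar> \<le> (1 + q) * min 1 u" by linarith
  qed auto
  show nonneg: "0 \<le> \<Phi> q" if "0 \<le> q" for q
    using that * by (auto simp: formula space_eq intro!: add_nonneg_nonneg integral_nonneg_AE AE_I2)
  have convex: "convex_on {0..} (\<lambda>q. - \<Phi> q)"
  proof (rule convex_onI)
    fix t x y :: real assume t: "0 < t" "t < 1" and xy: "x \<in> {0..}" "y \<in> {0..}"
    let ?z = "(1 - t) * x + t * y"
    have z: "0 \<le> ?z" using t xy by auto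
    have "(1 - t) * (\<integral>u. 1 - exp (- x * u) \<partial>\<nu>) + t * (\<integral>u. 1 - exp (- y * u) \<partial>\<nu>)
      = (\<integral>u. (1 - t) * (1 - exp (- x * u)) + t * (1 - exp (- y * u)) \<partial>\<nu>)"
      using int[of x] int[of y] xy by simp
    also have "\<dots> \<le> (\<integral>u. 1 - exp (- ?z * u) \<partial>\<nu>)"
    proof (intro integral_mono int Bochner_Integration.integrable_add integrable_mult_right)
      fix u
      have "exp ((1 - t) *\<^sub>R (- x * u) + t *\<^sub>R (- y * u)) \<le> (1 - t) * exp (- x * u) + t * exp (- y * u)"
        using t by (intro convex_onD[OF exp_convex]) auto
      then show "(1 - t) * (1 - exp (- x * u)) + t * (1 - exp (- y * u)) \<le> 1 - exp (- ?z * u)"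
        by (simp add: algebra_simps)
    qed (use xy z in auto)
    finally show "- \<Phi> ((1 - t) *\<^sub>R x + t *\<^sub>R y) \<le> (1 - t) * - \<Phi> x + t * - \<Phi> y"
      using xy z by (simp add: formula algebra_simps)
  qed simp
  then have "convex_on {0<..} (\<lambda>q. - \<Phi> q)" by (rule convex_on_subset) auto
  then have "continuous_on {0<..} (\<lambda>q. - \<Phi> q)" by (intro convex_on_continuous) auto
  then show "continuous_on {0<..} \<Phi>" using continuous_on_minus[of "{0<..}" "\<lambda>q. - \<Phi> q"] by simp
  have "\<Phi> 0 = 0" using formula[of 0] by simp
  then show "\<Phi> q \<le> \<Phi> 1 * q" if "1 \<le> q" for q
    using convex_ratio_mono[OF convex, of 1 q] that by (simp add: field_simps)
qed

section \<open>The flow started at infinity\<close>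

text \<open>The oriented integral from \<open>a\<close> to \<open>z\<close>: one of the two terms
  always vanishes. In this form it is, on either side of \<open>a\<close>, literally the set
  integral in the exponents of the theorem.\<close>

definition primitive :: "(real \<Rightarrow> real) \<Rightarrow> real \<Rightarrow> real \<Rightarrow> real" where
  "primitive f a z = (LBINT u:{a..z}. f u) - (LBINT u:{z..a}. f u)"

lemma LBINT_singleton [simp]: "(LBINT u:{a}. f u) = (0::real)" for a :: real
  unfolding set_lebesgue_integral_def
proof (rule integral_eq_zero_AE)
  show "AE u in lborel. indicator {a} u *\<^sub>R f u = 0"
    using AE_lborel_singleton[of a] by eventually_elim auto
qed

lemma LBINT_empty [simp]: "(LBINT u:{}. f u) = (0::real)" for f :: "real \<Rightarrow> real"
  by (simp add: set_lebesgue_integral_def)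

lemma primitive_base [simp]: "primitive f a a = 0"
  by (simp add: primitive_def)

lemma primitive_right: "a \<le> z \<Longrightarrow> primitive f a z = (LBINT u:{a..z}. f u)"
  by (cases "a = z") (auto simp: primitive_def)

lemma primitive_left: "z \<le> a \<Longrightarrow> primitive f a z = - (LBINT u:{z..a}. f u)"
  by (cases "a = z") (auto simp: primitive_def)

lemma LBINT_eq_integral:
  fixes f :: "real \<Rightarrow> real"
  assumes "continuous_on {a..b} f"
  shows "(LBINT u:{a..b}. f u) = integral {a..b} f"
  using set_borel_integral_eq_integral(2)[OF borel_integrable_atLeastAtMost'[OF assms]] .

lemma primitive_has_derivative:
  assumes f: "continuous_on {r<..} f" and a: "r < a" and z: "r < z"
  shows "(primitive f a has_real_derivative f z) (at z)"
proof -
  define c where "c = (r + min a z) / 2"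
  define b where "b = max a z + 1"
  have c: "r < c" "c < a" "c < z" "a < b" "z < b" using a z by (auto simp: c_def b_def)
  have cont: "continuous_on S f" if "S \<subseteq> {c..b}" for S
    using f by (rule continuous_on_subset) (use that c in auto)
  have int: "f integrable_on {p..q}" if "c \<le> p" "q \<le> b" for p q
    using cont[of "{p..q}"] that by (intro integrable_continuous_real) auto
  have eq: "primitive f a y = integral {c..y} f - integral {c..a} f" if y: "y \<in> {c<..<b}" for y
  proof (cases "a \<le> y")
    case True
    have "integral {c..a} f + integral {a..y} f = integral {c..y} f"
      using True c y by (intro Henstock_Kurzweil_Integration.integral_combine int) auto
    moreover have "(LBINT u:{a..y}. f u) = integral {a..y} f"
      using y c by (intro LBINT_eq_integral cont) auto
    ultimately show ?thesis using True by (simp add: primitive_right)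
  next
    case False
    have "integral {c..y} f + integral {y..a} f = integral {c..a} f"
      using False c y by (intro Henstock_Kurzweil_Integration.integral_combine int) auto
    moreover have "(LBINT u:{y..a}. f u) = integral {y..a} f"
      using y c by (intro LBINT_eq_integral cont) auto
    ultimately show ?thesis using False by (simp add: primitive_left)
  qed
  have "((\<lambda>y. integral {c..y} f) has_real_derivative f z) (at z within {c..b})"
    using c by (intro integral_has_real_derivative cont) auto
  then have "((\<lambda>y. integral {c..y} f - integral {c..a} f) has_real_derivative f z) (at z)"
    using c by (simp add: at_within_Icc_at) (auto intro!: derivative_eq_intros)
  then show ?thesis
    by (rule has_field_derivative_transform_within_open[where S = "{c<..<b}"]) (use c eq in auto)
qed

section \<open>Grey's integral and its inverse\<close>

locale flow =
  fixes \<Psi> :: "real \<Rightarrow> real" and \<theta> :: real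
  assumes mech_0: "\<Psi> 0 = 0" and mech_convex: "convex_on {0..} \<Psi>"
    and \<theta>_pos: "0 < \<theta>" and mech_pos_\<theta>: "\<And>u. \<theta> \<le> u \<Longrightarrow> 0 < \<Psi> u"
    and grey: "mass (\<lambda>q. 1 / \<Psi> q) {\<theta>..} < \<infinity>"
begin

text \<open>The largest root of \<open>\<Psi>\<close>, positive in the supercritical case. The flow
  started at infinity lives above it and decreases towards it, so everything below is done on
  \<open>(\<rho>, \<infinity>)\<close> and polarity needs no sign condition near
  \<open>0\<close>.\<close>

definition \<rho> :: real where "\<rho> = Sup {q. 0 \<le> q \<and> \<Psi> q \<le> 0}"

lemma mech_continuous: "continuous_on {0<..} \<Psi>"
  by (intro convex_on_continuous convex_on_subset[OF mech_convex]) auto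

lemma root_set: "0 \<in> {q. 0 \<le> q \<and> \<Psi> q \<le> 0}" "bdd_above {q. 0 \<le> q \<and> \<Psi> q \<le> 0}"
proof -
  show "0 \<in> {q. 0 \<le> q \<and> \<Psi> q \<le> 0}" using mech_0 by simp
  have "q \<le> \<theta>" if "\<Psi> q \<le> 0" for q using mech_pos_\<theta>[of q] that by (cases "q \<le> \<theta>") auto
  then show "bdd_above {q. 0 \<le> q \<and> \<Psi> q \<le> 0}" by (auto simp: bdd_above_def)
qed

lemma \<rho>_nonneg: "0 \<le> \<rho>"
  unfolding \<rho>_def using root_set by (rule cSup_upper)

lemma mech_pos: "\<rho> < q \<Longrightarrow> 0 < \<Psi> q"
proof (rule ccontr)
  assume q: "\<rho> < q" "\<not> 0 < \<Psi> q"
  then have "q \<in> {q. 0 \<le> q \<and> \<Psi> q \<le> 0}" using \<rho>_nonneg by auto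
  then have "q \<le> \<rho>" unfolding \<rho>_def using root_set(2) by (rule cSup_upper)
  then show False using q by simp
qed

lemma mech_\<rho>: "\<Psi> \<rho> \<le> 0"
proof (rule ccontr)
  assume "\<not> \<Psi> \<rho> \<le> 0"
  then have p: "0 < \<Psi> \<rho>" by simp
  then have "\<rho> \<noteq> 0" using mech_0 by auto
  then have \<rho>: "0 < \<rho>" using \<rho>_nonneg by simp
  have "isCont \<Psi> \<rho>" using mech_continuous \<rho> by (simp add: continuous_on_eq_continuous_at)
  then have "eventually (\<lambda>q. 0 < \<Psi> q) (at \<rho>)" using p by (auto simp: isCont_def dest: order_tendstoD(1))
  then obtain d where d: "d > 0" "\<And>q. q \<noteq> \<rho> \<Longrightarrow> dist q \<rho> < d \<Longrightarrow> 0 < \<Psi> q"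
    by (auto simp: eventually_at)
  have "\<rho> - d < Sup {q. 0 \<le> q \<and> \<Psi> q \<le> 0}" using d by (simp add: \<rho>_def[symmetric])
  then obtain q where q: "\<rho> - d < q" "0 \<le> q" "\<Psi> q \<le> 0"
    using less_cSup_iff[of "{q. 0 \<le> q \<and> \<Psi> q \<le> 0}"] root_set by auto
  then have "q \<le> \<rho>" using mech_pos[of q] by (cases "q \<le> \<rho>") auto
  then show False using q d(2)[of q] p by (cases "q = \<rho>") (auto simp: dist_real_def)
qed

lemma \<rho>_less: "\<rho> < \<theta>"
  using mech_\<rho> mech_pos_\<theta>[of \<rho>] by (cases "\<rho> < \<theta>") auto

lemma \<rho>_eq_0: "(\<And>q. 0 < q \<Longrightarrow> 0 < \<Psi> q) \<Longrightarrow> \<rho> = 0"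
  using mech_\<rho> \<rho>_nonneg by (metis leD less_eq_real_def)

lemma cont_above: "continuous_on {\<rho><..} \<Psi>"
  using mech_continuous by (rule continuous_on_subset) (use \<rho>_nonneg in auto)

definition L :: "real \<Rightarrow> real" where "L = primitive (\<lambda>q. 1 / \<Psi> q) \<theta>"

lemma cont_inverse: "continuous_on {\<rho><..} (\<lambda>q. 1 / \<Psi> q)"
  using mech_pos by (intro continuous_intros cont_above) force

lemma L_deriv: "\<rho> < z \<Longrightarrow> (L has_real_derivative 1 / \<Psi> z) (at z)"
  unfolding L_def by (rule primitive_has_derivative[OF cont_inverse \<rho>_less])

lemma L_less: "\<rho> < z \<Longrightarrow> z < z' \<Longrightarrow> L z < L z'"
  by (rule DERIV_pos_imp_increasing[of z z' L])
     (auto intro!: exI[of _ "1 / \<Psi> _"] L_deriv simp: mech_pos)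

lemma L_bounded:
  assumes "\<theta> \<le> z"
  shows "L z \<le> enn2real (mass (\<lambda>q. 1 / \<Psi> q) {\<theta>..})"
proof -
  have "set_integrable lborel {\<theta>..z} (\<lambda>q. 1 / \<Psi> q)"
    by (rule borel_integrable_atLeastAtMost') (rule continuous_on_subset[OF cont_inverse], use \<rho>_less in auto)
  then have int: "integrable lborel (\<lambda>q. indicator {\<theta>..z} q *\<^sub>R (1 / \<Psi> q))" by (simp add: set_integrable_def)
  have "ennreal (L z) = (\<integral>\<^sup>+q. ennreal (indicator {\<theta>..z} q *\<^sub>R (1 / \<Psi> q)) \<partial>lborel)"
    unfolding L_def primitive_right[OF assms] set_lebesgue_integral_def
    using mech_pos_\<theta> by (intro nn_integral_eq_integral[symmetric] int) (auto simp: indicator_def less_imp_le)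
  also have "\<dots> \<le> mass (\<lambda>q. 1 / \<Psi> q) {\<theta>..}"
    by (intro nn_integral_mono) (auto simp: indicator_def)
  finally have "enn2real (ennreal (L z)) \<le> enn2real (mass (\<lambda>q. 1 / \<Psi> q) {\<theta>..})"
    using grey by (intro enn2real_mono) auto
  moreover have "0 \<le> L z" using L_less[OF \<rho>_less, of z] assms by (cases "z = \<theta>") (auto simp: L_def)
  ultimately show ?thesis by simp
qed

text \<open>\<open>hit\<close> is \<open>\<integral>\<^sub>\<theta>\<^sup>\<infinity> dq / \<Psi> q\<close>, so \<open>H z = \<integral>\<^sub>z\<^sup>\<infinity> dq / \<Psi> q\<close>.\<close>

definition hit :: real where "hit = (SUP z\<in>{\<theta>..}. L z)"

definition H :: "real \<Rightarrow> real" where "H z = hit - L z"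

lemma L_bdd: "bdd_above (L ` {\<theta>..})"
  using L_bounded by (auto simp: bdd_above_def)

lemma H_\<theta>: "H \<theta> = hit"
  by (simp add: H_def L_def)

lemma H_deriv: "\<rho> < z \<Longrightarrow> (H has_real_derivative - (1 / \<Psi> z)) (at z)"
  unfolding H_def[abs_def] by (auto intro!: derivative_eq_intros L_deriv)

lemma H_less: "\<rho> < z \<Longrightarrow> z < z' \<Longrightarrow> H z' < H z"
  using L_less[of z z'] by (simp add: H_def)

lemma H_pos: "\<rho> < z \<Longrightarrow> 0 < H z"
proof -
  assume z: "\<rho> < z"
  have "L z < L (max z \<theta> + 1)" using z by (intro L_less) auto
  also have "\<dots> \<le> hit" unfolding hit_def by (rule cSUP_upper[OF _ L_bdd]) auto
  finally show ?thesis by (simp add: H_def)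
qed

lemma H_small: "0 < e \<Longrightarrow> \<exists>z\<ge>\<theta>. H z < e"
proof -
  assume "0 < e"
  then have "hit - e < (SUP z\<in>{\<theta>..}. L z)" by (simp add: hit_def)
  then obtain z where "z \<ge> \<theta>" "hit - e < L z" using less_cSUP_iff[OF _ L_bdd] by auto
  then show ?thesis by (auto simp: H_def)
qed

text \<open>By convexity \<open>\<Psi>\<close> lies below a chord vanishing at \<open>\<rho>\<close>, hence \<open>1 / \<Psi>\<close> is not integrable at \<open>\<rho>\<close>.\<close>

lemma H_large: "\<exists>z>\<rho>. K < H z"
proof -
  define c where "c = (\<theta> - \<rho>) / \<Psi> \<theta>"
  have c: "0 < c" using \<rho>_less mech_pos_\<theta>[of \<theta>] by (simp add: c_def)
  have chord: "c / (z - \<rho>) \<le> 1 / \<Psi> z" if z: "\<rho> < z" "z \<le> \<theta>" for z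
  proof -
    define s where "s = (z - \<rho>) / (\<theta> - \<rho>)"
    have s: "0 < s" "s \<le> 1" using z by (auto simp: s_def)
    have "s * (\<theta> - \<rho>) = z - \<rho>" using z by (simp add: s_def)
    then have "(1 - s) *\<^sub>R \<rho> + s *\<^sub>R \<theta> = z" by (simp add: algebra_simps)
    moreover have "\<Psi> ((1 - s) *\<^sub>R \<rho> + s *\<^sub>R \<theta>) \<le> (1 - s) * \<Psi> \<rho> + s * \<Psi> \<theta>"
      using s \<rho>_nonneg \<theta>_pos by (intro convex_onD[OF mech_convex]) auto
    moreover have "(1 - s) * \<Psi> \<rho> \<le> 0" using s mech_\<rho> by (simp add: mult_nonneg_nonpos)
    ultimately have "\<Psi> z \<le> s * \<Psi> \<theta>" by simp
    also have "s * \<Psi> \<theta> = (z - \<rho>) / c" using mech_pos_\<theta>[of \<theta>] z by (simp add: s_def c_def)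
    finally show ?thesis using mech_pos[OF z(1)] c z by (simp add: field_simps)
  qed
  have upper: "L z \<le> c * ln (z - \<rho>) - c * ln (\<theta> - \<rho>)" if z: "\<rho> < z" "z \<le> \<theta>" for z
  proof -
    have "L z - c * ln (z - \<rho>) \<le> L \<theta> - c * ln (\<theta> - \<rho>)"
    proof (rule DERIV_nonneg_imp_nondecreasing[OF z(2)])
      fix w assume w: "z \<le> w" "w \<le> \<theta>"
      then have "((\<lambda>w. L w - c * ln (w - \<rho>)) has_real_derivative 1 / \<Psi> w - c * (1 / (w - \<rho>))) (at w)"
        using z by (auto intro!: derivative_eq_intros L_deriv)
      moreover have "0 \<le> 1 / \<Psi> w - c * (1 / (w - \<rho>))" using chord[of w] w z by simp
      ultimately show "\<exists>y. ((\<lambda>w. L w - c * ln (w - \<rho>)) has_real_derivative y) (at w) \<and> 0 \<le> y" by blast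
    qed
    then show ?thesis by (simp add: L_def)
  qed
  \<comment> \<open>Chosen so that the chord bound
    \<open>c * ln ((z - \<rho>) / (\<theta> - \<rho>))\<close> is at most
    \<open>hit - K - 1\<close>; the cap keeps \<open>z \<le> \<theta>\<close>, where the chord
    estimate is valid, and the \<open>1\<close> makes the final inequality strict.\<close>
  define z where "z = \<rho> + min (\<theta> - \<rho>) (exp ((hit - K - 1) / c + ln (\<theta> - \<rho>)))"
  have z: "\<rho> < z" "z \<le> \<theta>" "z - \<rho> \<le> exp ((hit - K - 1) / c + ln (\<theta> - \<rho>))" using \<rho>_less by (auto simp: z_def)
  then have "ln (z - \<rho>) \<le> (hit - K - 1) / c + ln (\<theta> - \<rho>)"
    using ln_le_cancel_iff[of "z - \<rho>" "exp ((hit - K - 1) / c + ln (\<theta> - \<rho>))"] by simp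
  then have "c * ln (z - \<rho>) \<le> c * ((hit - K - 1) / c + ln (\<theta> - \<rho>))" using c by (intro mult_left_mono) auto
  also have "\<dots> = hit - K - 1 + c * ln (\<theta> - \<rho>)" using c by (simp add: distrib_left)
  finally have "L z \<le> hit - K - 1" using upper[OF z(1,2)] by simp
  then show ?thesis using z(1) by (auto simp: H_def)
qed

lemma H_isCont: "\<rho> < z \<Longrightarrow> isCont H z"
  using H_deriv DERIV_isCont by blast

lemma H_surj: "0 < s \<Longrightarrow> \<exists>z>\<rho>. H z = s"
proof -
  assume s: "0 < s"
  obtain z1 where z1: "z1 > \<rho>" "s < H z1" using H_large by blast
  obtain z2 where z2: "z2 \<ge> \<theta>" "H z2 < s" using H_small[OF s] by blast
  have z2\<rho>: "\<rho> < z2" using z2 \<rho>_less by simp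
  have "z1 \<le> z2"
    using H_less[OF z2\<rho>, of z1] z1 z2 by (cases "z1 \<le> z2") auto
  then obtain z where "z1 \<le> z" "z \<le> z2" "H z = s"
    using IVT2[of H z2 s z1] z1 z2 H_isCont by force
  then show ?thesis using z1 by (intro exI[of _ z]) auto
qed

lemma H_inj: "inj_on H {\<rho><..}"
  by (rule linorder_inj_onI') (use H_less in force)

text \<open>The flow at time \<open>s\<close> started at infinity. The value \<open>0\<close> for
  \<open>s \<le> 0\<close> makes \<open>V\<close> Borel on the whole line.\<close>

definition V :: "real \<Rightarrow> real" where
  "V s = (if 0 < s then inv_into {\<rho><..} H s else 0)"

lemma V_H: "\<rho> < z \<Longrightarrow> V (H z) = z"
  using H_pos[of z] inv_into_f_f[OF H_inj, of z] by (simp add: V_def)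

lemma V_above: "0 < s \<Longrightarrow> \<rho> < V s" and H_V: "0 < s \<Longrightarrow> H (V s) = s"
  using H_surj[of s] V_H by auto

lemma V_pos: "0 < s \<Longrightarrow> 0 < V s"
  using V_above[of s] \<rho>_nonneg by simp

lemma V_less: "0 < s \<Longrightarrow> s < s' \<Longrightarrow> V s' < V s"
proof (rule ccontr)
  assume s: "0 < s" "s < s'" "\<not> V s' < V s"
  then consider "V s = V s'" | "V s < V s'" by linarith
  then show False
    using H_V[of s] H_V[of s'] H_less[OF V_above, of s "V s'"] s by cases auto
qed

lemma V_isCont:
  assumes "0 < s"
  shows "isCont V s"
proof -
  define d where "d = (V s - \<rho>) / 2"
  have d: "0 < d" using V_above[OF assms] by (simp add: d_def)
  have near: "\<rho> < z" if "\<bar>z - V s\<bar> \<le> d" for z using that V_above[OF assms] by (simp add: d_def abs_if split: if_splits)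
  have "isCont V (H (V s))"
    by (rule isCont_inverse_function[OF d]) (auto intro: V_H H_isCont near)
  then show ?thesis using H_V[OF assms] by simp
qed

lemma V_continuous: "continuous_on {0<..} V"
  using V_isCont by (auto intro: continuous_at_imp_continuous_on)

lemma V_measurable [measurable]: "V \<in> borel_measurable borel"
proof -
  have "(\<lambda>s. if s \<in> {0<..} then V s else 0) \<in> borel_measurable borel"
    using V_continuous by (intro borel_measurable_continuous_on_if) auto
  also have "(\<lambda>s. if s \<in> {0<..} then V s else 0) = V" by (auto simp: V_def)
  finally show ?thesis .
qed

lemma V_tendsto: "filterlim V at_top (at_right 0)"
  unfolding filterlim_at_top
proof
  fix Z :: real
  define z where "z = max Z \<theta>"
  have z: "\<rho> < z" "Z \<le> z" using \<rho>_less by (auto simp: z_def)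
  have "Z \<le> V s" if "0 < s" "s < H z" for s
    using V_less[OF that] V_H[OF z(1)] z by simp
  then show "eventually (\<lambda>s. Z \<le> V s) (at_right 0)"
    unfolding eventually_at_right_field using H_pos[OF z(1)] by blast
qed

text \<open>The substitution \<open>s = H z\<close>, \<open>ds = - dz / \<Psi> z\<close>, done on
  compact intervals and extended by monotone convergence to all of
  \<open>(\<rho>, \<infinity>)\<close>.\<close>

lemma nn_integral_time_change:
  fixes F :: "real \<Rightarrow> ennreal"
  assumes [measurable]: "F \<in> borel_measurable borel"
  shows "(\<integral>\<^sup>+z\<in>{\<rho><..}. F (H z) * ennreal (1 / \<Psi> z) \<partial>lborel) = (\<integral>\<^sup>+s\<in>{0<..}. F s \<partial>lborel)"
proof -
  \<comment> \<open>The endpoints are preimages of \<open>n + 2\<close> and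
    \<open>1 / (n + 1)\<close> under the decreasing \<open>H\<close>. The \<open>2\<close> ensures
    \<open>1 / (n + 1) < n + 2\<close>, hence \<open>a n < b n\<close>, from \<open>n = 0\<close>
    on.\<close>
  define a b where "a n = V (real n + 2)" and "b n = V (1 / real (Suc n))" for n
  have ab: "\<rho> < a n" "\<rho> < b n" for n unfolding a_def b_def by (intro V_above; simp)+
  have Hab: "H (a n) = real n + 2" "H (b n) = 1 / real (Suc n)" for n
    unfolding a_def b_def by (intro H_V; simp)+
  have ab_less: "a n < b n" for n
  proof -
    have "1 / real (Suc n) \<le> 1" by simp
    then show ?thesis unfolding a_def b_def by (intro V_less) (simp, linarith)
  qed
  have step: "(\<integral>\<^sup>+z\<in>{a n..b n}. F (H z) * ennreal (1 / \<Psi> z) \<partial>lborel) = (\<integral>\<^sup>+s\<in>{1 / real (Suc n)..real n + 2}. F s \<partial>lborel)" for n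
  proof -
    \<comment> \<open>The substitution rule is for nondecreasing maps, so it is applied to
      \<open>- H\<close>; the reflection is undone afterwards.\<close>
    have "(\<integral>\<^sup>+x. F (- x) * indicator {- H (a n)..- H (b n)} x \<partial>lborel)
        = (\<integral>\<^sup>+x. F (- (- H x)) * ennreal (1 / \<Psi> x) * indicator {a n..b n} x \<partial>lborel)"
    proof (rule nn_integral_substitution_aux[OF _ _ _ _ _ ab_less])
      show "((\<lambda>x. - H x) has_real_derivative 1 / \<Psi> x) (at x)" if "x \<in> {a n..b n}" for x
        using H_deriv[of x] ab(1)[of n] that by (auto intro!: derivative_eq_intros)
      show "continuous_on {a n..b n} (\<lambda>x. 1 / \<Psi> x)"
        using cont_inverse by (rule continuous_on_subset) (use ab(1)[of n] in auto)
      show "0 \<le> 1 / \<Psi> x" if "x \<in> {a n..b n}" for x using mech_pos[of x] ab(1)[of n] that by simp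
    qed auto
    moreover have "(\<integral>\<^sup>+x. F (- x) * indicator {- H (a n)..- H (b n)} x \<partial>lborel)
      = (\<integral>\<^sup>+s. F s * indicator {1 / real (Suc n)..real n + 2} s \<partial>lborel)"
      unfolding Hab by (subst nn_integral_real_affine[where c = "-1" and t = 0]) (auto intro!: nn_integral_cong simp: indicator_def)
    ultimately show ?thesis by simp
  qed
  have mono1: "a (Suc n) \<le> a n" "b n \<le> b (Suc n)" for n
  proof -
    show "a (Suc n) \<le> a n" unfolding a_def by (intro less_imp_le V_less) auto
    have "1 / real (Suc (Suc n)) < 1 / real (Suc n)" by (intro divide_strict_left_mono) auto
    then show "b n \<le> b (Suc n)" unfolding b_def by (intro less_imp_le V_less) auto
  qed
  have [measurable]: "(\<lambda>z. F (H z) * ennreal (1 / \<Psi> z) * indicator {a n..b n} z) \<in> borel_measurable borel" for n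
  proof -
    have "continuous_on {\<rho><..} H" using H_isCont by (auto intro: continuous_at_imp_continuous_on)
    then have [measurable]: "(\<lambda>z. if z \<in> {\<rho><..} then H z else 0) \<in> borel_measurable borel"
      by (intro borel_measurable_continuous_on_if) auto
    have [measurable]: "(\<lambda>z. if z \<in> {\<rho><..} then 1 / \<Psi> z else 0) \<in> borel_measurable borel"
      by (intro borel_measurable_continuous_on_if cont_inverse) auto
    have "(\<lambda>z. F (if z \<in> {\<rho><..} then H z else 0) * ennreal (if z \<in> {\<rho><..} then 1 / \<Psi> z else 0) * indicator {a n..b n} z) \<in> borel_measurable borel"
      by measurable
    also have "(\<lambda>z. F (if z \<in> {\<rho><..} then H z else 0) * ennreal (if z \<in> {\<rho><..} then 1 / \<Psi> z else 0) * indicator {a n..b n} z)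
       = (\<lambda>z. F (H z) * ennreal (1 / \<Psi> z) * indicator {a n..b n} z)"
      using ab(1)[of n] by (auto simp: indicator_def)
    finally show ?thesis .
  qed
  have union: "\<exists>n. 1 / real (Suc n) < s \<and> s < real n + 2" if s: "0 < s" for s :: real
  proof -
    obtain n1 where n1: "s < real n1" using reals_Archimedean2 by blast
    obtain n2 where n2: "1 / real (Suc n2) < s" using nat_approx_posE[OF s] by blast
    have "1 / real (Suc (max n1 n2)) \<le> 1 / real (Suc n2)" by (intro divide_left_mono) auto
    then show ?thesis using n1 n2 by (intro exI[of _ "max n1 n2"]) auto
  qed
  have "(\<Union>n. {a n..b n}) = {\<rho><..}"
  proof (intro equalityI subsetI)
    fix z assume "z \<in> {\<rho><..}"
    then have z: "\<rho> < z" by simp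
    obtain n where "1 / real (Suc n) < H z" "H z < real n + 2" using union[OF H_pos[OF z]] by blast
    then have "a n < z" "z < b n"
      using V_less[OF H_pos[OF z], of "real n + 2"] V_less[of "1 / real (Suc n)" "H z"] V_H[OF z]
      by (auto simp: a_def b_def)
    then show "z \<in> (\<Union>n. {a n..b n})" by (auto intro!: exI[of _ n])
  qed (use ab(1) in \<open>auto intro: less_le_trans\<close>)
  then have "(\<integral>\<^sup>+z\<in>{\<rho><..}. F (H z) * ennreal (1 / \<Psi> z) \<partial>lborel)
      = (\<integral>\<^sup>+z\<in>(\<Union>n. {a n..b n}). F (H z) * ennreal (1 / \<Psi> z) \<partial>lborel)" by simp
  also have "\<dots> = (SUP n. \<integral>\<^sup>+z\<in>{a n..b n}. F (H z) * ennreal (1 / \<Psi> z) \<partial>lborel)"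
  proof (rule nn_integral_incseq_UN)
    show "{a n..b n} \<subseteq> {a (Suc n)..b (Suc n)}" for n using mono1[of n] by auto
  qed measurable
  also have "\<dots> = (SUP n. \<integral>\<^sup>+s\<in>{1 / real (Suc n)..real n + 2}. F s \<partial>lborel)" by (simp only: step)
  also have "\<dots> = (\<integral>\<^sup>+s\<in>(\<Union>n. {1 / real (Suc n)..real n + 2}). F s \<partial>lborel)"
  proof (rule nn_integral_incseq_UN[symmetric])
    show "{1 / real (Suc n)..real n + 2} \<subseteq> {1 / real (Suc (Suc n))..real (Suc n) + 2}" for n
    proof -
      have "1 / real (Suc (Suc n)) \<le> 1 / real (Suc n)" by (intro divide_left_mono) auto
      then show ?thesis by auto
    qed
  qed measurable
  also have "(\<Union>n. {1 / real (Suc n)..real n + 2}) = {0<..}"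
  proof (intro equalityI subsetI)
    fix s :: real assume "s \<in> (\<Union>n. {1 / real (Suc n)..real n + 2})"
    then obtain n where "1 / real (Suc n) \<le> s" by auto
    moreover have "0 < 1 / real (Suc n)" by simp
    ultimately have "0 < s" by linarith
    then show "s \<in> {0<..}" by simp
  next
    fix s :: real assume "s \<in> {0<..}"
    then obtain n where "1 / real (Suc n) < s" "s < real n + 2" using union[of s] by auto
    then show "s \<in> (\<Union>n. {1 / real (Suc n)..real n + 2})" by (intro UN_I[of n]) auto
  qed
  finally show ?thesis .
qed

end

lemma set_nn_integral_eq_set_integral:
  fixes f :: "'w \<Rightarrow> real"
  assumes "prob_space M" "f \<in> borel_measurable M" "\<And>\<omega>. 0 \<le> f \<omega>" "\<And>\<omega>. f \<omega> \<le> 1" "B \<in> sets M"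
  shows "(\<integral>\<^sup>+\<omega>\<in>B. ennreal (f \<omega>) \<partial>M) = ennreal (LINT \<omega>:B|M. f \<omega>)"
proof -
  interpret prob_space M by fact
  have "integrable M (\<lambda>\<omega>. indicator B \<omega> * f \<omega>)"
    using assms by (intro integrable_const_bound[where B = 1]) (auto simp: indicator_def)
  then have "(\<integral>\<^sup>+\<omega>. ennreal (indicator B \<omega> * f \<omega>) \<partial>M) = ennreal (\<integral>\<omega>. indicator B \<omega> * f \<omega> \<partial>M)"
    using assms by (intro nn_integral_eq_integral) auto
  moreover have "(\<integral>\<^sup>+\<omega>\<in>B. ennreal (f \<omega>) \<partial>M) = (\<integral>\<^sup>+\<omega>. ennreal (indicator B \<omega> * f \<omega>) \<partial>M)"
    by (intro nn_integral_cong) (auto simp: indicator_def)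
  ultimately show ?thesis by (simp add: set_lebesgue_integral_def)
qed

text \<open>Grey's condition comes with its own base point. Between it and the given
  \<open>\<theta>\<close> the function \<open>1 / \<Psi>\<close> is continuous on a compact
  interval, so the base point does not matter.\<close>

lemma grey_condition_at:
  assumes grey: "grey_condition \<Psi>" and cont: "continuous_on {0<..} \<Psi>"
    and \<theta>: "0 < \<theta>" "\<And>u. \<theta> \<le> u \<Longrightarrow> 0 < \<Psi> u"
  shows "mass (\<lambda>q. 1 / \<Psi> q) {\<theta>..} < \<infinity>"
proof -
  obtain \<theta>' where \<theta>': "0 < \<theta>'" "mass (\<lambda>q. 1 / \<Psi> q) {\<theta>'..} < \<infinity>"
    using grey by (auto simp: grey_condition_def)
  define b where "b = max \<theta> \<theta>'"
  have c: "continuous_on {\<theta>..} (\<lambda>q. 1 / \<Psi> q)"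
    using \<theta> by (intro continuous_intros continuous_on_subset[OF cont]) (auto, force)
  then have "continuous_on {\<theta>..b} (\<lambda>q. 1 / \<Psi> q)" by (rule continuous_on_subset) auto
  then have "set_integrable lborel {\<theta>..b} (\<lambda>q. 1 / \<Psi> q)" by (rule borel_integrable_atLeastAtMost')
  then have int: "integrable lborel (\<lambda>q. indicator {\<theta>..b} q * (1 / \<Psi> q))" by (simp add: set_integrable_def)
  have "mass (\<lambda>q. 1 / \<Psi> q) {\<theta>..b} = (\<integral>\<^sup>+q. ennreal (indicator {\<theta>..b} q * (1 / \<Psi> q)) \<partial>lborel)"
    by (intro nn_integral_cong) (auto simp: indicator_def)
  also have "\<dots> = ennreal (\<integral>q. indicator {\<theta>..b} q * (1 / \<Psi> q) \<partial>lborel)"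
    using \<theta>(2) by (intro nn_integral_eq_integral int) (auto simp: indicator_def less_imp_le)
  finally have fin: "mass (\<lambda>q. 1 / \<Psi> q) {\<theta>..b} < \<infinity>" by simp
  have [measurable]: "(\<lambda>q. ennreal (1 / \<Psi> q) * indicator S q) \<in> borel_measurable borel" if "S \<subseteq> {\<theta>..}" "S \<in> sets borel" for S
  proof -
    have [measurable]: "(\<lambda>q. if q \<in> {\<theta>..} then 1 / \<Psi> q else 0) \<in> borel_measurable borel"
      using c by (intro borel_measurable_continuous_on_if) auto
    note [measurable] = that(2)
    have "(\<lambda>q. ennreal (if q \<in> {\<theta>..} then 1 / \<Psi> q else 0) * indicator S q) \<in> borel_measurable borel" by measurable
    also have "(\<lambda>q. ennreal (if q \<in> {\<theta>..} then 1 / \<Psi> q else 0) * indicator S q) = (\<lambda>q. ennreal (1 / \<Psi> q) * indicator S q)"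
      using that(1) by (auto simp: indicator_def fun_eq_iff)
    finally show ?thesis .
  qed
  have "mass (\<lambda>q. 1 / \<Psi> q) {\<theta>..}
      \<le> (\<integral>\<^sup>+q. ennreal (1 / \<Psi> q) * indicator {\<theta>..b} q + ennreal (1 / \<Psi> q) * indicator {b..} q \<partial>lborel)"
    by (intro nn_integral_mono) (auto simp: indicator_def)
  also have "\<dots> = mass (\<lambda>q. 1 / \<Psi> q) {\<theta>..b} + mass (\<lambda>q. 1 / \<Psi> q) {b..}"
    by (intro nn_integral_add) (auto simp: b_def)
  also have "mass (\<lambda>q. 1 / \<Psi> q) {b..} \<le> mass (\<lambda>q. 1 / \<Psi> q) {\<theta>'..}"
    by (intro nn_integral_mono) (auto simp: indicator_def b_def)
  finally show ?thesis using fin \<theta>'(2) by (auto simp: less_top[symmetric] top_unique)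
qed

section \<open>The immigration weight along the flow\<close>

locale flow_immigration = flow +
  fixes \<Phi> :: "real \<Rightarrow> real"
  assumes immig_nonneg: "\<And>q. 0 \<le> q \<Longrightarrow> 0 \<le> \<Phi> q"
    and immig_continuous: "continuous_on {0<..} \<Phi>"
    and immig_linear: "\<And>q. 1 \<le> q \<Longrightarrow> \<Phi> q \<le> \<Phi> 1 * q"
begin

definition J :: "real \<Rightarrow> real" where "J = primitive (\<lambda>q. \<Phi> q / \<Psi> q) \<theta>"

definition G :: "real \<Rightarrow> real" where "G s = (if 0 < s then exp (J (V s)) else 0)"

lemma immig_cont_above: "continuous_on {\<rho><..} \<Phi>"
  using immig_continuous by (rule continuous_on_subset) (use \<rho>_nonneg in auto)

lemma J_deriv: "\<rho> < z \<Longrightarrow> (J has_real_derivative \<Phi> z / \<Psi> z) (at z)"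
  unfolding J_def
  by (rule primitive_has_derivative[OF _ \<rho>_less])
     (intro continuous_on_divide immig_cont_above cont_above, use mech_pos in force)

lemma J_mono: "\<rho> < z \<Longrightarrow> z \<le> z' \<Longrightarrow> J z \<le> J z'"
proof (rule DERIV_nonneg_imp_nondecreasing[where f = J])
  fix w assume w: "\<rho> < z" "z \<le> w" "w \<le> z'"
  then have "0 \<le> \<Phi> w / \<Psi> w" using mech_pos[of w] immig_nonneg[of w] \<rho>_nonneg by auto
  then show "\<exists>y. (J has_real_derivative y) (at w) \<and> 0 \<le> y" using J_deriv[of w] w by auto
qed auto

lemma G_pos: "0 < s \<Longrightarrow> 0 < G s"
  by (simp add: G_def)

lemma G_H: "\<rho> < z \<Longrightarrow> G (H z) = exp (J z)"
  using H_pos V_H by (simp add: G_def)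

lemma G_antimono: "0 < s \<Longrightarrow> s \<le> s' \<Longrightarrow> G s' \<le> G s"
  using V_less[of s s'] V_above[of s'] J_mono[of "V s'" "V s"] by (cases "s = s'") (auto simp: G_def)

lemma G_continuous: "continuous_on {0<..} G"
proof -
  have "isCont (\<lambda>s. exp (J (V s))) s" if "0 < s" for s
  proof -
    have "isCont J (V s)" using J_deriv[OF V_above[OF that]] by (rule DERIV_isCont)
    then have "isCont (\<lambda>s. J (V s)) s" using V_isCont[OF that] by (rule isCont_o2[rotated])
    then show ?thesis by (rule isCont_exp')
  qed
  then have "continuous_on {0<..} (\<lambda>s. exp (J (V s)))" by (auto intro: continuous_at_imp_continuous_on)
  then show ?thesis by (rule continuous_on_eq) (auto simp: G_def)
qed

lemma G_measurable [measurable]: "G \<in> borel_measurable borel"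
proof -
  have "(\<lambda>s. if s \<in> {0<..} then G s else 0) \<in> borel_measurable borel"
    using G_continuous by (intro borel_measurable_continuous_on_if) auto
  also have "(\<lambda>s. if s \<in> {0<..} then G s else 0) = G" by (auto simp: G_def)
  finally show ?thesis .
qed

text \<open>\<open>\<Psi> q / q\<close> is nondecreasing; were it bounded, \<open>1 / \<Psi>\<close> would not be integrable at infinity.\<close>

lemma mech_superlinear: "\<exists>z0\<ge>\<theta>. \<forall>z\<ge>z0. K * z \<le> \<Psi> z"
proof -
  define K' where "K' = max K 1"
  have K': "0 < K'" "K \<le> K'" by (auto simp: K'_def)
  have "\<exists>z0\<ge>\<theta>. K' * z0 \<le> \<Psi> z0"
  proof (rule ccontr)
    assume "\<not> (\<exists>z0\<ge>\<theta>. K' * z0 \<le> \<Psi> z0)"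
    then have less: "\<Psi> z < K' * z" if "\<theta> \<le> z" for z using that by force
    have lower: "(1 / K') * ln z - (1 / K') * ln \<theta> \<le> L z" if z: "\<theta> \<le> z" for z
    proof -
      have "L \<theta> - (1 / K') * ln \<theta> \<le> L z - (1 / K') * ln z"
      proof (rule DERIV_nonneg_imp_nondecreasing[OF z])
        fix w assume w: "\<theta> \<le> w" "w \<le> z"
        have w0: "0 < w" "\<rho> < w" using w \<theta>_pos \<rho>_less by auto
        have "((\<lambda>w. L w - (1 / K') * ln w) has_real_derivative 1 / \<Psi> w - (1 / K') * (1 / w)) (at w)"
          using w0 K'(1) by (auto intro!: derivative_eq_intros L_deriv)
        moreover have "(1 / K') * (1 / w) \<le> 1 / \<Psi> w"
        proof -
          have "1 / (K' * w) \<le> 1 / \<Psi> w"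
            using less[OF w(1)] mech_pos[OF w0(2)] K'(1) w0(1)
            by (intro divide_left_mono mult_pos_pos less_imp_le) auto
          then show ?thesis by simp
        qed
        ultimately show "\<exists>y. ((\<lambda>w. L w - (1 / K') * ln w) has_real_derivative y) (at w) \<and> 0 \<le> y" by force
      qed
      then show ?thesis by (simp add: L_def)
    qed
    define B where "B = enn2real (mass (\<lambda>q. 1 / \<Psi> q) {\<theta>..})"
    \<comment> \<open>Large enough that the logarithmic lower bound for \<open>L z\<close> reaches
      \<open>B + 1\<close>, above the bound \<open>B\<close> supplied by Grey's condition.\<close>
    define z where "z = max \<theta> (exp (K' * (B + 1) + ln \<theta>))"
    have "K' * (B + 1) + ln \<theta> \<le> ln z"
      using \<theta>_pos ln_le_cancel_iff[of "exp (K' * (B + 1) + ln \<theta>)" z] by (simp add: z_def)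
    then have "(1 / K') * (K' * (B + 1) + ln \<theta>) \<le> (1 / K') * ln z" using K' by (intro mult_left_mono) auto
    moreover have "(1 / K') * (K' * (B + 1) + ln \<theta>) = B + 1 + (1 / K') * ln \<theta>" using K' by (simp add: distrib_left)
    ultimately have "B + 1 \<le> (1 / K') * ln z - (1 / K') * ln \<theta>" by linarith
    also have "\<dots> \<le> L z" by (rule lower) (simp add: z_def)
    also have "\<dots> \<le> B" unfolding B_def by (rule L_bounded) (simp add: z_def)
    finally show False by simp
  qed
  then obtain z0 where z0: "\<theta> \<le> z0" "K' * z0 \<le> \<Psi> z0" by blast
  have "K * z \<le> \<Psi> z" if "z0 \<le> z" for z
  proof -
    have p: "0 < z0" "0 < z" using z0 \<theta>_pos that by auto
    have "\<Psi> ((1 - z0 / z) *\<^sub>R 0 + (z0 / z) *\<^sub>R z) \<le> (1 - z0 / z) * \<Psi> 0 + (z0 / z) * \<Psi> z"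
      using p that by (intro convex_onD[OF mech_convex]) auto
    then have "\<Psi> z0 \<le> (z0 / z) * \<Psi> z" using p mech_0 by simp
    then have "K' * z0 \<le> (z0 / z) * \<Psi> z" using z0 by simp
    then have "K' * z \<le> \<Psi> z" using p by (simp add: field_simps)
    moreover have "K * z \<le> K' * z" using K' p by (intro mult_right_mono) auto
    ultimately show ?thesis by simp
  qed
  then show ?thesis using z0 by blast
qed

text \<open>The derivative \<open>\<Phi> / \<Psi>\<close> of \<open>J\<close> tends to
  \<open>0\<close> at infinity, so \<open>J z\<close> grows at most like
  \<open>\<delta> / 2 * z\<close> and the factor \<open>exp (- \<delta> * z)\<close> wins.\<close>

lemma G_small:
  assumes \<delta>: "0 < \<delta>"
  shows "((\<lambda>s. exp (- \<delta> * V s) * G s) \<longlongrightarrow> 0) (at_right 0)"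
proof -
  \<comment> \<open>With this slope, \<open>\<Phi> w \<le> \<Phi> 1 * w\<close> gives
    \<open>\<Phi> w / \<Psi> w \<le> \<delta> / 2\<close>; one half of \<open>\<delta>\<close> is
    spent on \<open>J\<close> and the other half yields the decay.\<close>
  obtain z0 where z0: "z0 \<ge> \<theta>" "\<And>z. z \<ge> z0 \<Longrightarrow> (2 * \<Phi> 1 / \<delta>) * z \<le> \<Psi> z"
    using mech_superlinear by blast
  define z1 where "z1 = max z0 1"
  have z1: "\<rho> < z1" "1 \<le> z1" using z0 \<rho>_less by (auto simp: z1_def)
  have J: "J z \<le> J z1 - \<delta> / 2 * z1 + \<delta> / 2 * z" if z: "z1 \<le> z" for z
  proof -
    have "J z - \<delta> / 2 * z \<le> J z1 - \<delta> / 2 * z1"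
    proof (rule DERIV_nonpos_imp_nonincreasing[OF z])
      fix w assume w: "z1 \<le> w" "w \<le> z"
      have w0: "\<rho> < w" "1 \<le> w" "z0 \<le> w" using w z1 by (auto simp: z1_def)
      have "((\<lambda>w. J w - \<delta> / 2 * w) has_real_derivative \<Phi> w / \<Psi> w - \<delta> / 2) (at w)"
        using w0 by (auto intro!: derivative_eq_intros J_deriv)
      moreover have "\<Phi> w / \<Psi> w \<le> \<delta> / 2"
      proof -
        have "\<Phi> w \<le> \<Phi> 1 * w" by (rule immig_linear[OF w0(2)])
        also have "\<dots> = \<delta> / 2 * ((2 * \<Phi> 1 / \<delta>) * w)" using \<delta> by simp
        also have "\<dots> \<le> \<delta> / 2 * \<Psi> w" using z0(2)[OF w0(3)] \<delta> by (intro mult_left_mono) auto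
        finally show ?thesis using mech_pos[OF w0(1)] by (simp add: divide_le_eq)
      qed
      ultimately show "\<exists>y. ((\<lambda>w. J w - \<delta> / 2 * w) has_real_derivative y) (at w) \<and> y \<le> 0" by force
    qed
    then show ?thesis by simp
  qed
  have "((\<lambda>z. exp (C - \<delta> / 2 * z)) \<longlongrightarrow> 0) at_top" for C :: real
    using \<delta> by real_asymp
  from filterlim_compose[OF this V_tendsto]
  have lim: "((\<lambda>s. exp (J z1 - \<delta> / 2 * z1 - \<delta> / 2 * V s)) \<longlongrightarrow> 0) (at_right 0)"
    .
  show ?thesis
  proof (rule tendsto_sandwich[OF _ _ tendsto_const lim])
    have pos: "eventually (\<lambda>s::real. 0 < s) (at_right 0)" by (simp add: eventually_at_right_less)
    then show "eventually (\<lambda>s. 0 \<le> exp (- \<delta> * V s) * G s) (at_right 0)"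
      by eventually_elim (simp add: G_def)
    have "eventually (\<lambda>s. z1 \<le> V s) (at_right 0)" using V_tendsto by (simp add: filterlim_at_top)
    with pos show "eventually (\<lambda>s. exp (- \<delta> * V s) * G s \<le> exp (J z1 - \<delta> / 2 * z1 - \<delta> / 2 * V s)) (at_right 0)"
    proof eventually_elim
      case (elim s)
      then show ?case using J[of "V s"] by (simp add: G_def exp_add[symmetric])
    qed
  qed
qed

section \<open>Identification of the cumulant flow with \<open>V\<close>\<close>

lemma integral_equation:
  fixes f w :: "real \<Rightarrow> real"
  assumes int: "set_integrable lborel {0..T} f" and T: "0 \<le> T"
    and w: "\<And>t. t \<in> {0..T} \<Longrightarrow> w t = q - (LBINT s:{0..t}. f s)"
  shows "t \<in> {0..T} \<Longrightarrow> w t = q - integral {0..t} f" "continuous_on {0..T} w" "w 0 = q"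
proof -
  have w_int: "w t = q - integral {0..t} f" if t: "t \<in> {0..T}" for t
  proof -
    have "set_integrable lborel {0..t} f" using int by (rule set_integrable_subset) (use t in auto)
    then show ?thesis using w[OF t] set_borel_integral_eq_integral(2) by metis
  qed
  \<comment> \<open>\<open>cumulant_flow\<close> asks only for integrability of
    \<open>\<Psi> (v s q)\<close>; continuity of the solution is inherited from the indefinite
    integral.\<close>
  have "continuous_on {0..T} (\<lambda>t. q - integral {0..t} f)"
    using set_borel_integral_eq_integral(1)[OF int]
    by (intro continuous_intros indefinite_integral_continuous_1)
  then show "continuous_on {0..T} w" by (rule continuous_on_eq) (simp add: w_int)
  show "w 0 = q" using w_int[of 0] T by simp
  show "w t = q - integral {0..t} f" if "t \<in> {0..T}" using that by (rule w_int)
qed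

lemma flow_step:
  assumes int: "set_integrable lborel {0..T} (\<lambda>s. \<Psi> (w s))"
    and w: "\<And>t. t \<in> {0..T} \<Longrightarrow> w t = q - (LBINT s:{0..t}. \<Psi> (w s))"
    and T: "0 \<le> T" and above: "\<And>t. t \<in> {0..T} \<Longrightarrow> \<rho> < w t"
  shows "H (w T) = H q + T" "(LBINT s:{0..T}. \<Phi> (w s)) = J q - J (w T)"
proof -
  have w_int: "w t = q - integral {0..t} (\<lambda>s. \<Psi> (w s))" if "t \<in> {0..T}" for t
    using that by (rule integral_equation(1)[OF int T w, rotated])
  have cw: "continuous_on {0..T} w" and w0: "w 0 = q"
    by (rule integral_equation(2,3)[OF int T w], assumption)+
  have cont: "continuous_on {0..T} (\<lambda>s. f (w s))" if "continuous_on {\<rho><..} f" for f :: "real \<Rightarrow> real"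
    using that cw by (rule continuous_on_compose2) (use above in auto)
  have dw: "(w has_real_derivative - \<Psi> (w t)) (at t within {0..T})" if t: "t \<in> {0..T}" for t
  proof -
    have "((\<lambda>t. integral {0..t} (\<lambda>s. \<Psi> (w s))) has_real_derivative \<Psi> (w t)) (at t within {0..T})"
      using t by (intro integral_has_real_derivative cont cont_above) auto
    then have "((\<lambda>t. q - integral {0..t} (\<lambda>s. \<Psi> (w s))) has_real_derivative - \<Psi> (w t)) (at t within {0..T})"
      by (auto intro!: derivative_eq_intros)
    then show ?thesis by (rule has_field_derivative_transform_within[where d = 1]) (use t w_int in auto)
  qed
  have "((\<lambda>s. 1) has_integral H (w T) - H (w 0)) {0..T}"
  proof (rule fundamental_theorem_of_calculus[OF T])
    fix t assume t: "t \<in> {0..T}"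
    have "((\<lambda>t. H (w t)) has_real_derivative - (1 / \<Psi> (w t)) * - \<Psi> (w t)) (at t within {0..T})"
      by (rule DERIV_chain2[OF H_deriv[OF above[OF t]] dw[OF t]])
    then show "((\<lambda>t. H (w t)) has_vector_derivative 1) (at t within {0..T})"
      using mech_pos[OF above[OF t]] by (simp add: has_real_derivative_iff_has_vector_derivative)
  qed
  moreover have "((\<lambda>s. 1::real) has_integral T) {0..T}" using has_integral_const_real[of "1::real" 0 T] T by simp
  ultimately have "H (w T) - H (w 0) = T" by (rule has_integral_unique)
  then show "H (w T) = H q + T" by (simp add: w0)
  have "((\<lambda>s. - \<Phi> (w s)) has_integral J (w T) - J (w 0)) {0..T}"
  proof (rule fundamental_theorem_of_calculus[OF T])
    fix t assume t: "t \<in> {0..T}"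
    have "((\<lambda>t. J (w t)) has_real_derivative (\<Phi> (w t) / \<Psi> (w t)) * - \<Psi> (w t)) (at t within {0..T})"
      by (rule DERIV_chain2[OF J_deriv[OF above[OF t]] dw[OF t]])
    then show "((\<lambda>t. J (w t)) has_vector_derivative - \<Phi> (w t)) (at t within {0..T})"
      using mech_pos[OF above[OF t]] by (simp add: has_real_derivative_iff_has_vector_derivative)
  qed
  from has_integral_neg[OF this]
  have "((\<lambda>s. \<Phi> (w s)) has_integral J q - J (w T)) {0..T}" by (simp add: w0)
  then show "(LBINT s:{0..T}. \<Phi> (w s)) = J q - J (w T)"
    using LBINT_eq_integral[OF cont[OF immig_cont_above]] by (simp add: integral_unique)
qed

text \<open>The root cannot be reached in finite time because \<open>H\<close> is unbounded at
  \<open>\<rho>\<close>. Otherwise the path would cross a level \<open>z\<close> with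
  \<open>H z > H q + t\<close>; up to the first crossing time \<open>T\<close> it stays above
  \<open>\<rho>\<close>, so \<open>flow_step\<close> gives \<open>H z = H q + T\<close>, a
  contradiction.\<close>

lemma flow_above:
  assumes v: "cumulant_flow \<Psi> v" and q: "\<rho> < q" and t: "0 \<le> t"
  shows "\<rho> < v t q"
proof (rule ccontr)
  assume neg: "\<not> \<rho> < v t q"
  have q0: "0 < q" using q \<rho>_nonneg by simp
  define w where "w s = v s q" for s
  have w: "w s = q - (LBINT r:{0..s}. \<Psi> (w r))" and int: "set_integrable lborel {0..s} (\<lambda>r. \<Psi> (w r))" if "0 \<le> s" for s
    using v q0 that unfolding cumulant_flow_def w_def by blast+
  have cw: "continuous_on {0..t} w" and w0: "w 0 = q"
    using integral_equation(2,3)[where w = w, OF int[OF t] t] w by (simp_all only: atLeastAtMost_iff)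
  obtain z1 where z1: "z1 > \<rho>" "H q + t < H z1" using H_large by blast
  \<comment> \<open>The minimum keeps the level at or below the start, as the intermediate value
    theorem requires; \<open>z = q\<close> is then ruled out by \<open>H z1 > H q\<close>.\<close>
  define z where "z = min z1 q"
  have z: "\<rho> < z" "z \<le> q" "H q + t < H z \<or> z = q" "z \<le> z1" using z1 q by (auto simp: z_def min_def)
  have "z < q"
  proof (rule ccontr)
    assume "\<not> z < q"
    then have "q \<le> z1" by (simp add: z_def min_def split: if_splits)
    then have "H z1 \<le> H q" using H_less[OF q, of z1] by (cases "q = z1") auto
    then show False using z1 t by simp
  qed
  then have Hz: "H q + t < H z" using z by auto
  define S where "S = {s\<in>{0..t}. w s = z}"
  have "\<exists>s\<ge>0. s \<le> t \<and> w s = z"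
    using IVT2'[of w t z 0] cw t w0 z neg by (auto simp: w_def)
  then have S_ne: "S \<noteq> {}" by (auto simp: S_def)
  have "closed S"
    unfolding S_def using continuous_closed_preimage_constant[OF cw, of z] by simp
  moreover have bdd: "bdd_below S" by (auto simp: S_def bdd_below_def)
  ultimately have "Inf S \<in> S" using S_ne by (intro closed_contains_Inf) auto
  then obtain T where T: "T = Inf S" "0 \<le> T" "T \<le> t" "w T = z" by (auto simp: S_def)
  have above: "\<rho> < w s" if s: "s \<in> {0..T}" for s
  proof (rule ccontr)
    assume "\<not> \<rho> < w s"
    then have ws: "w s < z" using z by simp
    have "continuous_on {0..s} w" using cw by (rule continuous_on_subset) (use s T in auto)
    then obtain r where r: "0 \<le> r" "r \<le> s" "w r = z"
      using IVT2'[of w s z 0] ws s w0 z by auto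
    then have "r \<in> S" using s T by (auto simp: S_def)
    then have "T \<le> r" unfolding T(1) using bdd by (rule cInf_lower)
    then have "r = s" using r s by simp
    then show False using r ws by simp
  qed
  have "H (w T) = H q + T"
  proof (rule flow_step(1)[OF int[OF T(2)] _ T(2) above])
    fix s assume "s \<in> {0..T}"
    then have "0 \<le> s" by simp
    then show "w s = q - (LBINT r:{0..s}. \<Psi> (w r))" by (rule w)
  qed
  then show False using T Hz by simp
qed

lemma flow_V:
  assumes v: "cumulant_flow \<Psi> v" and r: "0 < r" and t: "0 \<le> t"
  shows "v t (V r) = V (r + t)" "exp (- (LBINT s:{0..t}. \<Phi> (v s (V r)))) = G (r + t) / G r"
proof -
  have above: "\<rho> < v s (V r)" if "s \<in> {0..t}" for s
    using that by (intro flow_above[OF v V_above[OF r]]) simp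
  have int: "set_integrable lborel {0..t} (\<lambda>s. \<Psi> (v s (V r)))"
    and eq: "\<And>s. s \<in> {0..t} \<Longrightarrow> v s (V r) = V r - (LBINT s:{0..s}. \<Psi> (v s (V r)))"
    using v V_pos[OF r] t unfolding cumulant_flow_def by (blast, auto)
  have "H (v t (V r)) = H (V r) + t"
    by (rule flow_step(1)[where w = "\<lambda>s. v s (V r)", OF int eq t above])
  then have "H (v t (V r)) = r + t" using H_V[OF r] by simp
  then show 2: "v t (V r) = V (r + t)" using V_H[OF above[of t]] t by simp
  have "(LBINT s:{0..t}. \<Phi> (v s (V r))) = J (V r) - J (v t (V r))"
    by (rule flow_step(2)[where w = "\<lambda>s. v s (V r)", OF int eq t above])
  then have "(LBINT s:{0..t}. \<Phi> (v s (V r))) = J (V r) - J (V (r + t))"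
    by (simp only: 2)
  then show "exp (- (LBINT s:{0..t}. \<Phi> (v s (V r)))) = G (r + t) / G r"
    using r t by (simp add: G_def exp_diff)
qed

section \<open>The integrals of the theorem as masses of \<open>G\<close>\<close>

lemma hit_pos: "0 < hit"
  using H_pos[OF \<rho>_less] H_\<theta> by simp

lemma H_le_hit_iff: "\<rho> < z \<Longrightarrow> H z \<le> hit \<longleftrightarrow> \<theta> \<le> z"
  and hit_le_H_iff: "\<rho> < z \<Longrightarrow> hit \<le> H z \<longleftrightarrow> z \<le> \<theta>"
  using H_less[of z \<theta>] H_less[OF \<rho>_less, of z] H_\<theta> by (cases z \<theta> rule: linorder_cases; force)+

text \<open>Under \<open>s = H z\<close> the half-line \<open>[\<theta>, \<infinity>)\<close>
  becomes \<open>(0, hit]\<close> and the exponential becomes \<open>G s\<close>, since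
  \<open>G (H z) = exp (J z)\<close>.\<close>

lemma integral_near_infinity:
  "(\<integral>\<^sup>+z\<in>{\<theta>..}. ennreal (exp (LBINT u:{\<theta>..z}. \<Phi> u / \<Psi> u) * (1 / \<Psi> z)) \<partial>lborel)
    = mass G {0<..hit}"
proof -
  have "(\<integral>\<^sup>+z\<in>{\<theta>..}. ennreal (exp (LBINT u:{\<theta>..z}. \<Phi> u / \<Psi> u) * (1 / \<Psi> z)) \<partial>lborel)
      = (\<integral>\<^sup>+z\<in>{\<rho><..}. (ennreal (G (H z)) * indicator {..hit} (H z)) * ennreal (1 / \<Psi> z) \<partial>lborel)"
  proof (intro nn_integral_cong)
    fix z
    show "ennreal (exp (LBINT u:{\<theta>..z}. \<Phi> u / \<Psi> u) * (1 / \<Psi> z)) * indicator {\<theta>..} z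
      = (ennreal (G (H z)) * indicator {..hit} (H z)) * ennreal (1 / \<Psi> z) * indicator {\<rho><..} z"
      using \<rho>_less H_le_hit_iff[of z] mech_pos[of z] G_H[of z]
      by (auto simp: indicator_def J_def primitive_right ennreal_mult[symmetric])
  qed
  also have "\<dots> = (\<integral>\<^sup>+s\<in>{0<..}. ennreal (G s) * indicator {..hit} s \<partial>lborel)"
    by (rule nn_integral_time_change) measurable
  also have "\<dots> = mass G {0<..hit}"
    by (intro nn_integral_cong) (auto simp: indicator_def)
  finally show ?thesis .
qed

text \<open>The assumption makes \<open>(0, \<theta>]\<close> the whole part of the domain of
  \<open>H\<close> below \<open>\<theta>\<close>; its image is \<open>[hit, \<infinity>)\<close>.
  The minus sign in the exponent is the orientation of \<open>J\<close> to the left of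
  \<open>\<theta>\<close>.\<close>

lemma integral_near_zero:
  assumes "\<rho> = 0"
  shows "(\<integral>\<^sup>+x\<in>{0<..\<theta>}. ennreal (exp (- (LBINT s:{x..\<theta>}. \<Phi> s / \<Psi> s)) * (1 / \<Psi> x)) \<partial>lborel)
    = mass G {hit..}"
proof -
  have "(\<integral>\<^sup>+x\<in>{0<..\<theta>}. ennreal (exp (- (LBINT s:{x..\<theta>}. \<Phi> s / \<Psi> s)) * (1 / \<Psi> x)) \<partial>lborel)
      = (\<integral>\<^sup>+z\<in>{\<rho><..}. (ennreal (G (H z)) * indicator {hit..} (H z)) * ennreal (1 / \<Psi> z) \<partial>lborel)"
  proof (intro nn_integral_cong)
    fix z
    show "ennreal (exp (- (LBINT s:{z..\<theta>}. \<Phi> s / \<Psi> s)) * (1 / \<Psi> z)) * indicator {0<..\<theta>} z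
      = (ennreal (G (H z)) * indicator {hit..} (H z)) * ennreal (1 / \<Psi> z) * indicator {\<rho><..} z"
      using assms hit_le_H_iff[of z] mech_pos[of z] G_H[of z]
      by (auto simp: indicator_def J_def primitive_left ennreal_mult[symmetric])
  qed
  also have "\<dots> = (\<integral>\<^sup>+s\<in>{0<..}. ennreal (G s) * indicator {hit..} s \<partial>lborel)"
    by (rule nn_integral_time_change) measurable
  also have "\<dots> = mass G {hit..}"
    using hit_pos by (intro nn_integral_cong) (auto simp: indicator_def)
  finally show ?thesis .
qed

lemma integral_split:
  "mass G {0<..} < \<infinity> \<longleftrightarrow>
    mass G {0<..hit} < \<infinity> \<and> mass G {hit..} < \<infinity>"
proof -
  have "mass G {0<..}
      \<le> (\<integral>\<^sup>+s. ennreal (G s) * indicator {0<..hit} s + ennreal (G s) * indicator {hit..} s \<partial>lborel)"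
    by (intro nn_integral_mono) (auto simp: indicator_def)
  also have "\<dots> = mass G {0<..hit} + mass G {hit..}"
    by (intro nn_integral_add) auto
  finally have 1: "mass G {0<..}
    \<le> mass G {0<..hit} + mass G {hit..}" .
  have 2: "mass G {0<..hit} \<le> mass G {0<..}"
    "mass G {hit..} \<le> mass G {0<..}"
    using hit_pos by (intro nn_integral_mono; auto simp: indicator_def)+
  show ?thesis using 1 2 by (auto simp: less_top[symmetric] top_unique)
qed

text \<open>At \<open>q = V r\<close> the Laplace formula has exponent \<open>V (r + w)\<close> and
  immigration factor \<open>G (r + w) / G r\<close>, which is an explicit Borel function of the
  starting point and can play the role of \<open>h\<close> in
  \<open>markov_expectation\<close>.\<close>

lemma cbi_dualityI:
  assumes cbi: "CBI \<Psi> \<Phi> P Y"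
  shows "cbi_duality (P x) Y V G x"
proof -
  have mp: "cadlag_markov_process P Y" using cbi by (simp add: CBI_def)
  obtain v where v: "cumulant_flow \<Psi> v"
    and laplace: "\<And>x q t. 0 < q \<Longrightarrow> 0 \<le> t \<Longrightarrow> (\<integral>\<omega>. exp_neg (ennreal q * Y t \<omega>) \<partial>P x)
          = exp_neg (x * ennreal (v t q)) * exp (- (LBINT s:{0..t}. \<Phi> (v s q)))"
    using cbi unfolding CBI_def by blast
  have prob: "prob_space (P x)" and sets_eq: "sets (P x) = sets (P 0)"
    using mp by (auto simp: cadlag_markov_process_def)
  interpret prob_space "P x" by (rule prob)
  have Ym: "Y t \<in> borel_measurable (P x)" if "0 \<le> t" for t
    using mp that measurable_cong_sets[OF sets_eq refl[of "sets (borel :: ennreal measure)"]]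
    by (simp add: cadlag_markov_process_def)
  show ?thesis
  proof
    show "Y t \<in> borel_measurable (P x)" if "0 \<le> t" for t using Ym that .
    show "cadlag (\<lambda>t. Y t \<omega>)" if "\<omega> \<in> space (P x)" for \<omega>
      using mp that sets_eq_imp_space_eq[OF sets_eq] by (simp add: cadlag_markov_process_def)
    show "AE \<omega> in P x. Y 0 \<omega> = x" using mp by (simp add: cadlag_markov_process_def)
    show "continuous_on {0<..} G" by (rule G_continuous)
    show "((\<lambda>s. exp (- \<delta> * V s) * G s) \<longlongrightarrow> 0) (at_right 0)" if "0 < \<delta>" for \<delta> using that by (rule G_small)
  next
    fix u w r :: real and B assume u: "0 \<le> u" and w: "0 \<le> w" and r: "0 < r" and B: "B \<in> sets (natural_filtration (P x) Y u)"
    have [measurable]: "B \<in> sets (P x)"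
      using B natural_filtration_subalgebra[of Y "P x" u] Ym by (auto simp: subalgebra_def)
    have [measurable]: "Y u \<in> borel_measurable (P x)" "Y (u + w) \<in> borel_measurable (P x)"
      using u w by (auto intro: Ym)
    have Gp: "0 < G r" "0 < G (r + w)" using r w by (auto intro: G_pos)
    have "(LINT \<omega>:B|P x. exp_neg (ennreal (V r) * Y (u + w) \<omega>))
      = (LINT \<omega>:B|P x. exp_neg (ennreal (V (r + w)) * Y u \<omega>) * (G (r + w) / G r))"
    proof (rule markov_expectation[OF mp _ _ _ _ _ u w B])
      fix y
      show "exp_neg (ennreal (V (r + w)) * y) * (G (r + w) / G r) = (\<integral>\<omega>. exp_neg (ennreal (V r) * Y w \<omega>) \<partial>P y)"
        using laplace[OF V_pos[OF r] w, of y] flow_V[OF v r w] by (simp add: mult.commute)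
    qed (auto simp: exp_neg_bounds)
    also have "\<dots> = (LINT \<omega>:B|P x. exp_neg (ennreal (V (r + w)) * Y u \<omega>)) * (G (r + w) / G r)"
      by (rule set_integral_mult_left)
    finally have eq: "G r * (LINT \<omega>:B|P x. exp_neg (ennreal (V r) * Y (u + w) \<omega>))
      = G (r + w) * (LINT \<omega>:B|P x. exp_neg (ennreal (V (r + w)) * Y u \<omega>))"
      using Gp by simp
    have nn: "(\<integral>\<^sup>+\<omega>\<in>B. ennreal (exp_neg (ennreal a * Y s \<omega>)) \<partial>P x) = ennreal (LINT \<omega>:B|P x. exp_neg (ennreal a * Y s \<omega>))"
      if "0 \<le> s" for a s
    proof -
      have [measurable]: "Y s \<in> borel_measurable (P x)" using that by (rule Ym)
      show ?thesis by (rule set_nn_integral_eq_set_integral[OF prob]) (auto simp: exp_neg_bounds)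
    qed
    show "ennreal (G r) * (\<integral>\<^sup>+\<omega>\<in>B. ennreal (exp_neg (ennreal (V r) * Y (u + w) \<omega>)) \<partial>P x)
        = ennreal (G (r + w)) * (\<integral>\<^sup>+\<omega>\<in>B. ennreal (exp_neg (ennreal (V (r + w)) * Y u \<omega>)) \<partial>P x)"
      using u w Gp eq by (simp add: nn ennreal_mult'[symmetric] less_imp_le)
  qed (auto intro: V_pos G_pos G_antimono)
qed

section \<open>Polarity, transience and recurrence\<close>

lemma zero_polar_iff:
  assumes cbi: "CBI \<Psi> \<Phi> P Y"
  shows "zero_polar P Y \<longleftrightarrow> mass G {0<..hit} = \<infinity>"
proof
  assume inf: "mass G {0<..hit} = \<infinity>"
  show "zero_polar P Y"
    unfolding zero_polar_def
  proof (intro allI impI)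
    fix x :: ennreal assume x: "x \<noteq> 0"
    interpret cbi_duality "P x" Y V G x by (rule cbi_dualityI[OF cbi])
    show "AE \<omega> in P x. \<not> (\<exists>t\<ge>0. Y t \<omega> = 0)"
      using never_zero[OF hit_pos inf] Y_start
    proof eventually_elim
      case (elim \<omega>)
      show ?case
      proof
        assume "\<exists>t\<ge>0. Y t \<omega> = 0"
        then obtain t where "0 \<le> t" "Y t \<omega> = 0" by blast
        then show False using elim x by (cases "t = 0") auto
      qed
    qed
  qed
next
  assume polar: "zero_polar P Y"
  show "mass G {0<..hit} = \<infinity>"
  proof (rule ccontr)
    assume "\<not> ?thesis"
    then have fin: "mass G {0<..hit} < \<infinity>" by (simp add: less_top)
    \<comment> \<open>A single starting point refutes polarity; \<open>1\<close> is an arbitrary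
      finite nonzero one.\<close>
    interpret cbi_duality "P 1" Y V G 1 by (rule cbi_dualityI[OF cbi])
    have "\<not> (AE \<omega> in P 1. \<forall>s\<ge>0. Y s \<omega> \<noteq> 0)" using zero_reachable[OF hit_pos fin] by simp
    moreover have "AE \<omega> in P 1. \<not> (\<exists>t\<ge>0. Y t \<omega> = 0)" using polar by (simp add: zero_polar_def)
    ultimately show False by simp
  qed
qed

text \<open>Started at \<open>0\<close>, the zero set almost surely contains time \<open>0\<close>.
  In the transient case a zero at a positive time is needed to separate it from \<open>{0}\<close>;
  in the recurrent case unboundedness does this by itself.\<close>

lemma zero_set_trichotomy:
  assumes cbi: "CBI \<Psi> \<Phi> P Y"
  shows "mass G {0<..hit} = \<infinity> \<Longrightarrow> AE \<omega> in P 0. zero_set Y \<omega> = {0}"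
    and "mass G {0<..hit} < \<infinity> \<Longrightarrow> mass G {hit..} < \<infinity> \<Longrightarrow> zero_transient P Y"
    and "mass G {0<..hit} < \<infinity> \<Longrightarrow> mass G {hit..} = \<infinity> \<Longrightarrow> zero_recurrent P Y"
proof -
  interpret cbi_duality "P 0" Y V G 0 by (rule cbi_dualityI[OF cbi])
  have mem: "s \<in> zero_set Y \<omega>" if "0 \<le> s" "Y s \<omega> = 0" for s \<omega>
    unfolding zero_set_def using that by (intro closure_subset[THEN subsetD]) simp
  {
    assume "mass G {0<..hit} = \<infinity>"
    from never_zero[OF hit_pos this] Y_start show "AE \<omega> in P 0. zero_set Y \<omega> = {0}"
    proof eventually_elim
      case (elim \<omega>)
      have "{t. 0 \<le> t \<and> Y t \<omega> = 0} = {0}" using elim by (auto simp: le_less)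
      then show ?case by (simp add: zero_set_def)
    qed
  next
    assume fin: "mass G {0<..hit} < \<infinity>" "mass G {hit..} < \<infinity>"
    then have "mass G {0<..} < \<infinity>" using integral_split by blast
    from zeros_bounded[OF this] zero_revisited[OF hit_pos fin(1) refl]
    show "zero_transient P Y"
      unfolding zero_transient_def
    proof eventually_elim
      case (elim \<omega>)
      obtain n where n: "\<forall>s\<ge>real n. Y s \<omega> \<noteq> 0" using elim by blast
      obtain s where s: "s > 0" "Y s \<omega> = 0" using elim by blast
      have "{t. 0 \<le> t \<and> Y t \<omega> = 0} \<subseteq> {0..real n}"
      proof
        fix t assume "t \<in> {t. 0 \<le> t \<and> Y t \<omega> = 0}"
        then show "t \<in> {0..real n}" using n by (cases "real n \<le> t") auto
      qed
      then have "bounded (zero_set Y \<omega>)"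
        unfolding zero_set_def by (intro bounded_closure bounded_subset[OF bounded_closed_interval])
      moreover have "zero_set Y \<omega> \<noteq> {0}"
      proof
        assume "zero_set Y \<omega> = {0}"
        moreover have "s \<in> zero_set Y \<omega>" using s by (intro mem) simp_all
        ultimately show False using s(1) by simp
      qed
      ultimately show ?case by (intro conjI)
    qed
  next
    assume fin: "mass G {0<..hit} < \<infinity>" "mass G {hit..} = \<infinity>"
    then have "mass G {0<..} = \<infinity>" 
      using integral_split by (simp add: less_top[symmetric])
    from zeros_unbounded[OF hit_pos fin(1) refl this]
    show "zero_recurrent P Y"
      unfolding zero_recurrent_def
    proof eventually_elim
      case (elim \<omega>)
      have "\<not> bounded (zero_set Y \<omega>)"
      proof
        assume "bounded (zero_set Y \<omega>)"
        then obtain b where b: "\<And>s. s \<in> zero_set Y \<omega> \<Longrightarrow> \<bar>s\<bar> \<le> b" by (auto simp: bounded_real)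
        obtain n where n: "b < real n" using reals_Archimedean2 by blast
        obtain s where s: "s \<ge> real n" "Y s \<omega> = 0" using elim by blast
        then have "s \<in> zero_set Y \<omega>" by (intro mem) simp_all
        then show False using b[of s] n s by simp
      qed
      moreover from this have "zero_set Y \<omega> \<noteq> {0}" by (metis finite.emptyI finite_imp_bounded finite_insert)
      ultimately show ?case by (intro conjI)
    qed
  }
qed

text \<open>The three cases for the masses are exhaustive, and their almost sure conclusions exclude
  one another under a probability measure, so the one-way implications become equivalences.\<close>

lemma zero_classification:
  assumes cbi: "CBI \<Psi> \<Phi> P Y"
  shows "(zero_transient P Y \<longleftrightarrow> mass G {0<..hit} < \<infinity> \<and> mass G {hit..} < \<infinity>) \<and>
    (zero_recurrent P Y \<longleftrightarrow> mass G {0<..hit} < \<infinity> \<and> mass G {hit..} = \<infinity>)"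
proof -
  interpret prob_space "P 0" using cbi by (simp add: CBI_def cadlag_markov_process_def)
  have excl: "\<not> (zero_transient P Y \<and> zero_recurrent P Y)"
  proof
    assume "zero_transient P Y \<and> zero_recurrent P Y"
    then have "AE \<omega> in P 0. zero_set Y \<omega> \<noteq> {0} \<and> bounded (zero_set Y \<omega>)"
      "AE \<omega> in P 0. zero_set Y \<omega> \<noteq> {0} \<and> \<not> bounded (zero_set Y \<omega>)"
      by (auto simp: zero_transient_def zero_recurrent_def)
    then have "AE \<omega> in P 0. False" by eventually_elim simp
    then show False by simp
  qed
  have triv: "\<not> zero_transient P Y \<and> \<not> zero_recurrent P Y" if AE0: "AE \<omega> in P 0. zero_set Y \<omega> = {0}"
  proof -
    have False if "AE \<omega> in P 0. zero_set Y \<omega> \<noteq> {0}"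
    proof -
      from that AE0 have "AE \<omega> in P 0. False" by eventually_elim simp
      then show False by simp
    qed
    then show ?thesis by (auto simp: zero_transient_def zero_recurrent_def)
  qed
  consider "mass G {0<..hit} = \<infinity>"
    | "mass G {0<..hit} < \<infinity>" "mass G {hit..} < \<infinity>"
    | "mass G {0<..hit} < \<infinity>" "mass G {hit..} = \<infinity>"
    unfolding infinity_ennreal_def using less_top by blast
  then show ?thesis
  proof cases
    case 1
    then show ?thesis using triv[OF zero_set_trichotomy(1)[OF cbi]] by simp
  next
    case 2
    have "zero_transient P Y" by (rule zero_set_trichotomy(2)[OF cbi 2])
    then show ?thesis using excl 2 by simp
  next
    case 3
    have "zero_recurrent P Y" by (rule zero_set_trichotomy(3)[OF cbi 3])
    then show ?thesis using excl 3 by simp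
  qed
qed

end

theorem corollary6:
  fixes \<Psi> \<Phi> :: "real \<Rightarrow> real"
    and P :: "ennreal \<Rightarrow> 'w measure" and Y :: "real \<Rightarrow> 'w \<Rightarrow> ennreal"
    and \<theta> :: real
  assumes "branching_mechanism \<Psi>" and "grey_condition \<Psi>"
    and "immigration_mechanism \<Phi>"
    and "CBI \<Psi> \<Phi> P Y"
    and "\<theta> > 0" and "\<forall>u\<ge>\<theta>. \<Psi> u > 0"
  shows
    "(zero_polar P Y \<longleftrightarrow>
        (\<integral>\<^sup>+z\<in>{\<theta>..}. ennreal (exp (LBINT u:{\<theta>..z}. \<Phi> u / \<Psi> u) * (1 / \<Psi> z)) \<partial>lborel) = \<infinity>)
     \<and> (critical_or_subcritical \<Psi> \<longrightarrow>
         (zero_transient P Y \<longleftrightarrow>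
            (\<integral>\<^sup>+z\<in>{\<theta>..}. ennreal (exp (LBINT u:{\<theta>..z}. \<Phi> u / \<Psi> u) * (1 / \<Psi> z)) \<partial>lborel) < \<infinity> \<and>
            (\<integral>\<^sup>+x\<in>{0<..\<theta>}. ennreal (exp (- (LBINT s:{x..\<theta>}. \<Phi> s / \<Psi> s)) * (1 / \<Psi> x)) \<partial>lborel) < \<infinity>)
         \<and>
         (zero_recurrent P Y \<longleftrightarrow>
            (\<integral>\<^sup>+z\<in>{\<theta>..}. ennreal (exp (LBINT u:{\<theta>..z}. \<Phi> u / \<Psi> u) * (1 / \<Psi> z)) \<partial>lborel) < \<infinity> \<and>
            (\<integral>\<^sup>+x\<in>{0<..\<theta>}. ennreal (exp (- (LBINT s:{x..\<theta>}. \<Phi> s / \<Psi> s)) * (1 / \<Psi> x)) \<partial>lborel) = \<infinity>))"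
proof -
  obtain \<nu> d \<sigma> where "branching \<nu> \<Psi> d \<sigma>" using branching_mechanismD[OF assms(1)] by blast
  then interpret branching \<nu> \<Psi> d \<sigma> .
  have "continuous_on {0<..} \<Psi>"
    by (intro convex_on_continuous convex_on_subset[OF mechanism_convex]) auto
  then have grey: "(\<integral>\<^sup>+q\<in>{\<theta>..}. ennreal (1 / \<Psi> q) \<partial>lborel) < \<infinity>"
    using assms by (intro grey_condition_at) auto
  interpret flow_immigration \<Psi> \<theta> \<Phi>
    by standard (use mechanism_0 mechanism_convex assms grey immigration_mechanism_properties[OF assms(3)] in auto)
  \<comment> \<open>Criticality enters through this equation, which identifies the second integral
    with the mass of \<open>G\<close> on \<open>[hit, \<infinity>)\<close>.\<close>
  have "\<rho> = 0" if "critical_or_subcritical \<Psi>"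
    using critical_or_subcritical_pos[OF assms(1) that assms(5)] assms(6) by (intro \<rho>_eq_0) auto
  then show ?thesis
    unfolding integral_near_infinity
    using zero_polar_iff[OF assms(4)] zero_classification[OF assms(4)] integral_near_zero by simp
qed

end
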